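(* Let $\Gamma$ be an $N=1$ ADE quiver over $\mathbb{C}$ with polynomials $P'_1,\dots,P'_n\in\mathbb{C}[x]$, and let $\mathcal{B}_\Gamma=\{w(P'_j) : w\in\mathfrak{W}_\Gamma,\ 1\le j\le n\}$. Assume that no element of $\mathcal{B}_\Gamma$ has a multiple root and that condition $( * )$ holds. Then the $N=1$ ADE quiver $\Gamma$ has finite representation type.
   Context: Dynkin diagrams. The ADE Dynkin diagrams have vertices $1,\dots,n$ and edges: $A_n$ ($n\ge1$): $i - (i+1)$ for $1\le i\le n-1$. $D_n$ ($n\ge4$): $i-(i+1)$ for $1\le i\le n-2$, together with $(n-2)- n$. $E_n$ ($n=6,7,8$): $i-(i+1)$ for $1\le i\le n-2$, together with $3 - n$. $N=1$ ADE quivers. Given an ADE Dynkin diagram $\Gamma$ and polynomials $P'_1,\dots,P'_n$, the associated $N=1$ ADE quiver (still denoted $\Gamma$) is the directed graph obtained by replacing each edge $i-j$ by two arrows $e_{ij}:j\to i$ and $e_{ji}:i\to j$ and adding a loop $e_i$ at each vertex $i$, with the relations $\sum_i s_{ij}e_{ji}e_{ij}+P'_j(e_j)=0$ for every vertex $j$, and $e_{ij}e_j=e_ie_{ij}$ for all adjacent $i,j$. Here $s_{ij}=0$ if $i,j$ are not adjacent, $s_{ij}=1$ if $i,j$ are adjacent and $i>j$, and $s_{ij}=-1$ if $i,j$ are adjacent and $i<j$. Representations. A representation $V$ consists of finite-dimensional vector spaces $V(i)$, linear maps $Q_{ij}:V(j)\to V(i)$ for adjacent $i,j$, and endomorphisms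 $\Phi_i$ of $V(i)$ with $\sum_i s_{ij}Q_{ji}Q_{ij}+P'_j(\Phi_j)=0$ for all $j$ and $Q_{ij}\Phi_j=\Phi_iQ_{ij}$ for all adjacent $i,j$. Morphisms are families of linear maps $V(i)\to V'(i)$ commuting with all the structure maps. Subrepresentations, direct sums, and indecomposable and simple representations are defined as usual. Finite representation type means that there are only finitely many isomorphism classes of indecomposable (finite-dimensional) representations. Weyl group action. $\mathfrak{W}_\Gamma$ is the Weyl group of the Dynkin diagram $\Gamma$, generated by simple reflections $r_1,\dots,r_n$. It acts on (formal) integer combinations of the $P'_j$ by $r_i(P'_i)=-P'_i$, $r_i(P'_j)=P'_j+P'_i$ if $j$ is adjacent to $i$, and $r_i(P'_j)=P'_j$ if $j\neq i$ is not adjacent to $i$. Thus if $w\alpha_j=\sum_i a_i\alpha_i$ in terms of simple roots, then $w(P'_j)=\sum_i a_iP'_i$. Condition $( * )$. Let $\mathcal{A}_\Gamma=\{\sum_i n_iP'_i : n_i\in\mathbb{Z},\ \text{not all } n_i \text{ zero}\}$. Condition $( * )$: no two elements $\sum_i n_iP'_i$ and $\sum_i m_iP'_i$ of $\mathcal{A}_\Gamma$ have a common root unless there is a constant $c$ with $m_i=cn_i$ for all $i$. *)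

theory Defs
  imports Complex_Main "HOL-Computational_Algebra.Polynomial"
begin

section \<open>ADE Dynkin diagrams\<close>

datatype dynkin = Dynkin_A nat | Dynkin_D nat | Dynkin_E nat

fun num_vertices :: "dynkin \<Rightarrow> nat" where
  "num_vertices (Dynkin_A n) = n"
| "num_vertices (Dynkin_D n) = n"
| "num_vertices (Dynkin_E n) = n"

fun is_ADE :: "dynkin \<Rightarrow> bool" where
  "is_ADE (Dynkin_A n) \<longleftrightarrow> n \<ge> 1"
| "is_ADE (Dynkin_D n) \<longleftrightarrow> n \<ge> 4"
| "is_ADE (Dynkin_E n) \<longleftrightarrow> n = 6 \<or> n = 7 \<or> n = 8"

definition vertices :: "dynkin \<Rightarrow> nat set" where
  "vertices \<Gamma> = {1..num_vertices \<Gamma>}"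

text \<open>Each edge is listed once; \<open>adjacent\<close> is the symmetric closure.\<close>

fun edge :: "dynkin \<Rightarrow> nat \<Rightarrow> nat \<Rightarrow> bool" where
  "edge (Dynkin_A n) i j \<longleftrightarrow> 1 \<le> i \<and> i \<le> n - 1 \<and> j = i + 1"
| "edge (Dynkin_D n) i j \<longleftrightarrow> (1 \<le> i \<and> i \<le> n - 2 \<and> j = i + 1) \<or> (i = n - 2 \<and> j = n)"
| "edge (Dynkin_E n) i j \<longleftrightarrow> (1 \<le> i \<and> i \<le> n - 2 \<and> j = i + 1) \<or> (i = 3 \<and> j = n)"

definition adjacent :: "dynkin \<Rightarrow> nat \<Rightarrow> nat \<Rightarrow> bool" where
  "adjacent \<Gamma> i j \<longleftrightarrow> edge \<Gamma> i j \<or> edge \<Gamma> j i"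

definition edge_sign :: "dynkin \<Rightarrow> nat \<Rightarrow> nat \<Rightarrow> int" where
  "edge_sign \<Gamma> i j = (if adjacent \<Gamma> i j then (if i > j then 1 else -1) else 0)"

lemma adjacent_irrefl: "is_ADE \<Gamma> \<Longrightarrow> \<not> adjacent \<Gamma> i i"
  by (cases \<Gamma>) (auto simp: adjacent_def)

lemma adjacent_sym: "adjacent \<Gamma> i j \<longleftrightarrow> adjacent \<Gamma> j i"
  by (auto simp: adjacent_def)

lemma adjacent_vertices:
  "is_ADE \<Gamma> \<Longrightarrow> adjacent \<Gamma> i j \<Longrightarrow> i \<in> vertices \<Gamma> \<and> j \<in> vertices \<Gamma>"
  by (cases \<Gamma>) (auto simp: adjacent_def vertices_def)


section \<open>Formal integer combinations and the Weyl group\<close>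

text \<open>A formal combination \<open>\<Sum>\<^sub>i a\<^sub>i \<alpha>\<^sub>i\<close> (equivalently, of the symbols \<open>P'\<^sub>i\<close>) is the coefficient
  function \<open>a :: nat \<Rightarrow> int\<close>; only its values on \<open>vertices \<Gamma>\<close> matter.\<close>

definition simple_root :: "nat \<Rightarrow> nat \<Rightarrow> int" where
  "simple_root j = (\<lambda>k. if k = j then 1 else 0)"

definition combination :: "dynkin \<Rightarrow> (nat \<Rightarrow> complex poly) \<Rightarrow> (nat \<Rightarrow> int) \<Rightarrow> complex poly" where
  "combination \<Gamma> P' a = (\<Sum>i\<in>vertices \<Gamma>. of_int (a i) * P' i)"

text \<open>The linear extension of \<open>\<alpha>\<^sub>i \<mapsto> - \<alpha>\<^sub>i\<close>, \<open>\<alpha>\<^sub>j \<mapsto> \<alpha>\<^sub>j + \<alpha>\<^sub>i\<close> for \<open>j\<close> adjacent to \<open>i\<close>,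
  and \<open>\<alpha>\<^sub>j \<mapsto> \<alpha>\<^sub>j\<close> otherwise: only the \<open>i\<close>-th coefficient changes.\<close>

definition simple_reflection :: "dynkin \<Rightarrow> nat \<Rightarrow> (nat \<Rightarrow> int) \<Rightarrow> (nat \<Rightarrow> int)" where
  "simple_reflection \<Gamma> i a = a(i := (\<Sum>j\<in>{j \<in> vertices \<Gamma>. adjacent \<Gamma> i j}. a j) - a i)"

lemma simple_reflection_simple_root:
  assumes "is_ADE \<Gamma>"
  shows "simple_reflection \<Gamma> i (simple_root i) = (\<lambda>k. - simple_root i k)"
    and "adjacent \<Gamma> i j \<Longrightarrow>
           simple_reflection \<Gamma> i (simple_root j) = (\<lambda>k. simple_root j k + simple_root i k)"
    and "j \<noteq> i \<Longrightarrow> \<not> adjacent \<Gamma> i j \<Longrightarrow> simple_reflection \<Gamma> i (simple_root j) = simple_root j"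
proof -
  have fin: "finite {j \<in> vertices \<Gamma>. adjacent \<Gamma> i j}" by (simp add: vertices_def)
  show "simple_reflection \<Gamma> i (simple_root i) = (\<lambda>k. - simple_root i k)"
    using adjacent_irrefl[OF assms, of i] fin
    by (auto simp: simple_reflection_def simple_root_def fun_eq_iff)
  show "simple_reflection \<Gamma> i (simple_root j) = (\<lambda>k. simple_root j k + simple_root i k)"
    if "adjacent \<Gamma> i j"
    using that adjacent_irrefl[OF assms, of i] adjacent_vertices[OF assms that] fin
    by (auto simp: simple_reflection_def simple_root_def fun_eq_iff)
  show "simple_reflection \<Gamma> i (simple_root j) = simple_root j"
    if "j \<noteq> i" "\<not> adjacent \<Gamma> i j"
    using that fin by (auto simp: simple_reflection_def simple_root_def fun_eq_iff)
qed

lemma simple_reflection_involution: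
  assumes "is_ADE \<Gamma>"
  shows "simple_reflection \<Gamma> i (simple_reflection \<Gamma> i a) = a"
proof -
  have "(\<Sum>j\<in>{j \<in> vertices \<Gamma>. adjacent \<Gamma> i j}. simple_reflection \<Gamma> i a j) =
        (\<Sum>j\<in>{j \<in> vertices \<Gamma>. adjacent \<Gamma> i j}. a j)"
    using adjacent_irrefl[OF assms, of i]
    by (intro sum.cong) (auto simp: simple_reflection_def)
  then show ?thesis
    by (auto simp: simple_reflection_def fun_eq_iff)
qed

text \<open>All words in the simple reflections. These form the generated group because each
  generator is its own inverse.\<close>

inductive_set weyl_group :: "dynkin \<Rightarrow> ((nat \<Rightarrow> int) \<Rightarrow> (nat \<Rightarrow> int)) set" for \<Gamma> :: dynkin where
  one: "id \<in> weyl_group \<Gamma>"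
| step: "\<lbrakk>w \<in> weyl_group \<Gamma>; i \<in> vertices \<Gamma>\<rbrakk> \<Longrightarrow> simple_reflection \<Gamma> i \<circ> w \<in> weyl_group \<Gamma>"

definition B_set :: "dynkin \<Rightarrow> (nat \<Rightarrow> complex poly) \<Rightarrow> complex poly set" where
  "B_set \<Gamma> P' =
     {combination \<Gamma> P' (w (simple_root j)) | w j. w \<in> weyl_group \<Gamma> \<and> j \<in> vertices \<Gamma>}"

text \<open>Under this definition every point is a multiple root of the zero polynomial.\<close>

definition has_multiple_root :: "complex poly \<Rightarrow> bool" where
  "has_multiple_root p \<longleftrightarrow> (\<exists>x. [:- x, 1:] ^ 2 dvd p)"

text \<open>The elements of \<open>\<A>\<^sub>\<Gamma>\<close> are compared as formal combinations, that is, through their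
  coefficient vectors.\<close>

definition condition_star :: "dynkin \<Rightarrow> (nat \<Rightarrow> complex poly) \<Rightarrow> bool" where
  "condition_star \<Gamma> P' \<longleftrightarrow>
     (\<forall>a b :: nat \<Rightarrow> int.
        (\<exists>i\<in>vertices \<Gamma>. a i \<noteq> 0) \<longrightarrow> (\<exists>i\<in>vertices \<Gamma>. b i \<noteq> 0) \<longrightarrow>
        (\<exists>x. poly (combination \<Gamma> P' a) x = 0 \<and> poly (combination \<Gamma> P' b) x = 0) \<longrightarrow>
        (\<exists>c :: complex. \<forall>i\<in>vertices \<Gamma>. of_int (b i) = c * of_int (a i)))"


section \<open>Representations\<close>

text \<open>The spaces of a representation are finite-dimensional subspaces of an ambient complex
  vector space \<open>'v\<close> with scalar multiplication \<open>scale\<close>. The maps are functions on \<open>'v\<close> whose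
  values outside the relevant subspace are irrelevant; \<open>edge_map V i j\<close> goes from
  \<open>vspace V j\<close> to \<open>vspace V i\<close>.\<close>

record 'v quiver_rep =
  vspace :: "nat \<Rightarrow> 'v set"
  edge_map :: "nat \<Rightarrow> nat \<Rightarrow> 'v \<Rightarrow> 'v"
  loop_map :: "nat \<Rightarrow> 'v \<Rightarrow> 'v"

definition linear_between ::
  "(complex \<Rightarrow> 'v::ab_group_add \<Rightarrow> 'v) \<Rightarrow> 'v set \<Rightarrow> 'v set \<Rightarrow> ('v \<Rightarrow> 'v) \<Rightarrow> bool" where
  "linear_between scale U W f \<longleftrightarrow>
     (\<forall>u\<in>U. f u \<in> W) \<and>
     (\<forall>u\<in>U. \<forall>v\<in>U. f (u + v) = f u + f v) \<and>
     (\<forall>c. \<forall>u\<in>U. f (scale c u) = scale c (f u))"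

definition poly_map ::
  "(complex \<Rightarrow> 'v::ab_group_add \<Rightarrow> 'v) \<Rightarrow> complex poly \<Rightarrow> ('v \<Rightarrow> 'v) \<Rightarrow> 'v \<Rightarrow> 'v" where
  "poly_map scale p f v = (\<Sum>k\<le>degree p. scale (coeff p k) ((f ^^ k) v))"

definition fin_dim_subspace ::
  "(complex \<Rightarrow> 'v::ab_group_add \<Rightarrow> 'v) \<Rightarrow> 'v set \<Rightarrow> bool" where
  "fin_dim_subspace scale U \<longleftrightarrow>
     module.subspace scale U \<and> (\<exists>B. finite B \<and> U = module.span scale B)"

definition is_rep ::
  "(complex \<Rightarrow> 'v::ab_group_add \<Rightarrow> 'v) \<Rightarrow> dynkin \<Rightarrow> (nat \<Rightarrow> complex poly) \<Rightarrow> 'v quiver_rep \<Rightarrow> bool"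
  where
  "is_rep scale \<Gamma> P' V \<longleftrightarrow>
     (\<forall>i\<in>vertices \<Gamma>. fin_dim_subspace scale (vspace V i)) \<and>
     (\<forall>i\<in>vertices \<Gamma>. \<forall>j\<in>vertices \<Gamma>. adjacent \<Gamma> i j \<longrightarrow>
        linear_between scale (vspace V j) (vspace V i) (edge_map V i j)) \<and>
     (\<forall>i\<in>vertices \<Gamma>. linear_between scale (vspace V i) (vspace V i) (loop_map V i)) \<and>
     (\<forall>j\<in>vertices \<Gamma>. \<forall>v\<in>vspace V j.
        (\<Sum>i\<in>vertices \<Gamma>. scale (of_int (edge_sign \<Gamma> i j)) (edge_map V j i (edge_map V i j v)))
          + poly_map scale (P' j) (loop_map V j) v = 0) \<and>
     (\<forall>i\<in>vertices \<Gamma>. \<forall>j\<in>vertices \<Gamma>. adjacent \<Gamma> i j \<longrightarrow>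
        (\<forall>v\<in>vspace V j. edge_map V i j (loop_map V j v) = loop_map V i (edge_map V i j v)))"

definition is_morphism ::
  "(complex \<Rightarrow> 'v::ab_group_add \<Rightarrow> 'v) \<Rightarrow> dynkin \<Rightarrow>
   'v quiver_rep \<Rightarrow> 'v quiver_rep \<Rightarrow> (nat \<Rightarrow> 'v \<Rightarrow> 'v) \<Rightarrow> bool" where
  "is_morphism scale \<Gamma> V W f \<longleftrightarrow>
     (\<forall>i\<in>vertices \<Gamma>. linear_between scale (vspace V i) (vspace W i) (f i)) \<and>
     (\<forall>i\<in>vertices \<Gamma>. \<forall>j\<in>vertices \<Gamma>. adjacent \<Gamma> i j \<longrightarrow>
        (\<forall>v\<in>vspace V j. f i (edge_map V i j v) = edge_map W i j (f j v))) \<and>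
     (\<forall>i\<in>vertices \<Gamma>. \<forall>v\<in>vspace V i. f i (loop_map V i v) = loop_map W i (f i v))"

definition isomorphic_reps ::
  "(complex \<Rightarrow> 'v::ab_group_add \<Rightarrow> 'v) \<Rightarrow> dynkin \<Rightarrow> 'v quiver_rep \<Rightarrow> 'v quiver_rep \<Rightarrow> bool" where
  "isomorphic_reps scale \<Gamma> V W \<longleftrightarrow>
     (\<exists>f. is_morphism scale \<Gamma> V W f \<and>
          (\<forall>i\<in>vertices \<Gamma>. bij_betw (f i) (vspace V i) (vspace W i)))"

text \<open>A subrepresentation is given by its family of subspaces, with the restricted maps.\<close>

definition is_subrep ::
  "(complex \<Rightarrow> 'v::ab_group_add \<Rightarrow> 'v) \<Rightarrow> dynkin \<Rightarrow> 'v quiver_rep \<Rightarrow> (nat \<Rightarrow> 'v set) \<Rightarrow> bool" where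
  "is_subrep scale \<Gamma> V U \<longleftrightarrow>
     (\<forall>i\<in>vertices \<Gamma>. module.subspace scale (U i) \<and> U i \<subseteq> vspace V i) \<and>
     (\<forall>i\<in>vertices \<Gamma>. \<forall>j\<in>vertices \<Gamma>. adjacent \<Gamma> i j \<longrightarrow> edge_map V i j ` U j \<subseteq> U i) \<and>
     (\<forall>i\<in>vertices \<Gamma>. loop_map V i ` U i \<subseteq> U i)"

definition is_direct_sum ::
  "dynkin \<Rightarrow> 'v::ab_group_add quiver_rep \<Rightarrow> (nat \<Rightarrow> 'v set) \<Rightarrow> (nat \<Rightarrow> 'v set) \<Rightarrow> bool" where
  "is_direct_sum \<Gamma> V U W \<longleftrightarrow>
     (\<forall>i\<in>vertices \<Gamma>. vspace V i = {u + w | u w. u \<in> U i \<and> w \<in> W i} \<and> U i \<inter> W i = {0})"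

definition nonzero_family :: "dynkin \<Rightarrow> (nat \<Rightarrow> 'v::ab_group_add set) \<Rightarrow> bool" where
  "nonzero_family \<Gamma> U \<longleftrightarrow> (\<exists>i\<in>vertices \<Gamma>. U i \<noteq> {0})"

definition indecomposable_rep ::
  "(complex \<Rightarrow> 'v::ab_group_add \<Rightarrow> 'v) \<Rightarrow> dynkin \<Rightarrow> (nat \<Rightarrow> complex poly) \<Rightarrow> 'v quiver_rep \<Rightarrow> bool"
  where
  "indecomposable_rep scale \<Gamma> P' V \<longleftrightarrow>
     is_rep scale \<Gamma> P' V \<and> nonzero_family \<Gamma> (vspace V) \<and>
     \<not> (\<exists>U W. is_subrep scale \<Gamma> V U \<and> is_subrep scale \<Gamma> V W \<and> is_direct_sum \<Gamma> V U W \<and>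
             nonzero_family \<Gamma> U \<and> nonzero_family \<Gamma> W)"

text \<open>When \<open>'v\<close> is infinite-dimensional, every finite-dimensional representation is isomorphic to
  one inside \<open>'v\<close>, so this counts all indecomposables; for smaller \<open>'v\<close> it counts those that
  embed. Results quantified over all ambient spaces therefore lose nothing.\<close>

definition finite_representation_type ::
  "(complex \<Rightarrow> 'v::ab_group_add \<Rightarrow> 'v) \<Rightarrow> dynkin \<Rightarrow> (nat \<Rightarrow> complex poly) \<Rightarrow> bool" where
  "finite_representation_type scale \<Gamma> P' \<longleftrightarrow>
     finite ({V. indecomposable_rep scale \<Gamma> P' V} //
       {(V, W). indecomposable_rep scale \<Gamma> P' V \<and> indecomposable_rep scale \<Gamma> P' W \<and>
                isomorphic_reps scale \<Gamma> V W})"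

end

theory Submission
  imports Defs "HOL-Computational_Algebra.Fundamental_Theorem_Algebra"
begin

text \<open>
  The loops \<open>\<Phi>\<close> commute with all arrows, so on a simple representation they act as one scalar
  \<open>\<lambda>\<close>, and a simple representation is a simple module over the deformed preprojective algebra
  with parameters \<open>t\<^sub>j = P'\<^sub>j(\<lambda>)\<close>. Everything follows from the claim that \<^emph>\<open>every indecomposable
  representation is simple, and is determined by \<open>\<lambda>\<close>\<close>, together with the fact that only finitely
  many \<open>\<lambda>\<close> occur.

  The tool is Crawley-Boevey's complex for two representations \<open>V, W\<close> with the same scalar,

    \<open>\<Oplus>\<^sub>i Hom(V\<^sub>i, W\<^sub>i) \<rightarrow> \<Oplus>\<^sub>i\<^sub>-\<^sub>j Hom(V\<^sub>j, W\<^sub>i) \<rightarrow> \<Oplus>\<^sub>i Hom(V\<^sub>i, W\<^sub>i)\<close>,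

  whose first kernel is \<open>Hom(V,W)\<close>, whose last cokernel is dual to \<open>Hom(W,V)\<close>, and whose middle
  homology classifies extensions on which the loops stay scalar. Counting dimensions gives
  \<open>dim Hom(V,W) + dim Hom(W,V) \<ge> (dim V, dim W)\<close> for the Cartan form, with equality exactly when the
  complex is exact in the middle (\<open>hom_bound\<close>, \<open>hom_exact\<close>).

  For a simple \<open>V\<close> Schur's lemma makes the left side \<open>2\<close>. The Cartan form is positive definite and
  even, so the dimension vector \<open>d\<close> is a positive root (\<open>simple_dimvec_root\<close>). Taking traces in the
  vertex relations gives \<open>\<Sum>\<^sub>j d\<^sub>j P'\<^sub>j(\<lambda>) = 0\<close>. There are finitely many positive roots, each lies in the
  Weyl orbit of a simple root, and so \<open>\<Sum>\<^sub>j d\<^sub>j P'\<^sub>j\<close> is a nonzero polynomial with simple roots; hence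
  finitely many \<open>\<lambda>\<close>. If \<open>V\<close> and \<open>W\<close> are simple with the same \<open>\<lambda>\<close>, then condition \<open>(*)\<close> makes their
  dimension vectors proportional, hence equal, and \<open>(d, d) = 2 > 0\<close> forces a nonzero homomorphism,
  so \<open>V \<cong> W\<close> (\<open>simple_iso\<close>).

  It remains to split extensions of a simple \<open>D\<close> by a simple \<open>S\<close> (\<open>extension_splits\<close>). If the scalars
  \<open>\<mu>\<close> of \<open>D\<close> and \<open>\<lambda>\<close> of \<open>S\<close> differ, the image of \<open>\<Phi> - \<lambda>\<close> is a complement. If they agree, then \<open>D \<cong> S\<close>, and
  \<open>\<Phi> - \<lambda>\<close> induces a homomorphism \<open>D \<rightarrow> S\<close>, that is, a multiple \<open>c\<close> of the isomorphism. The trace of the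
  vertex relations now gives \<open>c \<Sum>\<^sub>j d\<^sub>j P''\<^sub>j(\<lambda>) = 0\<close>, and since \<open>\<lambda>\<close> is not a multiple root, \<open>c = 0\<close>. The
  loops are therefore scalar, and the extension splits because the complex is exact for
  \<open>(d, d) = 2\<close>. Induction on the dimension then gives every simple subrepresentation a complement
  (\<open>simple_subrep_complement\<close>).
\<close>

section \<open>Positive roots of the ADE diagrams\<close>

definition nbrs :: "dynkin \<Rightarrow> nat \<Rightarrow> nat set" where
  "nbrs \<Gamma> i = {j \<in> vertices \<Gamma>. adjacent \<Gamma> i j}"

text \<open>The symmetric form of the Cartan matrix, so that \<open>cartan_form \<Gamma> a a\<close> is twice the Tits form.\<close>

definition cartan_form :: "dynkin \<Rightarrow> (nat \<Rightarrow> int) \<Rightarrow> (nat \<Rightarrow> int) \<Rightarrow> int" where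
  "cartan_form \<Gamma> a b = (\<Sum>i\<in>vertices \<Gamma>. a i * (2 * b i - (\<Sum>j\<in>nbrs \<Gamma> i. b j)))"

lemma finite_vertices [simp]: "finite (vertices \<Gamma>)"
  by (simp add: vertices_def)

lemma finite_nbrs [simp]: "finite (nbrs \<Gamma> i)"
  by (simp add: nbrs_def)

lemma sum_nbrs_swap:
  fixes f :: "nat \<Rightarrow> nat \<Rightarrow> 'a::comm_monoid_add"
  shows "(\<Sum>i\<in>vertices \<Gamma>. \<Sum>j\<in>nbrs \<Gamma> i. f i j) = (\<Sum>i\<in>vertices \<Gamma>. \<Sum>j\<in>nbrs \<Gamma> i. f j i)"
proof -
  have "(\<Sum>i\<in>vertices \<Gamma>. \<Sum>j\<in>nbrs \<Gamma> i. f i j) =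
        (\<Sum>i\<in>vertices \<Gamma>. \<Sum>j\<in>vertices \<Gamma>. if adjacent \<Gamma> i j then f i j else 0)"
    by (simp add: nbrs_def sum.inter_filter)
  also have "\<dots> = (\<Sum>j\<in>vertices \<Gamma>. \<Sum>i\<in>vertices \<Gamma>. if adjacent \<Gamma> i j then f i j else 0)"
    by (rule sum.swap)
  also have "\<dots> = (\<Sum>j\<in>vertices \<Gamma>. \<Sum>i\<in>nbrs \<Gamma> j. f i j)"
    by (simp add: nbrs_def sum.inter_filter adjacent_sym)
  finally show ?thesis .
qed

text \<open>The weight is the coefficient vector of \<open>2\<rho>\<close>, the sum of all positive roots: its pairing with every
  simple root is \<open>2\<close>. In type \<open>A\<close> and on the long chain of type \<open>D\<close> its entries are quadratic in \<open>i\<close>.\<close>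

lemma exists_weight:
  assumes "is_ADE \<Gamma>"
  shows "\<exists>h :: nat \<Rightarrow> int. \<forall>i\<in>vertices \<Gamma>. h i > 0 \<and> (\<Sum>j\<in>nbrs \<Gamma> i. h j) = 2 * h i - 2"
proof (cases \<Gamma>)
  case (Dynkin_A n)
  define h :: "nat \<Rightarrow> int" where "h i = int i * (int n + 1 - int i)" for i
  have "h i > 0 \<and> (\<Sum>j\<in>nbrs \<Gamma> i. h j) = 2 * h i - 2" if "i \<in> vertices \<Gamma>" for i
  proof -
    from that have i: "1 \<le> i" "i \<le> n" by (auto simp: Dynkin_A vertices_def)
    have "nbrs \<Gamma> i = {i - 1, i + 1} \<inter> {1..n}"
      using i by (auto simp: nbrs_def Dynkin_A vertices_def adjacent_def)
    moreover have "(\<Sum>j\<in>{i - 1, i + 1} \<inter> {1..n}. h j) = (\<Sum>j\<in>{i - 1, i + 1}. h j)"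
      using i by (intro sum.mono_neutral_left) (auto simp: h_def le_Suc_eq)
    moreover have "h i > 0" using i by (auto simp: h_def)
    moreover have "(\<Sum>j\<in>{i - 1, i + 1}. h j) = 2 * h i - 2"
      using i by (simp add: h_def of_nat_diff algebra_simps)
    ultimately show ?thesis by metis
  qed
  then show ?thesis by blast
next
  case (Dynkin_D n)
  then have n: "n \<ge> 4" using assms by simp
  define h :: "nat \<Rightarrow> int" where
    "h i = (if i \<le> n - 2 then int i * (2 * int n - 1 - int i) else int n * (int n - 1) div 2)" for i
  have half: "2 * (int n * (int n - 1) div 2) = int n * (int n - 1)" by simp
  have hn: "2 * h (n - 1) = int n * (int n - 1)" "2 * h n = int n * (int n - 1)"
    using n unfolding h_def by (auto simp: half simp del: dvd_mult_div_cancel)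
  have hpos: "h i > 0" if "1 \<le> i" "i \<le> n" for i
  proof (cases "i \<le> n - 2")
    case True then show ?thesis using that n by (auto simp: h_def)
  next
    case False
    then have "2 * h i = int n * (int n - 1)"
    proof -
      have "i = n - 1 \<or> i = n" using False that by linarith
      then show ?thesis using hn by auto
    qed
    moreover have "int n * (int n - 1) > 0" using n by simp
    ultimately show ?thesis by linarith
  qed
  have "(\<Sum>j\<in>nbrs \<Gamma> i. h j) = 2 * h i - 2" if "i \<in> vertices \<Gamma>" for i
  proof -
    from that have i: "1 \<le> i" "i \<le> n" by (auto simp: Dynkin_D vertices_def)
    consider "i \<le> n - 3" | "i = n - 2" | "i = n - 1" | "i = n" using i by linarith
    then show ?thesis
    proof cases
      case 1
      have "nbrs \<Gamma> i = {i - 1, i + 1} \<inter> {1..n}"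
        using i 1 n by (auto simp: nbrs_def Dynkin_D vertices_def adjacent_def)
      moreover have "(\<Sum>j\<in>{i - 1, i + 1} \<inter> {1..n}. h j) = (\<Sum>j\<in>{i - 1, i + 1}. h j)"
        using i 1 n by (intro sum.mono_neutral_left) (auto simp: h_def le_Suc_eq)
      ultimately show ?thesis using i 1 n
        by (auto simp: h_def algebra_simps of_nat_diff)
    next
      case 2
      have "nbrs \<Gamma> i = {n - 3, n - 1, n}"
        using 2 n by (auto simp: nbrs_def Dynkin_D vertices_def adjacent_def)
      moreover have "n - 3 \<noteq> n - 1" "n - 3 \<noteq> n" "n - 1 \<noteq> n" using n by auto
      ultimately have "(\<Sum>j\<in>nbrs \<Gamma> i. h j) = h (n - 3) + h (n - 1) + h n" by simp
      moreover have "h (n - 3) = (int n - 3) * (int n + 2)" "h i = (int n - 2) * (int n + 1)"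
        using 2 n by (auto simp: h_def of_nat_diff)
      ultimately show ?thesis using hn by (simp add: algebra_simps)
    next
      case 3
      have "nbrs \<Gamma> i = {n - 2}"
        using 3 n by (auto simp: nbrs_def Dynkin_D vertices_def adjacent_def)
      then show ?thesis using hn 3 n by (simp add: h_def of_nat_diff algebra_simps)
    next
      case 4
      have "nbrs \<Gamma> i = {n - 2}"
        using 4 n by (auto simp: nbrs_def Dynkin_D vertices_def adjacent_def)
      then show ?thesis using hn 4 n by (simp add: h_def of_nat_diff algebra_simps)
    qed
  qed
  then show ?thesis using hpos by (auto simp: Dynkin_D vertices_def intro!: exI[of _ h])
next
  case (Dynkin_E n)
  then consider "n = 6" | "n = 7" | "n = 8" using assms by auto
  then show ?thesis
  proof cases
    case 1
    have v: "vertices \<Gamma> = {1,2,3,4,5,6}" using 1 Dynkin_E by (auto simp: vertices_def)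
    have "nbrs \<Gamma> 1 = {2}" "nbrs \<Gamma> 2 = {1,3}" "nbrs \<Gamma> 3 = {2,4,6}" "nbrs \<Gamma> 4 = {3,5}"
      "nbrs \<Gamma> 5 = {4}" "nbrs \<Gamma> 6 = {3}"
      using 1 Dynkin_E by (auto simp: nbrs_def vertices_def adjacent_def)
    then show ?thesis
      by (intro exI[of _ "\<lambda>i. [0,16,30,42,30,16,22] ! i"]) (simp add: v)
  next
    case 2
    have v: "vertices \<Gamma> = {1,2,3,4,5,6,7}" using 2 Dynkin_E by (auto simp: vertices_def)
    have "nbrs \<Gamma> 1 = {2}" "nbrs \<Gamma> 2 = {1,3}" "nbrs \<Gamma> 3 = {2,4,7}" "nbrs \<Gamma> 4 = {3,5}"
      "nbrs \<Gamma> 5 = {4,6}" "nbrs \<Gamma> 6 = {5}" "nbrs \<Gamma> 7 = {3}"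
      using 2 Dynkin_E by (auto simp: nbrs_def vertices_def adjacent_def)
    then show ?thesis
      by (intro exI[of _ "\<lambda>i. [0,34,66,96,75,52,27,49] ! i"]) (simp add: v)
  next
    case 3
    have v: "vertices \<Gamma> = {1,2,3,4,5,6,7,8}" using 3 Dynkin_E by (auto simp: vertices_def)
    have "nbrs \<Gamma> 1 = {2}" "nbrs \<Gamma> 2 = {1,3}" "nbrs \<Gamma> 3 = {2,4,8}" "nbrs \<Gamma> 4 = {3,5}"
      "nbrs \<Gamma> 5 = {4,6}" "nbrs \<Gamma> 6 = {5,7}" "nbrs \<Gamma> 7 = {6}" "nbrs \<Gamma> 8 = {3}"
      using 3 Dynkin_E by (auto simp: nbrs_def vertices_def adjacent_def)
    then show ?thesis
      by (intro exI[of _ "\<lambda>i. [0,92,182,270,220,168,114,58,136] ! i"]) (simp add: v)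
  qed
qed

lemma cartan_form_expand:
  "cartan_form \<Gamma> a b =
     2 * (\<Sum>i\<in>vertices \<Gamma>. a i * b i) - (\<Sum>i\<in>vertices \<Gamma>. \<Sum>j\<in>nbrs \<Gamma> i. a i * b j)"
  by (simp add: cartan_form_def algebra_simps sum_subtractf sum_distrib_left)

text \<open>On an edge, \<open>2 x\<^sub>i x\<^sub>j \<le> (h\<^sub>j / h\<^sub>i) x\<^sub>i\<^sup>2 + (h\<^sub>i / h\<^sub>j) x\<^sub>j\<^sup>2\<close>; summing over the edges and using the relation
  for \<open>h\<close> leaves a diagonal form. One inequality thus yields both positive definiteness and the
  boundedness of the vectors of norm \<open>2\<close>, uniformly in the three types.\<close>

lemma cartan_form_lower_bound:
  fixes h a :: "nat \<Rightarrow> int"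
  assumes h: "\<forall>i\<in>vertices \<Gamma>. h i > 0 \<and> (\<Sum>j\<in>nbrs \<Gamma> i. h j) = 2 * h i - 2"
  shows "(\<Sum>i\<in>vertices \<Gamma>. 2 * (of_int (a i))\<^sup>2 / of_int (h i)) \<le> (of_int (cartan_form \<Gamma> a a) :: real)"
proof -
  define x H where "x i = (of_int (a i) :: real)" and "H i = (of_int (h i) :: real)" for i
  have Hpos: "H i > 0" if "i \<in> vertices \<Gamma>" for i using h that by (simp add: H_def)
  have Hsum: "(\<Sum>j\<in>nbrs \<Gamma> i. H j) = 2 * H i - 2" if "i \<in> vertices \<Gamma>" for i
  proof -
    have "(\<Sum>j\<in>nbrs \<Gamma> i. H j) = of_int (\<Sum>j\<in>nbrs \<Gamma> i. h j)" by (simp add: H_def)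
    also have "\<dots> = 2 * H i - 2" using h that by (simp add: H_def)
    finally show ?thesis .
  qed
  have edge: "2 * (x i * x j) \<le> H j * ((x i)\<^sup>2 / H i) + H i * ((x j)\<^sup>2 / H j)"
    if "i \<in> vertices \<Gamma>" "j \<in> nbrs \<Gamma> i" for i j
  proof -
    have p: "H i > 0" "H j > 0" using that Hpos by (auto simp: nbrs_def)
    have "0 \<le> (H j * x i - H i * x j)\<^sup>2 / (H i * H j)" using p by simp
    also have "\<dots> = H j * ((x i)\<^sup>2 / H i) + H i * ((x j)\<^sup>2 / H j) - 2 * (x i * x j)"
      using p by (simp add: field_simps power2_eq_square)
    finally show ?thesis by simp
  qed
  have "2 * (\<Sum>i\<in>vertices \<Gamma>. \<Sum>j\<in>nbrs \<Gamma> i. x i * x j)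
      \<le> (\<Sum>i\<in>vertices \<Gamma>. \<Sum>j\<in>nbrs \<Gamma> i. H j * ((x i)\<^sup>2 / H i))
        + (\<Sum>i\<in>vertices \<Gamma>. \<Sum>j\<in>nbrs \<Gamma> i. H i * ((x j)\<^sup>2 / H j))"
    unfolding sum_distrib_left sum.distrib[symmetric] by (intro sum_mono edge)
  also have "(\<Sum>i\<in>vertices \<Gamma>. \<Sum>j\<in>nbrs \<Gamma> i. H i * ((x j)\<^sup>2 / H j)) =
             (\<Sum>i\<in>vertices \<Gamma>. \<Sum>j\<in>nbrs \<Gamma> i. H j * ((x i)\<^sup>2 / H i))"
    by (rule sum_nbrs_swap)
  also have "(\<Sum>i\<in>vertices \<Gamma>. \<Sum>j\<in>nbrs \<Gamma> i. H j * ((x i)\<^sup>2 / H i)) =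
             (\<Sum>i\<in>vertices \<Gamma>. (2 * H i - 2) * ((x i)\<^sup>2 / H i))"
    by (intro sum.cong refl) (simp only: sum_distrib_right[symmetric] Hsum)
  also have "\<dots> = (\<Sum>i\<in>vertices \<Gamma>. 2 * (x i)\<^sup>2 - 2 * (x i)\<^sup>2 / H i)"
  proof (intro sum.cong refl)
    fix i assume "i \<in> vertices \<Gamma>"
    then have "H i > 0" by (rule Hpos)
    then show "(2 * H i - 2) * ((x i)\<^sup>2 / H i) = 2 * (x i)\<^sup>2 - 2 * (x i)\<^sup>2 / H i"
      by (simp add: field_simps)
  qed
  also have "\<dots> = (\<Sum>i\<in>vertices \<Gamma>. 2 * (x i)\<^sup>2) - (\<Sum>i\<in>vertices \<Gamma>. 2 * (x i)\<^sup>2 / H i)"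
    by (rule sum_subtractf)
  also have "(\<Sum>i\<in>vertices \<Gamma>. 2 * (x i)\<^sup>2) = 2 * (\<Sum>i\<in>vertices \<Gamma>. x i * x i)"
    by (simp add: power2_eq_square sum_distrib_left)
  finally have "(\<Sum>i\<in>vertices \<Gamma>. 2 * (x i)\<^sup>2 / H i) \<le>
     2 * (\<Sum>i\<in>vertices \<Gamma>. x i * x i) - (\<Sum>i\<in>vertices \<Gamma>. \<Sum>j\<in>nbrs \<Gamma> i. x i * x j)"
    by linarith
  also have "\<dots> = of_int (cartan_form \<Gamma> a a)"
    by (simp add: cartan_form_expand x_def)
  finally show ?thesis by (simp add: x_def H_def)
qed

lemma cartan_form_pos:
  assumes "is_ADE \<Gamma>" "i \<in> vertices \<Gamma>" "a i \<noteq> 0"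
  shows "cartan_form \<Gamma> a a > 0"
proof -
  obtain h :: "nat \<Rightarrow> int"
    where h: "\<forall>i\<in>vertices \<Gamma>. h i > 0 \<and> (\<Sum>j\<in>nbrs \<Gamma> i. h j) = 2 * h i - 2"
    using exists_weight[OF assms(1)] by blast
  have "0 < (\<Sum>i\<in>vertices \<Gamma>. 2 * (of_int (a i))\<^sup>2 / of_int (h i) :: real)"
    using assms h by (intro sum_pos2[where i = i]) (auto intro: less_imp_le)
  also have "\<dots> \<le> of_int (cartan_form \<Gamma> a a)" by (rule cartan_form_lower_bound[OF h])
  finally show ?thesis by simp
qed

definition positive_roots :: "dynkin \<Rightarrow> (nat \<Rightarrow> int) set" where
  "positive_roots \<Gamma> = {a. (\<forall>i. a i \<ge> 0) \<and> (\<forall>i. i \<notin> vertices \<Gamma> \<longrightarrow> a i = 0) \<and> cartan_form \<Gamma> a a = 2}"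

lemma finite_positive_roots:
  assumes "is_ADE \<Gamma>"
  shows "finite (positive_roots \<Gamma>)"
proof -
  obtain h :: "nat \<Rightarrow> int"
    where h: "\<forall>i\<in>vertices \<Gamma>. h i > 0 \<and> (\<Sum>j\<in>nbrs \<Gamma> i. h j) = 2 * h i - 2"
    using exists_weight[OF assms(1)] by blast
  define M where "M = (\<Sum>i\<in>vertices \<Gamma>. h i)"
  have "a i \<le> M" if a: "a \<in> positive_roots \<Gamma>" and i: "i \<in> vertices \<Gamma>" for a i
  proof -
    have hi: "h i > 0" using h i by blast
    have "2 * (of_int (a i))\<^sup>2 / of_int (h i) \<le> (\<Sum>i\<in>vertices \<Gamma>. 2 * (of_int (a i))\<^sup>2 / of_int (h i) :: real)"
      using h i by (intro member_le_sum) (auto intro: less_imp_le)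
    also have "\<dots> \<le> 2"
      using cartan_form_lower_bound[OF h, of a] a by (simp add: positive_roots_def)
    finally have "(of_int (a i))\<^sup>2 \<le> (of_int (h i) :: real)" using hi by (simp add: field_simps)
    then have "(a i)\<^sup>2 \<le> h i" by (metis of_int_le_iff of_int_power)
    moreover have "0 \<le> a i * (a i - 1)"
      using a by (cases "a i = 0") (auto simp: positive_roots_def order_less_le intro!: mult_nonneg_nonneg)
    then have "a i \<le> (a i)\<^sup>2" by (simp add: power2_eq_square algebra_simps)
    moreover have "h i \<le> M" unfolding M_def using h i by (intro member_le_sum) (auto intro: less_imp_le)
    ultimately show ?thesis by linarith
  qed
  then have "positive_roots \<Gamma> \<subseteq> {a. \<forall>i. (i \<in> vertices \<Gamma> \<longrightarrow> a i \<in> {0..M}) \<and> (i \<notin> vertices \<Gamma> \<longrightarrow> a i = 0)}"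
    by (auto simp: positive_roots_def)
  moreover have "finite {a. \<forall>i. (i \<in> vertices \<Gamma> \<longrightarrow> a i \<in> {0..M}) \<and> (i \<notin> vertices \<Gamma> \<longrightarrow> a i = 0)}"
    by (intro finite_set_of_finite_funs) auto
  ultimately show ?thesis by (rule finite_subset)
qed

text \<open>The off-diagonal part counts every edge twice.\<close>

lemma cartan_form_even:
  assumes "is_ADE \<Gamma>"
  shows "even (cartan_form \<Gamma> a a)"
proof -
  have "(\<Sum>i\<in>vertices \<Gamma>. \<Sum>j\<in>nbrs \<Gamma> i. a i * a j) =
        (\<Sum>i\<in>vertices \<Gamma>. \<Sum>j\<in>nbrs \<Gamma> i. (if i < j then a i * a j else 0) + (if j < i then a j * a i else 0))"
    using adjacent_irrefl[OF assms]
    by (intro sum.cong refl) (auto simp: nbrs_def not_less_iff_gr_or_eq)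
  also have "\<dots> = (\<Sum>i\<in>vertices \<Gamma>. \<Sum>j\<in>nbrs \<Gamma> i. if i < j then a i * a j else 0)
      + (\<Sum>i\<in>vertices \<Gamma>. \<Sum>j\<in>nbrs \<Gamma> i. if j < i then a j * a i else 0)"
    by (simp add: sum.distrib)
  also have "(\<Sum>i\<in>vertices \<Gamma>. \<Sum>j\<in>nbrs \<Gamma> i. if j < i then a j * a i else 0) =
      (\<Sum>i\<in>vertices \<Gamma>. \<Sum>j\<in>nbrs \<Gamma> i. if i < j then a i * a j else 0)"
    by (rule sum_nbrs_swap)
  finally show ?thesis by (simp add: cartan_form_expand)
qed

text \<open>Descent on the height. Since \<open>\<Sum>\<^sub>i a\<^sub>i (a, \<alpha>\<^sub>i) = 2\<close>, some \<open>i\<close> has \<open>a\<^sub>i > 0\<close> and \<open>(a, \<alpha>\<^sub>i) > 0\<close>. Unless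
  \<open>a = \<alpha>\<^sub>i\<close>, positive definiteness of \<open>(a - \<alpha>\<^sub>i, a - \<alpha>\<^sub>i) = 4 - 2 (a, \<alpha>\<^sub>i)\<close> gives \<open>(a, \<alpha>\<^sub>i) = 1\<close>, so the reflection
  of \<open>a\<close> at \<open>i\<close> is \<open>a - \<alpha>\<^sub>i\<close>, a smaller positive root.\<close>

lemma positive_root_in_orbit:
  assumes ADE: "is_ADE \<Gamma>" and "a \<in> positive_roots \<Gamma>"
  shows "\<exists>w\<in>weyl_group \<Gamma>. \<exists>j\<in>vertices \<Gamma>. a = w (simple_root j)"
  using assms(2)
proof (induction "nat (\<Sum>i\<in>vertices \<Gamma>. a i)" arbitrary: a rule: less_induct)
  case less
  define c where "c i = 2 * a i - (\<Sum>j\<in>nbrs \<Gamma> i. a j)" for i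
  have nonneg: "a i \<ge> 0" and out: "i \<notin> vertices \<Gamma> \<Longrightarrow> a i = 0" for i
    using less.prems by (auto simp: positive_roots_def)
  have form: "(\<Sum>i\<in>vertices \<Gamma>. a i * c i) = 2"
    using less.prems by (simp add: positive_roots_def cartan_form_def c_def)
  obtain i where i: "i \<in> vertices \<Gamma>" "a i * c i > 0"
  proof -
    have "\<not> (\<forall>i\<in>vertices \<Gamma>. a i * c i \<le> 0)"
      using sum_nonpos[of "vertices \<Gamma>" "\<lambda>i. a i * c i"] form by fastforce
    then show ?thesis using that by force
  qed
  have ci: "c i > 0" and ai: "a i > 0"
    using i(2) nonneg[of i] by (auto simp: zero_less_mult_iff)
  show ?case
  proof (cases "a = simple_root i")
    case True
    then have "a = id (simple_root i)" by simp
    then show ?thesis using i(1) weyl_group.one by blast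
  next
    case False
    define b where "b = a(i := a i - 1)"
    have sroot: "b = (\<lambda>k. a k - simple_root i k)"
      by (auto simp: b_def simple_root_def)
    have nb: "i \<notin> nbrs \<Gamma> i" using adjacent_irrefl[OF ADE] by (simp add: nbrs_def)
    have snb: "(\<Sum>j\<in>nbrs \<Gamma> k. simple_root i j) = (if k \<in> nbrs \<Gamma> i then 1 else 0)"
      if "k \<in> vertices \<Gamma>" for k
    proof -
      have "(\<Sum>j\<in>nbrs \<Gamma> k. simple_root i j) = (if i \<in> nbrs \<Gamma> k then 1 else 0)"
        by (simp add: simple_root_def)
      then show ?thesis using that i(1) adjacent_sym by (auto simp: nbrs_def)
    qed
    have "cartan_form \<Gamma> b b = (\<Sum>k\<in>vertices \<Gamma>. (a k - simple_root i k) *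
        (c k - (2 * simple_root i k - (\<Sum>j\<in>nbrs \<Gamma> k. simple_root i j))))"
      unfolding cartan_form_def sroot
      by (intro sum.cong refl) (simp add: c_def sum_subtractf algebra_simps)
    also have "\<dots> = (\<Sum>k\<in>vertices \<Gamma>. (a k * c k) - simple_root i k * c k
         - 2 * (a k * simple_root i k) + 2 * (simple_root i k * simple_root i k)
         + (a k - simple_root i k) * (if k \<in> nbrs \<Gamma> i then 1 else 0))"
      by (intro sum.cong refl) (simp add: snb algebra_simps)
    also have "\<dots> = (\<Sum>k\<in>vertices \<Gamma>. a k * c k) - c i - 2 * a i + 2 + (\<Sum>k\<in>nbrs \<Gamma> i. a k)"
    proof -
      have "(\<Sum>k\<in>vertices \<Gamma>. simple_root i k * c k) = c i"
           "(\<Sum>k\<in>vertices \<Gamma>. 2 * (a k * simple_root i k)) = 2 * a i"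
           "(\<Sum>k\<in>vertices \<Gamma>. 2 * (simple_root i k * simple_root i k)) = 2"
        using i(1) by (simp_all add: simple_root_def if_distrib[of "\<lambda>x. _ * x"] if_distrib[of "\<lambda>x. x * _"] cong: if_cong)
      moreover have "(\<Sum>k\<in>vertices \<Gamma>. (a k - simple_root i k) * (if k \<in> nbrs \<Gamma> i then 1 else 0)) = (\<Sum>k\<in>nbrs \<Gamma> i. a k)"
      proof -
        have "(\<Sum>k\<in>vertices \<Gamma>. (a k - simple_root i k) * (if k \<in> nbrs \<Gamma> i then 1 else 0)) =
          (\<Sum>k\<in>nbrs \<Gamma> i. a k - simple_root i k)"
          by (intro sum.mono_neutral_cong_right) (auto simp: nbrs_def)
        also have "\<dots> = (\<Sum>k\<in>nbrs \<Gamma> i. a k)"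
          using nb by (intro sum.cong refl) (auto simp: simple_root_def)
        finally show ?thesis .
      qed
      ultimately show ?thesis by (simp add: sum.distrib sum_subtractf)
    qed
    also have "\<dots> = 4 - 2 * c i" unfolding form by (simp add: c_def)
    finally have bb: "cartan_form \<Gamma> b b = 4 - 2 * c i" .
    obtain k where k: "b k \<noteq> 0" using False sroot by (metis eq_iff_diff_eq_0 ext)
    have "k \<in> vertices \<Gamma>"
      using k i(1) out[of k] by (cases "k = i") (auto simp: b_def)
    then have "4 - 2 * c i > 0" using cartan_form_pos[OF ADE, of k b] k bb by simp
    then have c1: "c i = 1" using ci by simp
    have "b \<in> positive_roots \<Gamma>"
      using nonneg out ai i(1) bb c1 by (auto simp: positive_roots_def b_def)
    moreover have "nat (\<Sum>i\<in>vertices \<Gamma>. b i) < nat (\<Sum>i\<in>vertices \<Gamma>. a i)"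
    proof -
      have "(\<Sum>i\<in>vertices \<Gamma>. b i) = (\<Sum>i\<in>vertices \<Gamma>. a i) - 1"
        using i(1) by (simp add: sroot sum_subtractf simple_root_def)
      moreover have "(\<Sum>i\<in>vertices \<Gamma>. a i) \<ge> a i" using nonneg i(1) by (intro member_le_sum) auto
      ultimately show ?thesis using ai by simp
    qed
    ultimately obtain w j where w: "w \<in> weyl_group \<Gamma>" "j \<in> vertices \<Gamma>" "b = w (simple_root j)"
      using less.hyps by blast
    have "simple_reflection \<Gamma> i b = a"
    proof -
      have "(\<Sum>j\<in>nbrs \<Gamma> i. b j) = (\<Sum>j\<in>nbrs \<Gamma> i. a j)"
        using nb by (intro sum.cong refl) (auto simp: b_def)
      then show ?thesis using c1 by (auto simp: simple_reflection_def nbrs_def[symmetric] b_def c_def)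
    qed
    then have "a = (simple_reflection \<Gamma> i \<circ> w) (simple_root j)" using w(3) by simp
    then show ?thesis using w(1,2) i(1) weyl_group.step by blast
  qed
qed

lemma positive_root_combination:
  assumes "is_ADE \<Gamma>" "a \<in> positive_roots \<Gamma>"
  shows "combination \<Gamma> P' a \<in> B_set \<Gamma> P'"
  using positive_root_in_orbit[OF assms] unfolding B_set_def by blast

section \<open>Linear algebra over finite index sets\<close>

text \<open>A homogeneous system with more unknowns than equations, by eliminating one unknown per equation.\<close>

lemma underdetermined_system:
  fixes a :: "'k \<Rightarrow> 'i \<Rightarrow> 'f::field"
  assumes "finite K" "finite I" "card K < card I"
  shows "\<exists>x. (\<exists>i\<in>I. x i \<noteq> 0) \<and> (\<forall>k\<in>K. (\<Sum>i\<in>I. a k i * x i) = 0)"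
  using assms
proof (induction K arbitrary: I a rule: finite_induct)
  case empty
  then have "I \<noteq> {}" by auto
  then show ?case by (intro exI[of _ "\<lambda>_. 1"]) auto
next
  case (insert k K)
  show ?case
  proof (cases "\<forall>i\<in>I. a k i = 0")
    case True
    have "card K < card I" using insert by simp
    then obtain x where "\<exists>i\<in>I. x i \<noteq> 0" "\<forall>k\<in>K. (\<Sum>i\<in>I. a k i * x i) = 0"
      using insert.IH insert.prems by blast
    then show ?thesis using True by (intro exI[of _ x]) auto
  next
    case False
    then obtain p where p: "p \<in> I" "a k p \<noteq> 0" by auto
    define I' where "I' = I - {p}"
    have I': "finite I'" "I = insert p I'" "p \<notin> I'" using p insert.prems by (auto simp: I'_def)
    have "card K < card I'" using insert I' by simp
    then obtain x where x: "\<exists>i\<in>I'. x i \<noteq> 0"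
        "\<forall>m\<in>K. (\<Sum>i\<in>I'. (a m i - a m p * a k i / a k p) * x i) = 0"
      using insert.IH[of I' "\<lambda>m i. a m i - a m p * a k i / a k p"] I' by blast
    \<comment> \<open>the value of the eliminated unknown that solves the pivot equation \<open>k\<close>\<close>
    define y where "y = x(p := - (\<Sum>i\<in>I'. a k i * x i) / a k p)"
    have s: "(\<Sum>i\<in>I. a m i * y i) = a m p * y p + (\<Sum>i\<in>I'. a m i * x i)" for m
    proof -
      have "(\<Sum>i\<in>I'. a m i * y i) = (\<Sum>i\<in>I'. a m i * x i)"
        using I' by (intro sum.cong) (auto simp: y_def)
      then show ?thesis using I' by simp
    qed
    have "(\<Sum>i\<in>I. a m i * y i) = 0" if "m \<in> insert k K" for m
    proof (cases "m = k")
      case True then show ?thesis using p unfolding s by (simp add: y_def)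
    next
      case False
      then have "0 = (\<Sum>i\<in>I'. (a m i - a m p * a k i / a k p) * x i)" using that x by simp
      also have "\<dots> = (\<Sum>i\<in>I'. a m i * x i) - a m p / a k p * (\<Sum>i\<in>I'. a k i * x i)"
        by (simp add: algebra_simps sum_subtractf sum_distrib_left sum_divide_distrib)
      finally show ?thesis unfolding s by (simp add: y_def)
    qed
    moreover have "\<exists>i\<in>I. y i \<noteq> 0" using x(1) I' by (auto simp: y_def)
    ultimately show ?thesis by blast
  qed
qed

text \<open>Vectors indexed by a finite set \<open>I\<close> are functions on the whole index type; the existence of a matrix
  expresses both linearity and independence of the values outside \<open>I\<close>.\<close>

definition lin_op :: "'i set \<Rightarrow> 'j set \<Rightarrow> (('i \<Rightarrow> complex) \<Rightarrow> 'j \<Rightarrow> complex) \<Rightarrow> bool" where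
  "lin_op I J A \<longleftrightarrow> (\<exists>a. \<forall>x. \<forall>j\<in>J. A x j = (\<Sum>i\<in>I. a j i * x i))"

lemma lin_opI:
  assumes fin: "finite I"
    and add: "\<And>x y j. j \<in> J \<Longrightarrow> A (\<lambda>i. x i + y i) j = A x j + A y j"
    and scale: "\<And>c x j. j \<in> J \<Longrightarrow> A (\<lambda>i. c * x i) j = c * A x j"
    and local: "\<And>x y j. j \<in> J \<Longrightarrow> (\<And>i. i \<in> I \<Longrightarrow> x i = y i) \<Longrightarrow> A x j = A y j"
  shows "lin_op I J A"
proof -
  define e :: "'a \<Rightarrow> 'a \<Rightarrow> complex" where "e i = (\<lambda>k. if k = i then 1 else 0)" for i
  have part: "A (\<lambda>i. if i \<in> F then x i else 0) j = (\<Sum>i\<in>F. A (e i) j * x i)"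
    if "finite F" "j \<in> J" for F x j
    using that(1)
  proof induction
    case empty
    then show ?case using scale[OF \<open>j \<in> J\<close>, of 0 "\<lambda>_. 0"] by simp
  next
    case (insert p F)
    have "(\<lambda>i. if i \<in> insert p F then x i else 0) =
          (\<lambda>i. (if i \<in> F then x i else 0) + x p * e p i)"
      using insert by (auto simp: e_def)
    then show ?case using insert add[OF \<open>j \<in> J\<close>] scale[OF \<open>j \<in> J\<close>, of "x p" "e p"] by simp
  qed
  have "A x j = (\<Sum>i\<in>I. A (e i) j * x i)" if "j \<in> J" for x j
    using part[OF fin that, of x] local[OF that, of x "\<lambda>i. if i \<in> I then x i else 0"] by simp
  then show ?thesis unfolding lin_op_def by (intro exI[of _ "\<lambda>j i. A (e i) j"]) blast
qed

text \<open>Two operators \<open>A\<close> and \<open>T\<close> into the same space with orthogonal images for the bilinear pairing: the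
  map \<open>(x, z) \<mapsto> A x + cnj (T (cnj z))\<close> has kernel \<open>ker A \<oplus> cnj (ker T)\<close>, because its two summands are
  orthogonal for the Hermitian inner product. The sets \<open>F\<close> and \<open>G\<close> of coordinates detect the two kernels
  and so bound their dimensions; adding them as equations leaves no nontrivial solution.
  For a complex \<open>A, A'\<close> this is used with \<open>T\<close> the transpose of \<open>A'\<close>, which turns \<open>A' \<circ> A = 0\<close> into
  orthogonality.\<close>

lemma orthogonal_images_bound:
  fixes A :: "('i \<Rightarrow> complex) \<Rightarrow> 'j \<Rightarrow> complex" and T :: "('k \<Rightarrow> complex) \<Rightarrow> 'j \<Rightarrow> complex"
  assumes fin: "finite I" "finite J" "finite K" "finite F" "finite G" "F \<subseteq> I" "G \<subseteq> K"
    and linA: "lin_op I J A" and linT: "lin_op K J T"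
    and orth: "\<And>x z. (\<Sum>j\<in>J. T z j * A x j) = 0"
    and injA: "\<And>x. (\<And>j. j \<in> J \<Longrightarrow> A x j = 0) \<Longrightarrow> (\<And>i. i \<in> F \<Longrightarrow> x i = 0) \<Longrightarrow> \<forall>i\<in>I. x i = 0"
    and injT: "\<And>z. (\<And>j. j \<in> J \<Longrightarrow> T z j = 0) \<Longrightarrow> (\<And>k. k \<in> G \<Longrightarrow> z k = 0) \<Longrightarrow> \<forall>k\<in>K. z k = 0"
  shows "card I + card K \<le> card J + card F + card G"
proof (rule ccontr)
  assume less: "\<not> ?thesis"
  obtain a where a: "A x j = (\<Sum>i\<in>I. a j i * x i)" if "j \<in> J" for x j
    using linA unfolding lin_op_def by blast
  obtain t where t: "T z j = (\<Sum>k\<in>K. t j k * z k)" if "j \<in> J" for z j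
    using linT unfolding lin_op_def by blast
  define m :: "'j + ('i + 'k) \<Rightarrow> 'i + 'k \<Rightarrow> complex" where
    "m e u = (case e of
        Inl j \<Rightarrow> (case u of Inl i \<Rightarrow> a j i | Inr k \<Rightarrow> cnj (t j k))
      | Inr v \<Rightarrow> (if u = v then 1 else 0))" for e u
  have "card (J <+> (F <+> G)) < card (I <+> K)"
    using less fin by (simp add: card_Plus)
  then obtain w where w: "\<exists>u\<in>I <+> K. w u \<noteq> 0"
      "\<forall>e\<in>J <+> (F <+> G). (\<Sum>u\<in>I <+> K. m e u * w u) = 0"
    using underdetermined_system[of "J <+> (F <+> G)" "I <+> K" m] fin by auto
  define x z where "x i = w (Inl i)" and "z k = cnj (w (Inr k))" for i k
  have eqJ: "A x j = - cnj (T z j)" if "j \<in> J" for j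
  proof -
    have "0 = (\<Sum>u\<in>I <+> K. m (Inl j) u * w u)" using w(2) that by auto
    also have "\<dots> = (\<Sum>i\<in>I. a j i * x i) + (\<Sum>k\<in>K. cnj (t j k) * cnj (z k))"
      using fin by (simp add: sum.Plus m_def x_def z_def)
    also have "\<dots> = A x j + cnj (T z j)" using that by (simp add: a t)
    finally show ?thesis by (simp add: eq_neg_iff_add_eq_0)
  qed
  have eqFG: "w v = 0" if "v \<in> F <+> G" for v
  proof -
    have "0 = (\<Sum>u\<in>I <+> K. m (Inr v) u * w u)" using w(2) that by auto
    also have "\<dots> = (\<Sum>u\<in>I <+> K. if u = v then w u else 0)"
      by (intro sum.cong) (auto simp: m_def)
    also have "\<dots> = w v" using that fin by (auto simp: sum.delta)
    finally show ?thesis by simp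
  qed
  have "0 = - (\<Sum>j\<in>J. T z j * A x j)" using orth by simp
  also have "\<dots> = (\<Sum>j\<in>J. of_real ((cmod (T z j))\<^sup>2))"
    unfolding sum_negf[symmetric]
    by (intro sum.cong refl) (simp only: eqJ complex_norm_square mult_minus_right minus_minus)
  finally have "(\<Sum>j\<in>J. (cmod (T z j))\<^sup>2) = 0"
    by (metis of_real_eq_0_iff of_real_sum)
  then have T0: "T z j = 0" if "j \<in> J" for j
    using that fin by (simp add: sum_nonneg_eq_0_iff)
  then have A0: "A x j = 0" if "j \<in> J" for j using that eqJ by simp
  have "x i = 0" if "i \<in> I" for i
    using injA[of x] A0 eqFG that by (auto simp: x_def)
  moreover have "z k = 0" if "k \<in> K" for k
    using injT[of z] T0 eqFG that by (auto simp: z_def)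
  ultimately show False using w(1) by (auto simp: x_def z_def)
qed

text \<open>In the case of equality, a vector \<open>y\<close> orthogonal to the image of \<open>T\<close> and outside the image of \<open>A\<close>
  could be adjoined to \<open>A\<close> as one more column, contradicting the bound.\<close>

lemma orthogonal_images_exact:
  fixes A :: "('i \<Rightarrow> complex) \<Rightarrow> 'j \<Rightarrow> complex" and T :: "('k \<Rightarrow> complex) \<Rightarrow> 'j \<Rightarrow> complex"
  assumes fin: "finite I" "finite J" "finite K" "finite F" "finite G" "F \<subseteq> I" "G \<subseteq> K"
    and linA: "lin_op I J A" and linT: "lin_op K J T"
    and orth: "\<And>x z. (\<Sum>j\<in>J. T z j * A x j) = 0"
    and injA: "\<And>x. (\<And>j. j \<in> J \<Longrightarrow> A x j = 0) \<Longrightarrow> (\<And>i. i \<in> F \<Longrightarrow> x i = 0) \<Longrightarrow> \<forall>i\<in>I. x i = 0"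
    and injT: "\<And>z. (\<And>j. j \<in> J \<Longrightarrow> T z j = 0) \<Longrightarrow> (\<And>k. k \<in> G \<Longrightarrow> z k = 0) \<Longrightarrow> \<forall>k\<in>K. z k = 0"
    and card: "card I + card K \<ge> card J + card F + card G"
    and y: "\<And>z. (\<Sum>j\<in>J. T z j * y j) = 0"
  shows "\<exists>x. \<forall>j\<in>J. A x j = y j"
proof (rule ccontr)
  assume no: "\<not> ?thesis"
  obtain a where a: "A x j = (\<Sum>i\<in>I. a j i * x i)" if "j \<in> J" for x j
    using linA unfolding lin_op_def by blast
  define A' :: "('i option \<Rightarrow> complex) \<Rightarrow> 'j \<Rightarrow> complex" where
    "A' x j = A (\<lambda>i. x (Some i)) j + x None * y j" for x j
  define I' where "I' = insert None (Some ` I)"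
  have I': "finite I'" "card I' = Suc (card I)"
    using fin by (auto simp: I'_def card_image)
  have "card I' + card K \<le> card J + card (Some ` F) + card G"
  proof (rule orthogonal_images_bound[where A = A' and T = T])
    show "lin_op I' J A'"
      unfolding lin_op_def
    proof (intro exI ballI allI)
      fix x j assume "j \<in> J"
      then show "A' x j = (\<Sum>i\<in>I'. (case i of None \<Rightarrow> y j | Some i \<Rightarrow> a j i) * x i)"
        using fin by (simp add: A'_def I'_def a sum.reindex algebra_simps)
    qed
    show "(\<Sum>j\<in>J. T z j * A' x j) = 0" for x z
    proof -
      have "(\<Sum>j\<in>J. T z j * A' x j) = (\<Sum>j\<in>J. T z j * A (\<lambda>i. x (Some i)) j) + x None * (\<Sum>j\<in>J. T z j * y j)"
        by (simp add: A'_def algebra_simps sum.distrib sum_distrib_left)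
      then show ?thesis using orth y by simp
    qed
    show "\<forall>i\<in>I'. x i = 0"
      if x: "\<And>j. j \<in> J \<Longrightarrow> A' x j = 0" "\<And>i. i \<in> Some ` F \<Longrightarrow> x i = 0" for x
    proof -
      have "x None = 0"
      proof (rule ccontr)
        assume nz: "x None \<noteq> 0"
        have "A (\<lambda>i. - x (Some i) / x None) j = y j" if "j \<in> J" for j
        proof -
          have "A (\<lambda>i. - x (Some i) / x None) j = - A (\<lambda>i. x (Some i)) j / x None"
            using that by (simp add: a sum_negf sum_divide_distrib)
          also have "A (\<lambda>i. x (Some i)) j = - x None * y j"
            using x(1)[OF that] by (simp add: A'_def add_eq_0_iff)
          finally show ?thesis using nz by simp
        qed
        then show False using no by blast
      qed
      moreover from this have "\<forall>i\<in>I. x (Some i) = 0"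
        using x by (intro injA) (auto simp: A'_def)
      ultimately show ?thesis by (auto simp: I'_def)
    qed
  next
    show "\<forall>k\<in>K. z k = 0"
      if "\<And>j. j \<in> J \<Longrightarrow> T z j = 0" "\<And>k. k \<in> G \<Longrightarrow> z k = 0" for z
      using injT[of z] that by simp
    show "Some ` F \<subseteq> I'" using fin by (auto simp: I'_def)
  qed (use fin linT I' in simp_all)
  then show False using card fin I' by (simp add: card_image)
qed

definition mtimes :: "'n set \<Rightarrow> ('m \<Rightarrow> 'n \<Rightarrow> complex) \<Rightarrow> ('n \<Rightarrow> 'k \<Rightarrow> complex) \<Rightarrow> 'm \<Rightarrow> 'k \<Rightarrow> complex" where
  "mtimes N f g a b = (\<Sum>c\<in>N. f a c * g c b)"

text \<open>The trace of the product of two rectangular matrices.\<close>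

definition mpair :: "'m set \<Rightarrow> 'n set \<Rightarrow> ('m \<Rightarrow> 'n \<Rightarrow> complex) \<Rightarrow> ('n \<Rightarrow> 'm \<Rightarrow> complex) \<Rightarrow> complex" where
  "mpair M N f g = (\<Sum>a\<in>M. \<Sum>b\<in>N. f a b * g b a)"

lemma mpair_commute: "mpair M N f g = mpair N M g f"
  unfolding mpair_def by (subst sum.swap) (simp add: mult.commute)

lemma mpair_mtimes: "mpair M N (mtimes K f h) g = mpair M K f (mtimes N h g)"
proof -
  have "(\<Sum>b\<in>N. (\<Sum>c\<in>K. f a c * h c b) * g b a) = (\<Sum>c\<in>K. f a c * (\<Sum>b\<in>N. h c b * g b a))" for a
  proof -
    have "(\<Sum>b\<in>N. (\<Sum>c\<in>K. f a c * h c b) * g b a) = (\<Sum>b\<in>N. \<Sum>c\<in>K. f a c * h c b * g b a)"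
      by (simp add: sum_distrib_right)
    also have "\<dots> = (\<Sum>c\<in>K. \<Sum>b\<in>N. f a c * h c b * g b a)" by (rule sum.swap)
    finally show ?thesis by (simp add: sum_distrib_left mult.assoc)
  qed
  then show ?thesis by (simp add: mpair_def mtimes_def)
qed

lemma mtimes_assoc: "mtimes M (mtimes N f g) h = mtimes N f (mtimes M g h)"
proof (intro ext)
  fix a b
  have "mtimes M (mtimes N f g) h a b = (\<Sum>c\<in>M. \<Sum>d\<in>N. f a d * g d c * h c b)"
    by (simp add: mtimes_def sum_distrib_right)
  also have "\<dots> = (\<Sum>d\<in>N. \<Sum>c\<in>M. f a d * g d c * h c b)" by (rule sum.swap)
  finally show "mtimes M (mtimes N f g) h a b = mtimes N f (mtimes M g h) a b"
    by (simp add: mtimes_def sum_distrib_left mult.assoc)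
qed

lemma mpair_cong:
  "(\<And>a b. a \<in> M \<Longrightarrow> b \<in> N \<Longrightarrow> f a b = f' a b) \<Longrightarrow> (\<And>a b. a \<in> M \<Longrightarrow> b \<in> N \<Longrightarrow> g b a = g' b a)
   \<Longrightarrow> mpair M N f g = mpair M N f' g'"
  unfolding mpair_def by (intro sum.cong) auto

lemma mpair_sum_right:
  "mpair M N f (\<lambda>b a. \<Sum>i\<in>I. g i b a) = (\<Sum>i\<in>I. mpair M N f (g i))"
proof -
  have "mpair M N f (\<lambda>b a. \<Sum>i\<in>I. g i b a) = (\<Sum>a\<in>M. \<Sum>i\<in>I. \<Sum>b\<in>N. f a b * g i b a)"
    unfolding mpair_def sum_distrib_left by (rule sum.cong[OF refl]) (rule sum.swap)
  also have "\<dots> = (\<Sum>i\<in>I. mpair M N f (g i))"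
    unfolding mpair_def by (rule sum.swap)
  finally show ?thesis .
qed

lemma mpair_scale_right: "mpair M N f (\<lambda>b a. c * g b a) = c * mpair M N f g"
  by (simp add: mpair_def sum_distrib_left algebra_simps)

lemma mpair_scale_left: "mpair M N (\<lambda>b a. c * f b a) g = c * mpair M N f g"
  by (simp add: mpair_def sum_distrib_left algebra_simps)

lemma mpair_add_right: "mpair M N f (\<lambda>b a. g b a + h b a) = mpair M N f g + mpair M N f h"
  by (simp add: mpair_def algebra_simps sum.distrib)

lemma mpair_diff_left: "mpair M N (\<lambda>b a. f b a - f' b a) g = mpair M N f g - mpair M N f' g"
  by (simp add: mpair_def algebra_simps sum_subtractf)

section \<open>The complex computing homomorphisms and extensions\<close>

lemma edge_sign_swap:
  assumes "is_ADE \<Gamma>" shows "edge_sign \<Gamma> j i = - edge_sign \<Gamma> i j"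
proof (cases "adjacent \<Gamma> i j")
  case True
  then have "adjacent \<Gamma> j i" "i \<noteq> j" using adjacent_sym adjacent_irrefl[OF assms] by blast+
  then show ?thesis using True by (auto simp: edge_sign_def)
next
  case False
  then have "\<not> adjacent \<Gamma> j i" using adjacent_sym by blast
  then show ?thesis using False by (simp add: edge_sign_def)
qed

lemma edge_sign_neq_0: "adjacent \<Gamma> i j \<Longrightarrow> edge_sign \<Gamma> i j \<noteq> 0"
  by (simp add: edge_sign_def)

lemma sum_antisymmetric:
  fixes f :: "nat \<Rightarrow> nat \<Rightarrow> complex"
  assumes "is_ADE \<Gamma>"
  shows "(\<Sum>i\<in>V. \<Sum>j\<in>V. of_int (edge_sign \<Gamma> i j) * f i j) = - (\<Sum>j\<in>V. \<Sum>i\<in>V. of_int (edge_sign \<Gamma> i j) * f j i)"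
proof -
  have "(\<Sum>i\<in>V. \<Sum>j\<in>V. of_int (edge_sign \<Gamma> i j) * f i j) =
        (\<Sum>i\<in>V. \<Sum>j\<in>V. - (of_int (edge_sign \<Gamma> j i) * f i j))"
  proof (intro sum.cong refl)
    fix i j
    have "edge_sign \<Gamma> i j = - edge_sign \<Gamma> j i" by (rule edge_sign_swap[OF assms])
    then show "of_int (edge_sign \<Gamma> i j) * f i j = - (of_int (edge_sign \<Gamma> j i) * f i j)"
      by (metis mult_minus_left of_int_minus)
  qed
  then show ?thesis by (simp add: sum_negf)
qed

text \<open>The coordinates of a representation on which all loops act as one scalar \<open>\<lambda>\<close>, where
  \<open>t j = P'\<^sub>j(\<lambda>)\<close>: the vertex relations then say that the sum of the signed two-step paths at \<open>j\<close> is
  \<open>- t j\<close> times the identity.\<close>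

definition matrix_rep :: "dynkin \<Rightarrow> (nat \<Rightarrow> complex) \<Rightarrow> (nat \<Rightarrow> 'b set) \<Rightarrow> (nat \<Rightarrow> nat \<Rightarrow> 'b \<Rightarrow> 'b \<Rightarrow> complex) \<Rightarrow> bool" where
  "matrix_rep \<Gamma> t B q \<longleftrightarrow>
     (\<forall>i\<in>vertices \<Gamma>. finite (B i)) \<and>
     (\<forall>j\<in>vertices \<Gamma>. \<forall>b\<in>B j. \<forall>b'\<in>B j.
        (\<Sum>i\<in>vertices \<Gamma>. of_int (edge_sign \<Gamma> i j) * mtimes (B i) (q j i) (q i j) b' b)
          = - t j * (if b' = b then 1 else 0))"

text \<open>The traces of \<open>Q\<^sub>j\<^sub>i Q\<^sub>i\<^sub>j\<close> and \<open>Q\<^sub>i\<^sub>j Q\<^sub>j\<^sub>i\<close> agree and enter with opposite signs, so the traces of the vertex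
  relations add up to zero.\<close>

lemma matrix_rep_trace:
  assumes ADE: "is_ADE \<Gamma>" and rep: "matrix_rep \<Gamma> t B q"
  shows "(\<Sum>j\<in>vertices \<Gamma>. of_nat (card (B j)) * t j) = 0"
proof -
  let ?V = "vertices \<Gamma>" and ?s = "\<lambda>i j. complex_of_int (edge_sign \<Gamma> i j)"
  have "(\<Sum>j\<in>?V. of_nat (card (B j)) * - t j) =
      (\<Sum>j\<in>?V. \<Sum>b\<in>B j. \<Sum>i\<in>?V. ?s i j * mtimes (B i) (q j i) (q i j) b b)"
    using rep by (intro sum.cong refl) (simp add: matrix_rep_def)
  also have "\<dots> = (\<Sum>j\<in>?V. \<Sum>i\<in>?V. ?s i j * mpair (B j) (B i) (q j i) (q i j))"
    by (rule sum.cong[OF refl], subst sum.swap) (simp add: mpair_def mtimes_def sum_distrib_left)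
  finally have eq: "(\<Sum>j\<in>?V. of_nat (card (B j)) * - t j) =
      (\<Sum>j\<in>?V. \<Sum>i\<in>?V. ?s i j * mpair (B j) (B i) (q j i) (q i j))" .
  also have "\<dots> = (\<Sum>i\<in>?V. \<Sum>j\<in>?V. ?s i j * mpair (B j) (B i) (q j i) (q i j))"
    by (rule sum.swap)
  also have "\<dots> = - (\<Sum>j\<in>?V. \<Sum>i\<in>?V. ?s i j * mpair (B i) (B j) (q i j) (q j i))"
    by (rule sum_antisymmetric[OF ADE])
  also have "\<dots> = - (\<Sum>j\<in>?V. \<Sum>i\<in>?V. ?s i j * mpair (B j) (B i) (q j i) (q i j))"
    by (subst mpair_commute) simp
  also have "\<dots> = - (\<Sum>j\<in>?V. of_nat (card (B j)) * - t j)" unfolding eq ..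
  finally show ?thesis by (simp add: sum_negf)
qed

definition matrix_hom :: "dynkin \<Rightarrow> (nat \<Rightarrow> 'b set) \<Rightarrow> (nat \<Rightarrow> nat \<Rightarrow> 'b \<Rightarrow> 'b \<Rightarrow> complex) \<Rightarrow>
    (nat \<Rightarrow> 'c set) \<Rightarrow> (nat \<Rightarrow> nat \<Rightarrow> 'c \<Rightarrow> 'c \<Rightarrow> complex) \<Rightarrow> (nat \<Rightarrow> 'c \<Rightarrow> 'b \<Rightarrow> complex) \<Rightarrow> bool" where
  "matrix_hom \<Gamma> B q C r x \<longleftrightarrow> (\<forall>i\<in>vertices \<Gamma>. \<forall>j\<in>nbrs \<Gamma> i. \<forall>c\<in>C i. \<forall>b\<in>B j.
     mtimes (B i) (x i) (q i j) c b = mtimes (C j) (r i j) (x j) c b)"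

text \<open>The complex attached to two such representations. \<open>diff0\<close> measures the failure of a family of maps
  to commute with the arrows. \<open>diff1\<close> is the linearisation of the vertex relations, and \<open>codiff1\<close> is its
  transpose under the trace pairing; the kernel of \<open>codiff1\<close> consists of the homomorphisms in the
  opposite direction.\<close>

locale hom_complex =
  fixes \<Gamma> :: dynkin and t :: "nat \<Rightarrow> complex"
    and B :: "nat \<Rightarrow> 'b set" and q :: "nat \<Rightarrow> nat \<Rightarrow> 'b \<Rightarrow> 'b \<Rightarrow> complex"
    and C :: "nat \<Rightarrow> 'c set" and r :: "nat \<Rightarrow> nat \<Rightarrow> 'c \<Rightarrow> 'c \<Rightarrow> complex"
  assumes ADE: "is_ADE \<Gamma>"
    and repB: "matrix_rep \<Gamma> t B q" and repC: "matrix_rep \<Gamma> t C r"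
begin

abbreviation "s i j \<equiv> complex_of_int (edge_sign \<Gamma> i j)"

lemma finB [simp]: "i \<in> vertices \<Gamma> \<Longrightarrow> finite (B i)"
  and finC [simp]: "i \<in> vertices \<Gamma> \<Longrightarrow> finite (C i)"
  using repB repC by (auto simp: matrix_rep_def)

definition diff0 :: "(nat \<Rightarrow> 'c \<Rightarrow> 'b \<Rightarrow> complex) \<Rightarrow> nat \<Rightarrow> nat \<Rightarrow> 'c \<Rightarrow> 'b \<Rightarrow> complex" where
  "diff0 x i j = (\<lambda>c b. mtimes (B i) (x i) (q i j) c b - mtimes (C j) (r i j) (x j) c b)"

definition diff1 :: "(nat \<Rightarrow> nat \<Rightarrow> 'c \<Rightarrow> 'b \<Rightarrow> complex) \<Rightarrow> nat \<Rightarrow> 'c \<Rightarrow> 'b \<Rightarrow> complex" where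
  "diff1 y j = (\<lambda>c b. \<Sum>i\<in>vertices \<Gamma>. s i j *
      (mtimes (C i) (r j i) (y i j) c b + mtimes (B i) (y j i) (q i j) c b))"

definition codiff1 :: "(nat \<Rightarrow> 'b \<Rightarrow> 'c \<Rightarrow> complex) \<Rightarrow> nat \<Rightarrow> nat \<Rightarrow> 'b \<Rightarrow> 'c \<Rightarrow> complex" where
  "codiff1 z i j = (\<lambda>b c. s i j * (mtimes (C j) (z j) (r j i) b c - mtimes (B i) (q j i) (z i) b c))"

lemma codiff1_adjoint:
  "(\<Sum>i\<in>vertices \<Gamma>. \<Sum>j\<in>vertices \<Gamma>. mpair (B j) (C i) (codiff1 z i j) (y i j)) =
   (\<Sum>j\<in>vertices \<Gamma>. mpair (B j) (C j) (z j) (diff1 y j))"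
proof -
  let ?V = "vertices \<Gamma>"
  have 1: "mpair (B j) (C i) (codiff1 z i j) (y i j) =
      s i j * mpair (B j) (C j) (z j) (mtimes (C i) (r j i) (y i j))
      - s i j * mpair (B i) (C i) (z i) (mtimes (B j) (y i j) (q j i))" for i j
  proof -
    have "mpair (B j) (C i) (mtimes (B i) (q j i) (z i)) (y i j) =
      mpair (B i) (C i) (z i) (mtimes (B j) (y i j) (q j i))"
      by (simp add: mpair_mtimes mpair_commute[of "B j" "B i"])
    then show ?thesis
      unfolding codiff1_def mpair_scale_left mpair_diff_left
      by (simp add: mpair_mtimes algebra_simps)
  qed
  have "(\<Sum>i\<in>?V. \<Sum>j\<in>?V. mpair (B j) (C i) (codiff1 z i j) (y i j)) =
     (\<Sum>i\<in>?V. \<Sum>j\<in>?V. s i j * mpair (B j) (C j) (z j) (mtimes (C i) (r j i) (y i j)))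
     - (\<Sum>i\<in>?V. \<Sum>j\<in>?V. s i j * mpair (B i) (C i) (z i) (mtimes (B j) (y i j) (q j i)))"
    by (simp add: 1 sum_subtractf)
  also have "(\<Sum>i\<in>?V. \<Sum>j\<in>?V. s i j * mpair (B j) (C j) (z j) (mtimes (C i) (r j i) (y i j))) =
     (\<Sum>j\<in>?V. \<Sum>i\<in>?V. s i j * mpair (B j) (C j) (z j) (mtimes (C i) (r j i) (y i j)))"
    by (rule sum.swap)
  also have "(\<Sum>i\<in>?V. \<Sum>j\<in>?V. s i j * mpair (B i) (C i) (z i) (mtimes (B j) (y i j) (q j i))) =
     - (\<Sum>j\<in>?V. \<Sum>i\<in>?V. s i j * mpair (B j) (C j) (z j) (mtimes (B i) (y j i) (q i j)))"
    by (rule sum_antisymmetric[OF ADE])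
  finally show ?thesis
    by (simp add: diff1_def mpair_sum_right mpair_scale_right mpair_add_right
        sum.distrib distrib_left)
qed

text \<open>By the vertex relations of both representations the composite is \<open>x\<^sub>j \<cdot> (- t\<^sub>j) - (- t\<^sub>j) \<cdot> x\<^sub>j\<close>.\<close>

lemma diff1_diff0:
  assumes j: "j \<in> vertices \<Gamma>" and c: "c \<in> C j" and b: "b \<in> B j"
  shows "diff1 (diff0 x) j c b = 0"
proof -
  let ?V = "vertices \<Gamma>"
  have d1: "mtimes N f (\<lambda>c b. g c b - h c b) a b = mtimes N f g a b - mtimes N f h a b" for N :: "'n set" and f g h and a::'m and b :: 'k
    by (simp add: mtimes_def algebra_simps sum_subtractf)
  have d2: "mtimes N (\<lambda>c b. g c b - h c b) f a b = mtimes N g f a b - mtimes N h f a b" for N :: "'n set" and f g h and a::'m and b :: 'k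
    by (simp add: mtimes_def algebra_simps sum_subtractf)
  have "diff1 (diff0 x) j c b =
    (\<Sum>i\<in>?V. s i j * mtimes (B j) (x j) (mtimes (B i) (q j i) (q i j)) c b
           - s i j * mtimes (C j) (mtimes (C i) (r j i) (r i j)) (x j) c b)"
    unfolding diff1_def diff0_def
    by (intro sum.cong refl) (simp add: d1 d2 mtimes_assoc algebra_simps)
  also have "\<dots> = (\<Sum>b'\<in>B j. x j c b' * (\<Sum>i\<in>?V. s i j * mtimes (B i) (q j i) (q i j) b' b))
     - (\<Sum>c'\<in>C j. (\<Sum>i\<in>?V. s i j * mtimes (C i) (r j i) (r i j) c c') * x j c' b)"
  proof -
    have "(\<Sum>i\<in>?V. s i j * mtimes (B j) (x j) (mtimes (B i) (q j i) (q i j)) c b) =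
       (\<Sum>i\<in>?V. \<Sum>b'\<in>B j. x j c b' * (s i j * mtimes (B i) (q j i) (q i j) b' b))"
      unfolding mtimes_def[of "B j"] sum_distrib_left by (simp add: mult.left_commute)
    also have "\<dots> = (\<Sum>b'\<in>B j. \<Sum>i\<in>?V. x j c b' * (s i j * mtimes (B i) (q j i) (q i j) b' b))"
      by (rule sum.swap)
    finally have 1: "(\<Sum>i\<in>?V. s i j * mtimes (B j) (x j) (mtimes (B i) (q j i) (q i j)) c b) =
      (\<Sum>b'\<in>B j. x j c b' * (\<Sum>i\<in>?V. s i j * mtimes (B i) (q j i) (q i j) b' b))"
      by (simp add: sum_distrib_left)
    have "(\<Sum>i\<in>?V. s i j * mtimes (C j) (mtimes (C i) (r j i) (r i j)) (x j) c b) =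
       (\<Sum>i\<in>?V. \<Sum>c'\<in>C j. (s i j * mtimes (C i) (r j i) (r i j) c c') * x j c' b)"
      unfolding mtimes_def[of "C j"] sum_distrib_left by (simp add: mult.assoc)
    also have "\<dots> = (\<Sum>c'\<in>C j. \<Sum>i\<in>?V. (s i j * mtimes (C i) (r j i) (r i j) c c') * x j c' b)"
      by (rule sum.swap)
    finally have 2: "(\<Sum>i\<in>?V. s i j * mtimes (C j) (mtimes (C i) (r j i) (r i j)) (x j) c b) =
      (\<Sum>c'\<in>C j. (\<Sum>i\<in>?V. s i j * mtimes (C i) (r j i) (r i j) c c') * x j c' b)"
      by (simp add: sum_distrib_right)
    show ?thesis by (simp add: sum_subtractf 1 2)
  qed
  also have "\<dots> = (\<Sum>b'\<in>B j. if b' = b then - (x j c b' * t j) else 0)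
     - (\<Sum>c'\<in>C j. if c = c' then - (t j * x j c' b) else 0)"
    using repB repC j b c by (intro arg_cong2[where f="(-)"] sum.cong refl) (auto simp: matrix_rep_def)
  also have "\<dots> = 0" using j b c by simp
  finally show ?thesis .
qed

text \<open>The index sets of the coordinates in the three terms of the complex; the last term is indexed
  with rows and columns exchanged, as the source of \<open>codiff1\<close>.\<close>

definition "hom_index = (SIGMA i:vertices \<Gamma>. C i \<times> B i)"
definition "cohom_index = (SIGMA i:vertices \<Gamma>. B i \<times> C i)"
definition "arrow_index = (SIGMA i:vertices \<Gamma>. SIGMA j:nbrs \<Gamma> i. C i \<times> B j)"

lemma nbrs_vertices: "j \<in> nbrs \<Gamma> i \<Longrightarrow> j \<in> vertices \<Gamma>"
  by (simp add: nbrs_def)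

lemma finite_index [simp]: "finite hom_index" "finite cohom_index" "finite arrow_index"
  unfolding hom_index_def cohom_index_def arrow_index_def
  by (auto intro!: finite_SigmaI finite_cartesian_product dest: nbrs_vertices)

lemma card_index:
  "card hom_index = (\<Sum>i\<in>vertices \<Gamma>. card (C i) * card (B i))"
  "card cohom_index = (\<Sum>i\<in>vertices \<Gamma>. card (C i) * card (B i))"
  "card arrow_index = (\<Sum>i\<in>vertices \<Gamma>. \<Sum>j\<in>nbrs \<Gamma> i. card (C i) * card (B j))"
proof -
  show "card arrow_index = (\<Sum>i\<in>vertices \<Gamma>. \<Sum>j\<in>nbrs \<Gamma> i. card (C i) * card (B j))"
    unfolding arrow_index_def
    by (subst card_SigmaI)
       (auto intro!: sum.cong finite_SigmaI finite_cartesian_product card_SigmaI[THEN trans] simp: card_cartesian_product dest: nbrs_vertices)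
qed (simp_all add: hom_index_def cohom_index_def card_cartesian_product mult.commute)

definition diff0_op :: "(nat \<times> 'c \<times> 'b \<Rightarrow> complex) \<Rightarrow> nat \<times> nat \<times> 'c \<times> 'b \<Rightarrow> complex" where
  "diff0_op x = (\<lambda>(i, j, c, b). diff0 (\<lambda>i c b. x (i, c, b)) i j c b)"

definition codiff1_op :: "(nat \<times> 'b \<times> 'c \<Rightarrow> complex) \<Rightarrow> nat \<times> nat \<times> 'c \<times> 'b \<Rightarrow> complex" where
  "codiff1_op z = (\<lambda>(i, j, c, b). codiff1 (\<lambda>i b c. z (i, b, c)) i j b c)"

lemma lin_op_diff0_op: "lin_op hom_index arrow_index diff0_op"
proof (rule lin_opI)
  show "diff0_op x k = diff0_op y k" if "k \<in> arrow_index" "\<And>i. i \<in> hom_index \<Longrightarrow> x i = y i" for x y k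
    using that by (auto simp: diff0_op_def diff0_def mtimes_def arrow_index_def hom_index_def nbrs_def
        intro!: arg_cong2[where f="(-)"] sum.cong)
qed (auto simp: diff0_op_def diff0_def mtimes_def algebra_simps sum.distrib sum_distrib_left)

lemma lin_op_codiff1_op: "lin_op cohom_index arrow_index codiff1_op"
proof (rule lin_opI)
  show "codiff1_op x k = codiff1_op y k" if "k \<in> arrow_index" "\<And>i. i \<in> cohom_index \<Longrightarrow> x i = y i" for x y k
    using that by (auto simp: codiff1_op_def codiff1_def mtimes_def arrow_index_def cohom_index_def nbrs_def
        intro!: arg_cong2[where f="(-)"] sum.cong)
qed (auto simp: codiff1_op_def codiff1_def mtimes_def algebra_simps sum.distrib sum_distrib_left)

lemma sum_arrow_index:
  "(\<Sum>k\<in>arrow_index. codiff1_op z k * (case k of (i, j, c, b) \<Rightarrow> y i j c b)) =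
   (\<Sum>j\<in>vertices \<Gamma>. mpair (B j) (C j) (\<lambda>b c. z (j, b, c)) (diff1 y j))"
proof -
  have "(\<Sum>k\<in>arrow_index. codiff1_op z k * (case k of (i, j, c, b) \<Rightarrow> y i j c b)) =
    (\<Sum>i\<in>vertices \<Gamma>. \<Sum>j\<in>nbrs \<Gamma> i. \<Sum>c\<in>C i. \<Sum>b\<in>B j. codiff1 (\<lambda>i b c. z (i, b, c)) i j b c * y i j c b)"
  proof -
    have "(\<Sum>i\<in>vertices \<Gamma>. \<Sum>j\<in>nbrs \<Gamma> i. \<Sum>c\<in>C i. \<Sum>b\<in>B j. f i j c b) = (\<Sum>(i, j, c, b)\<in>arrow_index. f i j c b)"
      for f :: "nat \<Rightarrow> nat \<Rightarrow> 'c \<Rightarrow> 'b \<Rightarrow> complex"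
    proof -
      have "(\<Sum>j\<in>nbrs \<Gamma> i. \<Sum>c\<in>C i. \<Sum>b\<in>B j. f i j c b) = (\<Sum>(j, c, b)\<in>(SIGMA j:nbrs \<Gamma> i. C i \<times> B j). f i j c b)"
        if "i \<in> vertices \<Gamma>" for i
      proof -
        have "(\<Sum>j\<in>nbrs \<Gamma> i. \<Sum>(c, b)\<in>C i \<times> B j. f i j c b) =
              (\<Sum>(j, c, b)\<in>(SIGMA j:nbrs \<Gamma> i. C i \<times> B j). f i j c b)"
          using that by (subst sum.Sigma) (auto dest: nbrs_vertices)
        then show ?thesis by (simp add: sum.cartesian_product)
      qed
      then have "(\<Sum>i\<in>vertices \<Gamma>. \<Sum>j\<in>nbrs \<Gamma> i. \<Sum>c\<in>C i. \<Sum>b\<in>B j. f i j c b) =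
         (\<Sum>i\<in>vertices \<Gamma>. \<Sum>(j, c, b)\<in>(SIGMA j:nbrs \<Gamma> i. C i \<times> B j). f i j c b)"
        by simp
      also have "\<dots> = (\<Sum>(i, j, c, b)\<in>arrow_index. f i j c b)"
        unfolding arrow_index_def
        by (subst sum.Sigma) (auto dest: nbrs_vertices intro!: finite_SigmaI finite_cartesian_product)
      finally show ?thesis .
    qed
    then show ?thesis by (simp add: codiff1_op_def case_prod_unfold)
  qed
  also have "\<dots> = (\<Sum>i\<in>vertices \<Gamma>. \<Sum>j\<in>nbrs \<Gamma> i. mpair (B j) (C i) (codiff1 (\<lambda>i b c. z (i, b, c)) i j) (y i j))"
    unfolding mpair_def by (intro sum.cong refl) (rule sum.swap)
  also have "\<dots> = (\<Sum>i\<in>vertices \<Gamma>. \<Sum>j\<in>vertices \<Gamma>. mpair (B j) (C i) (codiff1 (\<lambda>i b c. z (i, b, c)) i j) (y i j))"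
    by (intro sum.cong refl sum.mono_neutral_left)
       (auto simp: nbrs_def mpair_def codiff1_def edge_sign_def)
  also have "\<dots> = (\<Sum>j\<in>vertices \<Gamma>. mpair (B j) (C j) (\<lambda>b c. z (j, b, c)) (diff1 y j))"
    by (rule codiff1_adjoint)
  finally show ?thesis .
qed

lemma codiff1_op_diff0_op_orthogonal: "(\<Sum>k\<in>arrow_index. codiff1_op z k * diff0_op x k) = 0"
proof -
  have "(\<Sum>k\<in>arrow_index. codiff1_op z k * diff0_op x k) =
    (\<Sum>j\<in>vertices \<Gamma>. mpair (B j) (C j) (\<lambda>b c. z (j, b, c)) (diff1 (diff0 (\<lambda>i c b. x (i, c, b))) j))"
    unfolding diff0_op_def by (rule sum_arrow_index)
  also have "\<dots> = (\<Sum>j\<in>vertices \<Gamma>. mpair (B j) (C j) (\<lambda>b c. z (j, b, c)) (\<lambda>_ _. 0))"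
    by (intro sum.cong mpair_cong) (auto simp: diff1_diff0)
  finally show ?thesis by (simp add: mpair_def)
qed

abbreviation "hom \<equiv> matrix_hom \<Gamma> B q C r"
abbreviation "cohom \<equiv> matrix_hom \<Gamma> C r B q"

lemma diff0_op_zero: "(\<forall>k\<in>arrow_index. diff0_op x k = 0) \<longleftrightarrow> hom (\<lambda>i c b. x (i, c, b))"
  by (auto simp: arrow_index_def diff0_op_def matrix_hom_def diff0_def)

lemma codiff1_op_zero: "(\<forall>k\<in>arrow_index. codiff1_op z k = 0) \<longleftrightarrow> cohom (\<lambda>i b c. z (i, b, c))"
proof -
  have "(\<forall>k\<in>arrow_index. codiff1_op z k = 0) \<longleftrightarrow>
    (\<forall>i\<in>vertices \<Gamma>. \<forall>j\<in>nbrs \<Gamma> i. \<forall>c\<in>C i. \<forall>b\<in>B j. codiff1 (\<lambda>i b c. z (i, b, c)) i j b c = 0)"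
    by (auto simp: arrow_index_def codiff1_op_def)
  also have "\<dots> \<longleftrightarrow> (\<forall>i\<in>vertices \<Gamma>. \<forall>j\<in>nbrs \<Gamma> i. \<forall>c\<in>C i. \<forall>b\<in>B j.
     mtimes (C j) (\<lambda>b c. z (j, b, c)) (r j i) b c = mtimes (B i) (q j i) (\<lambda>b c. z (i, b, c)) b c)"
    by (intro ball_cong refl) (auto simp: codiff1_def nbrs_def edge_sign_neq_0)
  also have "\<dots> \<longleftrightarrow> cohom (\<lambda>i b c. z (i, b, c))"
    unfolding matrix_hom_def nbrs_def using adjacent_sym[of \<Gamma>] by blast
  finally show ?thesis .
qed

context
  fixes F G
  assumes F: "F \<subseteq> hom_index" and G: "G \<subseteq> cohom_index"
    and injF: "\<And>x. hom x \<Longrightarrow> (\<And>i c b. (i, c, b) \<in> F \<Longrightarrow> x i c b = 0) \<Longrightarrow>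
       (i, c, b) \<in> hom_index \<Longrightarrow> x i c b = 0"
    and injG: "\<And>z. cohom z \<Longrightarrow> (\<And>i b c. (i, b, c) \<in> G \<Longrightarrow> z i b c = 0) \<Longrightarrow>
       (i, b, c) \<in> cohom_index \<Longrightarrow> z i b c = 0"
begin

lemma finite_FG: "finite F" "finite G"
  using F G finite_subset finite_index by blast+

lemma diff0_op_injective: "(\<And>k. k \<in> arrow_index \<Longrightarrow> diff0_op x k = 0) \<Longrightarrow> (\<And>i. i \<in> F \<Longrightarrow> x i = 0) \<Longrightarrow> \<forall>i\<in>hom_index. x i = 0"
  using injF[of "\<lambda>i c b. x (i, c, b)"] diff0_op_zero[of x] by auto

lemma codiff1_op_injective: "(\<And>k. k \<in> arrow_index \<Longrightarrow> codiff1_op z k = 0) \<Longrightarrow> (\<And>i. i \<in> G \<Longrightarrow> z i = 0) \<Longrightarrow> \<forall>i\<in>cohom_index. z i = 0"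
  using injG[of "\<lambda>i c b. z (i, c, b)"] codiff1_op_zero[of z] by auto

text \<open>\<open>2 \<Sum>\<^sub>i d\<^sub>i e\<^sub>i - \<Sum>\<^sub>i\<^sub>-\<^sub>j d\<^sub>i e\<^sub>j \<le> dim Hom(V,W) + dim Hom(W,V)\<close>, where the dimensions on the right are
  replaced by numbers of matrix entries that detect a homomorphism.\<close>

lemma hom_bound:
  "2 * (\<Sum>i\<in>vertices \<Gamma>. card (C i) * card (B i)) \<le>
   (\<Sum>i\<in>vertices \<Gamma>. \<Sum>j\<in>nbrs \<Gamma> i. card (C i) * card (B j)) + card F + card G"
proof -
  have "card hom_index + card cohom_index \<le> card arrow_index + card F + card G"
    by (rule orthogonal_images_bound[OF _ _ _ finite_FG F G lin_op_diff0_op lin_op_codiff1_op codiff1_op_diff0_op_orthogonal diff0_op_injective codiff1_op_injective]) simp_all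
  then show ?thesis by (simp add: card_index)
qed

text \<open>Equality in the bound makes the complex exact in the middle: every cocycle is a coboundary.\<close>

lemma hom_exact:
  assumes eq: "2 * (\<Sum>i\<in>vertices \<Gamma>. card (C i) * card (B i)) \<ge>
       (\<Sum>i\<in>vertices \<Gamma>. \<Sum>j\<in>nbrs \<Gamma> i. card (C i) * card (B j)) + card F + card G"
    and y: "\<And>j c b. j \<in> vertices \<Gamma> \<Longrightarrow> c \<in> C j \<Longrightarrow> b \<in> B j \<Longrightarrow> diff1 y j c b = 0"
  shows "\<exists>x. \<forall>i\<in>vertices \<Gamma>. \<forall>j\<in>nbrs \<Gamma> i. \<forall>c\<in>C i. \<forall>b\<in>B j. diff0 x i j c b = y i j c b"
proof -
  have "\<exists>x. \<forall>k\<in>arrow_index. diff0_op x k = (case k of (i, j, c, b) \<Rightarrow> y i j c b)"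
  proof (rule orthogonal_images_exact[OF _ _ _ finite_FG F G lin_op_diff0_op lin_op_codiff1_op codiff1_op_diff0_op_orthogonal diff0_op_injective codiff1_op_injective])
    show "card arrow_index + card F + card G \<le> card hom_index + card cohom_index"
      using eq by (simp add: card_index)
    show "(\<Sum>k\<in>arrow_index. codiff1_op z k * (case k of (i, j, c, b) \<Rightarrow> y i j c b)) = 0" for z
    proof -
      have "(\<Sum>j\<in>vertices \<Gamma>. mpair (B j) (C j) (\<lambda>b c. z (j, b, c)) (diff1 y j)) =
        (\<Sum>j\<in>vertices \<Gamma>. mpair (B j) (C j) (\<lambda>b c. z (j, b, c)) (\<lambda>_ _. 0))"
        by (intro sum.cong mpair_cong) (auto simp: y)
      then show ?thesis unfolding sum_arrow_index by (simp add: mpair_def)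
    qed
  qed simp_all
  then obtain x where x: "\<And>k. k \<in> arrow_index \<Longrightarrow> diff0_op x k = (case k of (i, j, c, b) \<Rightarrow> y i j c b)" by blast
  show ?thesis
  proof (intro exI ballI)
    fix i j c b assume "i \<in> vertices \<Gamma>" "j \<in> nbrs \<Gamma> i" "c \<in> C i" "b \<in> B j"
    then show "diff0 (\<lambda>i c b. x (i, c, b)) i j c b = y i j c b"
      using x[of "(i, j, c, b)"] by (simp add: arrow_index_def diff0_op_def)
  qed
qed

end

text \<open>By adjointness with \<open>codiff1\<close>; it extracts scalar equations from relations between values of \<open>diff1\<close>.\<close>

lemma cohom_pair_diff1:
  assumes "cohom z"
  shows "(\<Sum>j\<in>vertices \<Gamma>. mpair (B j) (C j) (z j) (diff1 y j)) = 0"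
proof -
  have "(\<Sum>k\<in>arrow_index. codiff1_op (\<lambda>(i, b, c). z i b c) k * (case k of (i, j, c, b) \<Rightarrow> y i j c b)) = 0"
    using codiff1_op_zero[of "\<lambda>(i, b, c). z i b c"] assms by (intro sum.neutral) auto
  then show ?thesis unfolding sum_arrow_index by simp
qed

end

section \<open>Linear maps between finite-dimensional subspaces\<close>

locale ambient_space = vector_space scale
  for scale :: "complex \<Rightarrow> 'v::ab_group_add \<Rightarrow> 'v" (infixr "*s" 75)
begin

abbreviation "lin \<equiv> linear_between scale"
abbreviation "fd_space \<equiv> fin_dim_subspace scale"

sublocale vs_pair: vector_space_pair scale scale ..

lemma fd_space_subspace: "fd_space U \<Longrightarrow> subspace U"
  by (simp add: fin_dim_subspace_def)

lemma fd_space_basis: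
  assumes "fd_space U" obtains B where "finite B" "independent B" "span B = U"
proof -
  obtain D where D: "finite D" "U = span D" using assms by (auto simp: fin_dim_subspace_def)
  obtain B where "B \<subseteq> D" "independent B" "D \<subseteq> span B" using maximal_independent_subset by metis
  then show ?thesis using that D by (metis finite_subset span_eq span_mono span_superset subset_trans)
qed

lemma fd_space_mono:
  assumes U: "fd_space U" and W: "subspace W" "W \<subseteq> U"
  shows "fd_space W" and "dim W \<le> dim U" and "dim W = dim U \<Longrightarrow> W = U"
proof -
  obtain D where D: "finite D" "independent D" "span D = U" using fd_space_basis[OF U] .
  obtain B where B: "B \<subseteq> W" "independent B" "W \<subseteq> span B" using maximal_independent_subset by metis
  have fin: "finite B" "card B \<le> card D"
    using independent_span_bound[of D B] D B W by auto
  have BW: "span B = W" using B W(1) by (simp add: span_minimal subset_antisym)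
  show "fd_space W" using W(1) fin(1) BW by (auto simp: fin_dim_subspace_def)
  have dims: "dim W = card B" "dim U = card D" using D B BW by (auto intro: dim_eq_card)
  show "dim W \<le> dim U" using fin dims by simp
  show "W = U" if eq: "dim W = dim U"
  proof -
    obtain B' where B': "B \<subseteq> B'" "B' \<subseteq> U" "independent B'" "U \<subseteq> span B'"
      using maximal_independent_subset_extend[of B U] B W by blast
    have "finite B' \<and> card B' \<le> card D"
      using independent_span_bound[of D B'] D B' by auto
    then have "B' = B" using B'(1) eq dims card_seteq[of B' B] by simp
    then show ?thesis using B'(4) BW W by auto
  qed
qed

lemma lin_mem: "lin U W f \<Longrightarrow> u \<in> U \<Longrightarrow> f u \<in> W"
  and lin_add: "lin U W f \<Longrightarrow> u \<in> U \<Longrightarrow> v \<in> U \<Longrightarrow> f (u + v) = f u + f v"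
  and lin_scale: "lin U W f \<Longrightarrow> u \<in> U \<Longrightarrow> f (c *s u) = c *s f u"
  by (simp_all add: linear_between_def)

lemma lin_zero: "lin U W f \<Longrightarrow> subspace U \<Longrightarrow> f 0 = 0"
  using lin_scale[of U W f 0 0] subspace_0 by fastforce

lemma lin_diff:
  assumes "lin U W f" "subspace U" "u \<in> U" "v \<in> U" shows "f (u - v) = f u - f v"
proof -
  have "f (u - v) = f (u + (-1) *s v)" by simp
  also have "\<dots> = f u + (-1) *s f v"
    using assms subspace_scale[OF assms(2,4), of "-1"] by (simp only: lin_add lin_scale)
  finally show ?thesis by simp
qed

lemma lin_sum:
  assumes f: "lin U W f" and U: "subspace U" and x: "\<And>i. i \<in> I \<Longrightarrow> x i \<in> U"
  shows "f (\<Sum>i\<in>I. a i *s x i) = (\<Sum>i\<in>I. a i *s f (x i))"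
  using x
proof (induction I rule: infinite_finite_induct)
  case (insert i I)
  then show ?case
    using f U by (simp add: lin_add[OF f] lin_scale[OF f] subspace_scale subspace_sum)
qed (use f U in \<open>auto simp: lin_zero\<close>)

lemma lin_compose: "lin U W f \<Longrightarrow> lin W X g \<Longrightarrow> lin U X (\<lambda>v. g (f v))"
  by (simp add: linear_between_def)

lemma lin_linear:
  assumes "Vector_Spaces.linear scale scale f" "\<And>u. u \<in> U \<Longrightarrow> f u \<in> W"
  shows "lin U W f"
  using assms by (auto simp: linear_between_def Vector_Spaces.linear_iff)

lemma lin_kernel: "lin U W f \<Longrightarrow> subspace U \<Longrightarrow> subspace {u \<in> U. f u = 0}"
  by (auto simp: subspace_def linear_between_def) (metis scale_zero_left scale_zero_right)

lemma lin_image: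
  assumes f: "lin U W f" and U: "subspace U" shows "subspace (f ` U)"
  unfolding subspace_def
proof (intro conjI ballI allI)
  show "0 \<in> f ` U" using lin_zero[OF f U] subspace_0[OF U] by force
next
  fix x y assume "x \<in> f ` U" "y \<in> f ` U"
  then show "x + y \<in> f ` U" using lin_add[OF f] subspace_add[OF U] by (auto simp: image_iff) metis
next
  fix c x assume "x \<in> f ` U"
  then show "c *s x \<in> f ` U" using lin_scale[OF f] subspace_scale[OF U] by (auto simp: image_iff) metis
qed

lemma lin_representation:
  assumes f: "lin (span B) (span C) f" and B: "finite B" "independent B" and C: "independent C"
    and v: "v \<in> span B"
  shows "representation C (f v) c = (\<Sum>b\<in>B. representation C (f b) c * representation B v b)"
proof -
  have "f v = f (\<Sum>b\<in>B. representation B v b *s b)"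
    using sum_representation_eq[OF B(2) v B(1)] by simp
  also have "\<dots> = (\<Sum>b\<in>B. representation B v b *s f b)"
    by (rule lin_sum[OF f]) (auto intro: span_base)
  finally have "representation C (f v) c = representation C (\<Sum>b\<in>B. representation B v b *s f b) c" by simp
  also have "\<dots> = (\<Sum>b\<in>B. representation C (representation B v b *s f b) c)"
    by (subst representation_sum[OF C]) (auto intro: span_scale lin_mem[OF f] span_base)
  also have "\<dots> = (\<Sum>b\<in>B. representation C (f b) c * representation B v b)"
    by (intro sum.cong refl) (simp add: representation_scale[OF C] lin_mem[OF f] span_base)
  finally show ?thesis .
qed

lemma representation_eq_imp_eq:
  assumes B: "finite B" "independent B" and v: "v \<in> span B" "w \<in> span B"
    and eq: "\<And>b. b \<in> B \<Longrightarrow> representation B v b = representation B w b"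
  shows "v = w"
proof -
  have "v = (\<Sum>b\<in>B. representation B v b *s b)" using sum_representation_eq[OF B(2) v(1) B(1)] by simp
  also have "\<dots> = (\<Sum>b\<in>B. representation B w b *s b)" by (simp add: eq)
  also have "\<dots> = w" using sum_representation_eq[OF B(2) v(2) B(1)] by simp
  finally show ?thesis .
qed

lemma lin_eq_on_basis:
  assumes f: "lin (span B) W f" "lin (span B) W g" and B: "finite B" "independent B"
    and eq: "\<And>b. b \<in> B \<Longrightarrow> f b = g b" and v: "v \<in> span B"
  shows "f v = g v"
proof -
  have "h v = (\<Sum>b\<in>B. representation B v b *s h b)" if "lin (span B) W h" for h
    using lin_sum[OF that, of B "\<lambda>b. b" "representation B v"] sum_representation_eq[OF B(2) v B(1)]
    by (simp add: span_base)
  from this[OF f(1)] this[OF f(2)] show ?thesis using eq by simp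
qed

lemma lin_of_matrix:
  assumes B: "finite B" "independent B" and C: "finite C" "independent C"
  shows "\<exists>f. lin (span B) (span C) f \<and> (\<forall>b\<in>B. \<forall>c\<in>C. representation C (f b) c = x c b)"
proof -
  define g where "g b = (\<Sum>c\<in>C. x c b *s c)" for b
  define f where "f = vs_pair.construct B g"
  have gspan: "g b \<in> span C" for b
    unfolding g_def by (intro span_sum span_scale span_base)
  have "f v \<in> span C" for v
  proof -
    have "f v \<in> span (g ` B)" unfolding f_def by (rule vs_pair.construct_in_span[OF B(2)])
    also have "\<dots> \<subseteq> span C" using gspan by (intro span_minimal) auto
    finally show ?thesis .
  qed
  then have "lin (span B) (span C) f"
    unfolding f_def by (intro lin_linear vs_pair.linear_construct B)
  moreover have "representation C (f b) c = x c b" if "b \<in> B" "c \<in> C" for b c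
  proof -
    have "representation C (f b) c = (\<Sum>c'\<in>C. representation C (x c' b *s c') c)"
      unfolding f_def vs_pair.construct_basis[OF B(2) that(1)] g_def
      by (subst representation_sum[OF C(2)]) (auto intro: span_scale span_base)
    also have "\<dots> = (\<Sum>c'\<in>C. if c = c' then x c' b else 0)"
      by (intro sum.cong refl)
         (auto simp: representation_scale[OF C(2)] span_base representation_basis[OF C(2)])
    also have "\<dots> = x c b" using that C by simp
    finally show ?thesis .
  qed
  ultimately show ?thesis by blast
qed

text \<open>A projection with kernel \<open>T\<close> that fixes \<open>S\<close>. Its image is a complement of \<open>T\<close>, which serves below as
  a model of the quotient by \<open>T\<close> inside the same ambient space.\<close>

lemma exists_projection:
  assumes S: "subspace S" and T: "subspace T" and ST: "S \<inter> T = {0}"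
  shows "\<exists>p. Vector_Spaces.linear scale scale p \<and> (\<forall>v\<in>T. p v = 0) \<and> (\<forall>v\<in>S. p v = v) \<and>
     (\<forall>v. v - p v \<in> T)"
proof -
  obtain \<pi> where \<pi>: "\<pi> ` UNIV \<subseteq> S" "Vector_Spaces.linear scale scale \<pi>" "\<forall>v\<in>S. \<pi> v = v"
    using vs_pair.linear_exists_left_inverse_on[OF linear_id S] by auto
  have lin1: "Vector_Spaces.linear scale scale (\<lambda>v. v - \<pi> v)"
    using \<pi>(2) by (auto simp: Vector_Spaces.linear_iff scale_right_diff_distrib)
  have "inj_on (\<lambda>v. v - \<pi> v) T"
  proof (rule inj_onI)
    fix v w assume vw: "v \<in> T" "w \<in> T" "v - \<pi> v = w - \<pi> w"
    have "v - w = \<pi> v - \<pi> w" using vw(3) by (simp add: algebra_simps)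
    moreover have "\<pi> v - \<pi> w \<in> S" using \<pi>(1) by (intro subspace_diff[OF S]) auto
    moreover have "v - w \<in> T" using subspace_diff[OF T] vw by auto
    ultimately have "v - w \<in> S \<inter> T" by simp
    then show "v = w" using ST by simp
  qed
  then obtain g where g: "g ` UNIV \<subseteq> T" "Vector_Spaces.linear scale scale g" "\<forall>v\<in>T. g (v - \<pi> v) = v"
    using vs_pair.linear_exists_left_inverse_on[OF lin1 T] by auto
  have "g 0 = 0" using g(2) by (auto simp: Vector_Spaces.linear_iff dest: spec[of _ 0])
  moreover have "Vector_Spaces.linear scale scale (\<lambda>v. v - g (v - \<pi> v))"
  proof -
    have "Vector_Spaces.linear scale scale (g \<circ> (\<lambda>v. v - \<pi> v))"
      by (rule Vector_Spaces.linear_compose[OF lin1 g(2)])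
    then show ?thesis by (auto simp: Vector_Spaces.linear_iff scale_right_diff_distrib)
  qed
  ultimately show ?thesis using g \<pi>(3)
    by (intro exI[of _ "\<lambda>v. v - g (v - \<pi> v)"]) auto
qed

lemma poly_map_ge:
  assumes "degree p \<le> n"
  shows "poly_map scale p f v = (\<Sum>k\<le>n. coeff p k *s (f ^^ k) v)"
  unfolding poly_map_def using assms
  by (intro sum.mono_neutral_left) (auto simp: coeff_eq_0)

lemma funpow_mem: "lin U U f \<Longrightarrow> v \<in> U \<Longrightarrow> (f ^^ k) v \<in> U"
  by (induction k) (auto intro: lin_mem)

lemma poly_map_mem: "lin U U f \<Longrightarrow> subspace U \<Longrightarrow> v \<in> U \<Longrightarrow> poly_map scale p f v \<in> U"
  unfolding poly_map_def by (intro subspace_sum subspace_scale funpow_mem)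

lemma poly_map_linear_factor:
  assumes f: "lin U U f" "subspace U" "v \<in> U"
  shows "poly_map scale ([:-z, 1:] * r) f v = f (poly_map scale r f v) - z *s poly_map scale r f v"
proof -
  have [simp]: "coeff ([:-z, 1:] * r) k = coeff (pCons 0 r) k - z * coeff r k" for k
    by simp
  have "poly_map scale ([:-z, 1:] * r) f v = (\<Sum>k\<le>Suc (degree r). coeff ([:-z, 1:] * r) k *s (f ^^ k) v)"
    by (rule poly_map_ge, rule order_trans[OF degree_mult_le]) auto
  also have "\<dots> = (\<Sum>k\<le>Suc (degree r). coeff (pCons 0 r) k *s (f ^^ k) v)
      - (\<Sum>k\<le>Suc (degree r). (z * coeff r k) *s (f ^^ k) v)"
    by (simp only: \<open>\<And>k. coeff ([:-z, 1:] * r) k = _ k\<close> scale_left_diff_distrib sum_subtractf)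
  also have "(\<Sum>k\<le>Suc (degree r). (z * coeff r k) *s (f ^^ k) v) = z *s poly_map scale r f v"
    by (subst poly_map_ge[of r "Suc (degree r)"]) (simp_all add: scale_sum_right scale_right_distrib del: sum.atMost_Suc)
  also have "(\<Sum>k\<le>Suc (degree r). coeff (pCons 0 r) k *s (f ^^ k) v) =
     (\<Sum>k\<le>degree r. coeff r k *s f ((f ^^ k) v))"
    by (subst sum.atMost_Suc_shift) simp
  also have "\<dots> = f (poly_map scale r f v)"
    unfolding poly_map_def by (rule lin_sum[symmetric, OF f(1,2)]) (rule funpow_mem[OF f(1,3)])
  finally show ?thesis .
qed

text \<open>For a polynomial \<open>m\<close> of minimal degree with \<open>m(f) v = 0\<close> and a root \<open>z\<close> of \<open>m = (X - z) r\<close>, the vector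
  \<open>r(f) v\<close> is nonzero and has eigenvalue \<open>z\<close>.\<close>

lemma exists_eigenvector:
  assumes U: "fd_space U" and f: "lin U U f" and nz: "U \<noteq> {0}"
  shows "\<exists>z v. v \<in> U \<and> v \<noteq> 0 \<and> f v = z *s v"
proof -
  note sub = fd_space_subspace[OF U]
  obtain v where v: "v \<in> U" "v \<noteq> 0" using nz subspace_0[OF sub] by blast
  obtain B where B: "finite B" "independent B" "span B = U" using fd_space_basis[OF U] .
  obtain x where x: "\<exists>i\<in>{..card B}. x i \<noteq> 0"
      "\<forall>b\<in>B. (\<Sum>i\<le>card B. representation B ((f ^^ i) v) b * x i) = 0"
    using underdetermined_system[of B "{..card B}" "\<lambda>b i. representation B ((f ^^ i) v) b"] B by auto
  define p where "p = (\<Sum>i\<le>card B. monom (x i) i)"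
  have cp: "coeff p k = (if k \<le> card B then x k else 0)" for k
    by (simp add: p_def coeff_sum)
  have "p \<noteq> 0" using x(1) cp by (metis atMost_iff coeff_0)
  have "(\<Sum>i\<le>card B. x i *s (f ^^ i) v) = 0"
  proof (rule representation_eq_imp_eq[OF B(1,2)])
    show "(\<Sum>i\<le>card B. x i *s (f ^^ i) v) \<in> span B" "0 \<in> span B"
      using funpow_mem[OF f v(1)] B(3) by (auto intro!: span_sum span_scale simp: span_zero)
    fix b assume "b \<in> B"
    have "representation B (\<Sum>i\<le>card B. x i *s (f ^^ i) v) b = (\<Sum>i\<le>card B. representation B (x i *s (f ^^ i) v) b)"
      using funpow_mem[OF f v(1)] B(3) by (subst representation_sum[OF B(2)]) (auto intro!: span_scale)
    also have "\<dots> = (\<Sum>i\<le>card B. representation B ((f ^^ i) v) b * x i)"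
      using funpow_mem[OF f v(1)] B(3) by (intro sum.cong refl) (simp add: representation_scale[OF B(2)])
    finally show "representation B (\<Sum>i\<le>card B. x i *s (f ^^ i) v) b = representation B 0 b"
      using x(2) \<open>b \<in> B\<close> by (simp add: representation_zero)
  qed
  moreover have "degree p \<le> card B" by (rule degree_le) (simp add: cp)
  ultimately have "poly_map scale p f v = 0" by (simp add: poly_map_ge cp)
  then have ex: "\<exists>p. p \<noteq> 0 \<and> poly_map scale p f v = 0" using \<open>p \<noteq> 0\<close> by blast
  define m where "m = (ARG_MIN degree p. p \<noteq> 0 \<and> poly_map scale p f v = 0)"
  have m: "m \<noteq> 0" "poly_map scale m f v = 0"
    and min: "\<And>r. r \<noteq> 0 \<Longrightarrow> poly_map scale r f v = 0 \<Longrightarrow> degree m \<le> degree r"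
    using arg_min_natI[of "\<lambda>p. p \<noteq> 0 \<and> poly_map scale p f v = 0" _ degree]
      arg_min_nat_le[of "\<lambda>p. p \<noteq> 0 \<and> poly_map scale p f v = 0" _ degree] ex
    unfolding m_def by blast+
  have "degree m \<noteq> 0"
  proof
    assume "degree m = 0"
    then obtain a where "m = [:a:]" by (metis degree_eq_zeroE)
    then show False using m v by (simp add: poly_map_def)
  qed
  then have "\<not> constant (poly m)" by (simp add: constant_degree)
  then obtain z where "poly m z = 0" using fundamental_theorem_of_algebra by blast
  then obtain r where r: "m = [:-z, 1:] * r" by (metis dvdE poly_eq_0_iff_dvd)
  have "r \<noteq> 0" using r m by auto
  have "degree m = Suc (degree r)" unfolding r using \<open>r \<noteq> 0\<close> by (subst degree_mult_eq) auto
  then have "poly_map scale r f v \<noteq> 0" using min[OF \<open>r \<noteq> 0\<close>] by auto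
  moreover have "f (poly_map scale r f v) = z *s poly_map scale r f v"
    using m(2) poly_map_linear_factor[OF f sub v(1), of z r] by (simp add: r)
  ultimately show ?thesis using poly_map_mem[OF f sub v(1)] by blast
qed

text \<open>Taylor expansion at \<open>z\<close> on a Jordan chain of length at most two.\<close>

lemma poly_map_jordan:
  assumes f: "lin U U f" "v \<in> U" "n \<in> U" and fv: "f v = z *s v + n" and fn: "f n = z *s n" and sub: "subspace U"
  shows "poly_map scale p f v = poly p z *s v + poly (pderiv p) z *s n"
proof -
  have pow: "(f ^^ k) v = z ^ k *s v + (of_nat k * z ^ (k - 1)) *s n" for k
  proof (induction k)
    case (Suc k)
    have "(f ^^ Suc k) v = f (z ^ k *s v + (of_nat k * z ^ (k - 1)) *s n)" by (simp add: Suc)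
    also have "\<dots> = z ^ k *s f v + (of_nat k * z ^ (k - 1)) *s f n"
      using f sub by (simp only: lin_add[OF f(1)] lin_scale[OF f(1)] subspace_scale)
    also have "\<dots> = z ^ Suc k *s v + (z ^ k + of_nat k * (z ^ (k - 1) * z)) *s n"
      by (simp add: fv fn scale_right_distrib scale_left_distrib mult.commute mult.left_commute)
    also have "z ^ k + of_nat k * (z ^ (k - 1) * z) = of_nat (Suc k) * z ^ (Suc k - 1)"
      by (cases k) (auto simp: algebra_simps)
    finally show ?case .
  qed simp
  have "poly (pderiv p) z = (\<Sum>k\<le>degree p. coeff p k * (of_nat k * z ^ (k - 1)))"
  proof -
    have "pderiv p = pderiv (\<Sum>k\<le>degree p. monom (coeff p k) k)"
      by (simp add: poly_as_sum_of_monoms)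
    also have "\<dots> = (\<Sum>k\<le>degree p. monom (of_nat k * coeff p k) (k - 1))"
      by (simp add: pderiv_monom higher_pderiv_sum[of 1, simplified])
    finally show ?thesis by (simp add: poly_sum poly_monom algebra_simps)
  qed
  then show ?thesis
    by (simp add: poly_map_def pow poly_altdef scale_sum_left scale_right_distrib sum.distrib)
qed

end

section \<open>Subrepresentations, quotients and simple representations\<close>

locale ade_quiver = ambient_space scale
  for scale :: "complex \<Rightarrow> 'v::ab_group_add \<Rightarrow> 'v" (infixr "*s" 75) +
  fixes \<Gamma> :: dynkin and P' :: "nat \<Rightarrow> complex poly"
  assumes ADE: "is_ADE \<Gamma>"
begin

abbreviation "I \<equiv> vertices \<Gamma>"
abbreviation "rep \<equiv> is_rep scale \<Gamma> P'"
abbreviation "subrep \<equiv> is_subrep scale \<Gamma>"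
abbreviation "morph \<equiv> is_morphism scale \<Gamma>"

lemma adj_I: "adjacent \<Gamma> i j \<Longrightarrow> i \<in> I" "adjacent \<Gamma> i j \<Longrightarrow> j \<in> I"
  using adjacent_vertices[OF ADE] by auto

lemma rep_fd_space: "rep V \<Longrightarrow> i \<in> I \<Longrightarrow> fd_space (vspace V i)"
  and rep_edge: "rep V \<Longrightarrow> adjacent \<Gamma> i j \<Longrightarrow> lin (vspace V j) (vspace V i) (edge_map V i j)"
  and rep_loop: "rep V \<Longrightarrow> i \<in> I \<Longrightarrow> lin (vspace V i) (vspace V i) (loop_map V i)"
  and rep_relation: "rep V \<Longrightarrow> j \<in> I \<Longrightarrow> v \<in> vspace V j \<Longrightarrow>
     (\<Sum>i\<in>I. of_int (edge_sign \<Gamma> i j) *s edge_map V j i (edge_map V i j v))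
          + poly_map scale (P' j) (loop_map V j) v = 0"
  and rep_commute: "rep V \<Longrightarrow> adjacent \<Gamma> i j \<Longrightarrow> v \<in> vspace V j \<Longrightarrow>
     edge_map V i j (loop_map V j v) = loop_map V i (edge_map V i j v)"
  using adj_I by (auto simp: is_rep_def)

lemma rep_subspace: "rep V \<Longrightarrow> i \<in> I \<Longrightarrow> subspace (vspace V i)"
  by (rule fd_space_subspace[OF rep_fd_space])

lemmas rep_edge_mem = lin_mem[OF rep_edge]
lemmas rep_loop_mem = lin_mem[OF rep_loop]

lemma subrepD:
  assumes "subrep V U"
  shows "i \<in> I \<Longrightarrow> subspace (U i)" "i \<in> I \<Longrightarrow> v \<in> U i \<Longrightarrow> v \<in> vspace V i"
    "adjacent \<Gamma> i j \<Longrightarrow> v \<in> U j \<Longrightarrow> edge_map V i j v \<in> U i"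
    "i \<in> I \<Longrightarrow> v \<in> U i \<Longrightarrow> loop_map V i v \<in> U i"
  using assms adj_I[of i j] unfolding is_subrep_def by blast+

lemma subrepI:
  assumes "\<And>i. i \<in> I \<Longrightarrow> subspace (U i)" "\<And>i v. i \<in> I \<Longrightarrow> v \<in> U i \<Longrightarrow> v \<in> vspace V i"
    "\<And>i j v. adjacent \<Gamma> i j \<Longrightarrow> v \<in> U j \<Longrightarrow> edge_map V i j v \<in> U i"
    "\<And>i v. i \<in> I \<Longrightarrow> v \<in> U i \<Longrightarrow> loop_map V i v \<in> U i"
  shows "subrep V U"
  using assms unfolding is_subrep_def by blast

lemma subrep_self: "rep V \<Longrightarrow> subrep V (vspace V)"
  by (rule subrepI) (auto intro: rep_subspace rep_edge_mem rep_loop_mem)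

lemma subrep_zero: "rep V \<Longrightarrow> subrep V (\<lambda>_. {0})"
  by (rule subrepI)
     (auto intro: subspace_0 rep_subspace simp: lin_zero[OF rep_edge] lin_zero[OF rep_loop] adj_I rep_subspace)

abbreviation restrict_rep :: "'v quiver_rep \<Rightarrow> (nat \<Rightarrow> 'v set) \<Rightarrow> 'v quiver_rep" where
  "restrict_rep V U \<equiv> V\<lparr>vspace := U\<rparr>"

lemma rep_restrict:
  assumes V: "rep V" and U: "subrep V U"
  shows "rep (restrict_rep V U)"
  unfolding is_rep_def
proof (intro conjI ballI impI allI)
  fix i assume i: "i \<in> I"
  show "fd_space (vspace (restrict_rep V U) i)"
    using fd_space_mono(1)[OF rep_fd_space[OF V i]] subrepD[OF U] i by auto
  show "lin (vspace (restrict_rep V U) i) (vspace (restrict_rep V U) i) (loop_map (restrict_rep V U) i)"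
    using rep_loop[OF V i] subrepD[OF U] i by (auto simp: linear_between_def)
next
  fix i j assume "adjacent \<Gamma> i j"
  then show "lin (vspace (restrict_rep V U) j) (vspace (restrict_rep V U) i) (edge_map (restrict_rep V U) i j)"
    using rep_edge[OF V, of i j] subrepD[OF U] adj_I[of i j] by (auto simp: linear_between_def)
next
  fix i j v assume "adjacent \<Gamma> i j" "v \<in> vspace (restrict_rep V U) j"
  then show "edge_map (restrict_rep V U) i j (loop_map (restrict_rep V U) j v) =
     loop_map (restrict_rep V U) i (edge_map (restrict_rep V U) i j v)"
    using rep_commute[OF V] subrepD[OF U] adj_I[of i j] by auto
next
  fix j v assume "j \<in> I" "v \<in> vspace (restrict_rep V U) j"
  then show "(\<Sum>i\<in>I. of_int (edge_sign \<Gamma> i j) *s edge_map (restrict_rep V U) j i (edge_map (restrict_rep V U) i j v))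
          + poly_map scale (P' j) (loop_map (restrict_rep V U) j) v = 0"
    using rep_relation[OF V] subrepD[OF U] by auto
qed

lemma subrep_restrict:
  assumes U: "subrep V U"
  shows "subrep (restrict_rep V U) W \<longleftrightarrow> subrep V W \<and> (\<forall>i\<in>I. W i \<subseteq> U i)"
proof
  assume W: "subrep (restrict_rep V U) W"
  have "W i \<subseteq> U i" if "i \<in> I" for i using subrepD(2)[OF W that] by auto
  moreover from this have "subrep V W"
    using subrepD[OF W] subrepD(2)[OF U] by (intro subrepI) auto
  ultimately show "subrep V W \<and> (\<forall>i\<in>I. W i \<subseteq> U i)" by blast
next
  assume W: "subrep V W \<and> (\<forall>i\<in>I. W i \<subseteq> U i)"
  then show "subrep (restrict_rep V U) W" using subrepD[of V W] by (intro subrepI) auto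
qed

definition simple_rep :: "'v quiver_rep \<Rightarrow> bool" where
  "simple_rep V \<longleftrightarrow> rep V \<and> nonzero_family \<Gamma> (vspace V) \<and>
     (\<forall>U. subrep V U \<longrightarrow> nonzero_family \<Gamma> U \<longrightarrow> (\<forall>i\<in>I. U i = vspace V i))"

lemma simple_repD:
  assumes "simple_rep V"
  shows "rep V" "nonzero_family \<Gamma> (vspace V)"
    "subrep V U \<Longrightarrow> nonzero_family \<Gamma> U \<Longrightarrow> i \<in> I \<Longrightarrow> U i = vspace V i"
  using assms by (auto simp: simple_rep_def)

lemma nonzero_familyI: "i \<in> I \<Longrightarrow> v \<in> U i \<Longrightarrow> v \<noteq> 0 \<Longrightarrow> nonzero_family \<Gamma> U"
  by (auto simp: nonzero_family_def)

lemma nonzero_family_rep: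
  assumes "rep V" "nonzero_family \<Gamma> (vspace V)"
  obtains i v where "i \<in> I" "v \<in> vspace V i" "v \<noteq> 0"
  using assms subspace_0[OF rep_subspace] unfolding nonzero_family_def by blast

text \<open>The measure for choosing minimal subrepresentations and for the induction on representations.\<close>

definition total_dim :: "(nat \<Rightarrow> 'v set) \<Rightarrow> nat" where
  "total_dim U = (\<Sum>i\<in>I. dim (U i))"

lemma total_dim_less:
  assumes V: "\<And>i. i \<in> I \<Longrightarrow> fd_space (V i)" and U: "\<And>i. i \<in> I \<Longrightarrow> subspace (U i)" "\<And>i. i \<in> I \<Longrightarrow> U i \<subseteq> V i"
    and k: "k \<in> I" "U k \<noteq> V k"
  shows "total_dim U < total_dim V"
  unfolding total_dim_def
proof (rule sum_strict_mono_ex1)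
  show "\<forall>i\<in>I. dim (U i) \<le> dim (V i)" using fd_space_mono(2) assms by blast
  have "dim (U k) < dim (V k)" using fd_space_mono(2,3)[OF V U] k by (meson nless_le)
  then show "\<exists>i\<in>I. dim (U i) < dim (V i)" using k by blast
qed simp

lemma exists_simple_subrep:
  assumes V: "rep V" and nz: "nonzero_family \<Gamma> (vspace V)"
  shows "\<exists>S. subrep V S \<and> simple_rep (restrict_rep V S)"
proof -
  define S where "S = (ARG_MIN total_dim U. subrep V U \<and> nonzero_family \<Gamma> U)"
  have S: "subrep V S" "nonzero_family \<Gamma> S"
    and min: "\<And>U. subrep V U \<Longrightarrow> nonzero_family \<Gamma> U \<Longrightarrow> total_dim S \<le> total_dim U"
    using arg_min_natI[of "\<lambda>U. subrep V U \<and> nonzero_family \<Gamma> U" "vspace V" total_dim]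
      arg_min_nat_le[of "\<lambda>U. subrep V U \<and> nonzero_family \<Gamma> U" _ total_dim] subrep_self[OF V] nz
    unfolding S_def by blast+
  note R = rep_restrict[OF V S(1)]
  have "U i = S i" if U: "subrep (restrict_rep V S) U" "nonzero_family \<Gamma> U" "i \<in> I" for U i
  proof (rule ccontr)
    assume "U i \<noteq> S i"
    then have "total_dim U < total_dim S"
      using rep_fd_space[OF R] subrepD[OF U(1)] U(3) by (intro total_dim_less[of S U i]) auto
    moreover have "subrep V U" using U(1) subrep_restrict[OF S(1)] by blast
    ultimately show False using min[of U] U(2) by simp
  qed
  then show ?thesis using S R by (auto simp: simple_rep_def)
qed

lemma morphD:
  assumes "morph V W f"
  shows "i \<in> I \<Longrightarrow> lin (vspace V i) (vspace W i) (f i)"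
    "adjacent \<Gamma> i j \<Longrightarrow> v \<in> vspace V j \<Longrightarrow> f i (edge_map V i j v) = edge_map W i j (f j v)"
    "i \<in> I \<Longrightarrow> v \<in> vspace V i \<Longrightarrow> f i (loop_map V i v) = loop_map W i (f i v)"
  using assms adj_I[of i j] unfolding is_morphism_def by blast+

lemma morphI:
  assumes "\<And>i. i \<in> I \<Longrightarrow> lin (vspace V i) (vspace W i) (f i)"
    "\<And>i j v. adjacent \<Gamma> i j \<Longrightarrow> v \<in> vspace V j \<Longrightarrow> f i (edge_map V i j v) = edge_map W i j (f j v)"
    "\<And>i v. i \<in> I \<Longrightarrow> v \<in> vspace V i \<Longrightarrow> f i (loop_map V i v) = loop_map W i (f i v)"
  shows "morph V W f"
  using assms unfolding is_morphism_def by blast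

lemma morph_kernel:
  assumes V: "rep V" and W: "rep W" and f: "morph V W f"
  shows "subrep V (\<lambda>i. {v \<in> vspace V i. f i v = 0})"
proof (rule subrepI)
  show "subspace {v \<in> vspace V i. f i v = 0}" if "i \<in> I" for i
    by (rule lin_kernel[OF morphD(1)[OF f that] rep_subspace[OF V that]])
  show "edge_map V i j v \<in> {v \<in> vspace V i. f i v = 0}"
    if "adjacent \<Gamma> i j" "v \<in> {v \<in> vspace V j. f j v = 0}" for i j v
    using that morphD(2)[OF f] rep_edge_mem[OF V] lin_zero[OF rep_edge[OF W] rep_subspace[OF W]] adj_I
    by auto
  show "loop_map V i v \<in> {v \<in> vspace V i. f i v = 0}"
    if "i \<in> I" "v \<in> {v \<in> vspace V i. f i v = 0}" for i v
    using that morphD(3)[OF f] rep_loop_mem[OF V] lin_zero[OF rep_loop[OF W] rep_subspace[OF W]]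
    by auto
qed auto

lemma morph_image:
  assumes V: "rep V" and W: "rep W" and f: "morph V W f"
  shows "subrep W (\<lambda>i. f i ` vspace V i)"
proof (rule subrepI)
  show "subspace (f i ` vspace V i)" if "i \<in> I" for i
    by (rule lin_image[OF morphD(1)[OF f that] rep_subspace[OF V that]])
  show "edge_map W i j v \<in> f i ` vspace V i" if "adjacent \<Gamma> i j" "v \<in> f j ` vspace V j" for i j v
    using that morphD(2)[OF f, symmetric] rep_edge_mem[OF V] by auto
  show "loop_map W i v \<in> f i ` vspace V i" if "i \<in> I" "v \<in> f i ` vspace V i" for i v
    using that morphD(3)[OF f, symmetric] rep_loop_mem[OF V] by auto
qed (auto intro: lin_mem[OF morphD(1)[OF f]])

definition is_iso :: "'v quiver_rep \<Rightarrow> 'v quiver_rep \<Rightarrow> (nat \<Rightarrow> 'v \<Rightarrow> 'v) \<Rightarrow> bool" where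
  "is_iso V W f \<longleftrightarrow> morph V W f \<and> (\<forall>i\<in>I. bij_betw (f i) (vspace V i) (vspace W i))"

lemma lin_inj_onI:
  assumes "lin U W f" "subspace U" "\<And>v. v \<in> U \<Longrightarrow> f v = 0 \<Longrightarrow> v = 0"
  shows "inj_on f U"
proof (rule inj_onI)
  fix v w assume vw: "v \<in> U" "w \<in> U" "f v = f w"
  then have "f (v - w) = 0" using lin_diff[OF assms(1,2)] by simp
  then show "v = w" using assms(3)[OF subspace_diff[OF assms(2) vw(1,2)]] by simp
qed

lemma schur_iso:
  assumes V: "simple_rep V" and W: "simple_rep W" and f: "morph V W f"
    and nz: "i \<in> I" "v \<in> vspace V i" "f i v \<noteq> 0"
  shows "is_iso V W f"
proof -
  note rV = simple_repD(1)[OF V] and rW = simple_repD(1)[OF W]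
  have img: "f k ` vspace V k = vspace W k" if "k \<in> I" for k
    using simple_repD(3)[OF W morph_image[OF rV rW f] nonzero_familyI[of i "f i v"] that] nz by blast
  have "\<not> nonzero_family \<Gamma> (\<lambda>i. {v \<in> vspace V i. f i v = 0})"
    using simple_repD(3)[OF V morph_kernel[OF rV rW f], of i] nz by blast
  then have "w = 0" if "k \<in> I" "w \<in> vspace V k" "f k w = 0" for k w
    using that nonzero_familyI[of k w "\<lambda>i. {v \<in> vspace V i. f i v = 0}"] by blast
  then have "inj_on (f k) (vspace V k)" if "k \<in> I" for k
    using that lin_inj_onI[OF morphD(1)[OF f that] rep_subspace[OF rV that]] by blast
  then show ?thesis using f img by (auto simp: is_iso_def bij_betw_def)
qed

lemma iso_inverse:
  assumes V: "rep V" and W: "rep W" and f: "is_iso V W f"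
  shows "is_iso W V (\<lambda>i. inv_into (vspace V i) (f i))"
proof -
  define g where "g i = inv_into (vspace V i) (f i)" for i
  have m: "morph V W f" and bij: "i \<in> I \<Longrightarrow> bij_betw (f i) (vspace V i) (vspace W i)" for i
    using f by (auto simp: is_iso_def)
  have g: "g i w \<in> vspace V i" "f i (g i w) = w" if "i \<in> I" "w \<in> vspace W i" for i w
    using bij[OF that(1)] that unfolding g_def
    by (auto simp: bij_betw_def intro: inv_into_into f_inv_into_f)
  have uniq: "g i w = v" if "i \<in> I" "v \<in> vspace V i" "f i v = w" for i v w
    using bij[OF that(1)] that unfolding g_def by (auto simp: bij_betw_def)
  have "morph W V g"
  proof (rule morphI)
    fix i assume i: "i \<in> I"
    note sub = rep_subspace[OF V i] and lbf = morphD(1)[OF m i]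
    show "lin (vspace W i) (vspace V i) (g i)"
      unfolding linear_between_def
      by (auto simp: g[OF i] lin_add[OF lbf] lin_scale[OF lbf] intro!: uniq[OF i] subspace_add[OF sub] subspace_scale[OF sub])
    show "g i (loop_map W i w) = loop_map V i (g i w)" if "w \<in> vspace W i" for w
      using g[OF i that] i by (intro uniq) (auto simp: morphD(3)[OF m] intro: rep_loop_mem[OF V])
  next
    fix i j w assume ij: "adjacent \<Gamma> i j" and w: "w \<in> vspace W j"
    show "g i (edge_map W i j w) = edge_map V i j (g j w)"
      using g[OF adj_I(2)[OF ij] w] ij adj_I[OF ij]
      by (intro uniq) (auto simp: morphD(2)[OF m] intro: rep_edge_mem[OF V])
  qed
  moreover have "bij_betw (g i) (vspace W i) (vspace V i)" if "i \<in> I" for i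
    unfolding g_def using bij[OF that] by (rule bij_betw_inv_into)
  ultimately show ?thesis by (simp add: is_iso_def g_def[abs_def])
qed

lemma morph_combination:
  assumes V: "rep V" and W: "rep W" and f: "morph V W f" and g: "morph V W g"
  shows "morph V W (\<lambda>i v. f i v - c *s g i v)"
proof (rule morphI)
  fix i assume i: "i \<in> I"
  note lf = morphD(1)[OF f i] and lg = morphD(1)[OF g i] and sW = rep_subspace[OF W i]
  show "lin (vspace V i) (vspace W i) (\<lambda>v. f i v - c *s g i v)"
    unfolding linear_between_def
  proof (intro conjI ballI allI)
    fix u v d assume u: "u \<in> vspace V i" and v: "v \<in> vspace V i"
    show "f i u - c *s g i u \<in> vspace W i"
      using lin_mem[OF lf u] lin_mem[OF lg u] sW by (intro subspace_diff subspace_scale)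
    show "f i (u + v) - c *s g i (u + v) = f i u - c *s g i u + (f i v - c *s g i v)"
      using u v by (simp add: lin_add[OF lf] lin_add[OF lg] scale_right_distrib)
    show "f i (d *s u) - c *s g i (d *s u) = d *s (f i u - c *s g i u)"
      using u by (simp add: lin_scale[OF lf] lin_scale[OF lg] scale_right_diff_distrib mult.commute)
  qed
  show "f i (loop_map V i v) - c *s g i (loop_map V i v) = loop_map W i (f i v - c *s g i v)"
    if "v \<in> vspace V i" for v
    using that lin_mem[OF lf that] lin_mem[OF lg that] i sW
    by (simp add: morphD(3)[OF f] morphD(3)[OF g] lin_diff[OF rep_loop[OF W i] sW]
        lin_scale[OF rep_loop[OF W i]] subspace_scale)
next
  fix i j v assume ij: "adjacent \<Gamma> i j" and v: "v \<in> vspace V j"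
  note j = adj_I(2)[OF ij]
  note lf = morphD(1)[OF f j] and lg = morphD(1)[OF g j] and sW = rep_subspace[OF W j]
  show "f i (edge_map V i j v) - c *s g i (edge_map V i j v) = edge_map W i j (f j v - c *s g j v)"
    using v lin_mem[OF lf v] lin_mem[OF lg v] ij sW
    by (simp add: morphD(2)[OF f] morphD(2)[OF g] lin_diff[OF rep_edge[OF W ij] sW]
        lin_scale[OF rep_edge[OF W ij]] subspace_scale)
qed

text \<open>Schur's lemma over the complex numbers: if \<open>c\<close> is an eigenvalue of \<open>h\<^sup>-\<^sup>1 f\<close> at one vertex, then \<open>f - c h\<close>
  has a nonzero kernel.\<close>

lemma schur_scalar:
  assumes V: "simple_rep V" and W: "simple_rep W" and h: "is_iso V W h" and f: "morph V W f"
  shows "\<exists>c. \<forall>i\<in>I. \<forall>v\<in>vspace V i. f i v = c *s h i v"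
proof -
  note rV = simple_repD(1)[OF V] and rW = simple_repD(1)[OF W]
  obtain i v0 where i: "i \<in> I" and v0: "v0 \<in> vspace V i" "v0 \<noteq> 0"
    using nonzero_family_rep[OF rV simple_repD(2)[OF V]] .
  define g where "g = inv_into (vspace V i) (h i)"
  have inv: "is_iso W V (\<lambda>i. inv_into (vspace V i) (h i))" by (rule iso_inverse[OF rV rW h])
  then have lg: "lin (vspace W i) (vspace V i) g"
    using i morphD(1) unfolding is_iso_def g_def by blast
  have lf: "lin (vspace V i) (vspace W i) (f i)" by (rule morphD(1)[OF f i])
  have mh: "morph V W h" using h by (simp add: is_iso_def)
  have lh: "lin (vspace V i) (vspace W i) (h i)" by (rule morphD(1)[OF mh i])
  have bij: "bij_betw (h i) (vspace V i) (vspace W i)" using h i by (simp add: is_iso_def)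
  obtain c v where v: "v \<in> vspace V i" "v \<noteq> 0" "g (f i v) = c *s v"
    using exists_eigenvector[OF rep_fd_space[OF rV i] lin_compose[OF lf lg]] v0 by blast
  have "f i v = h i (g (f i v))"
    using bij lin_mem[OF lf v(1)] unfolding g_def by (simp add: bij_betw_def f_inv_into_f)
  then have fv: "f i v - c *s h i v = 0" using v by (simp add: lin_scale[OF lh])
  note m = morph_combination[OF rV rW f mh, of c]
  have "{v \<in> vspace V k. f k v - c *s h k v = 0} = vspace V k" if "k \<in> I" for k
    by (rule simple_repD(3)[OF V morph_kernel[OF rV rW m] nonzero_familyI[of i v] that]) (use i v fv in auto)
  then show ?thesis by (intro exI[of _ c]) auto
qed

definition loop_scalar :: "'v quiver_rep \<Rightarrow> complex \<Rightarrow> bool" where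
  "loop_scalar V z \<longleftrightarrow> (\<forall>i\<in>I. \<forall>v\<in>vspace V i. loop_map V i v = z *s v)"

text \<open>The loops commute with the arrows, so they form an endomorphism.\<close>

lemma simple_loop_scalar:
  assumes V: "simple_rep V"
  shows "\<exists>z. loop_scalar V z"
proof -
  note rV = simple_repD(1)[OF V]
  have "morph V V (\<lambda>i v. v)" by (rule morphI) (auto simp: linear_between_def)
  then have "is_iso V V (\<lambda>i v. v)" by (auto simp: is_iso_def bij_betw_def)
  moreover have "morph V V (loop_map V)"
    by (rule morphI) (auto simp: rep_commute[OF rV] intro: rep_loop[OF rV])
  ultimately show ?thesis
    using schur_scalar[OF V V] unfolding loop_scalar_def by blast
qed

text \<open>A choice, at every vertex, of a projection along \<open>T\<close>. The images of the projections form complements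
  of \<open>T\<close>, and the maps of a representation compressed to them realise the quotient by \<open>T\<close>.\<close>

definition splitting :: "'v quiver_rep \<Rightarrow> (nat \<Rightarrow> 'v set) \<Rightarrow> (nat \<Rightarrow> 'v \<Rightarrow> 'v) \<Rightarrow> bool" where
  "splitting V T p \<longleftrightarrow> (\<forall>i\<in>I. Vector_Spaces.linear scale scale (p i) \<and> (\<forall>v\<in>T i. p i v = 0) \<and>
     (\<forall>v. v - p i v \<in> T i))"

definition quotient_rep :: "'v quiver_rep \<Rightarrow> (nat \<Rightarrow> 'v \<Rightarrow> 'v) \<Rightarrow> 'v quiver_rep" where
  "quotient_rep V p = \<lparr>vspace = \<lambda>i. p i ` vspace V i, edge_map = \<lambda>i j v. p i (edge_map V i j v),
     loop_map = \<lambda>i v. p i (loop_map V i v)\<rparr>"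

lemma exists_splitting:
  assumes V: "rep V" and S: "subrep V S" and T: "subrep V T" and ST: "\<And>i. i \<in> I \<Longrightarrow> S i \<inter> T i = {0}"
  shows "\<exists>p. splitting V T p \<and> (\<forall>i\<in>I. \<forall>v\<in>S i. p i v = v)"
proof -
  have "\<forall>i\<in>I. \<exists>p. Vector_Spaces.linear scale scale p \<and> (\<forall>v\<in>T i. p v = 0) \<and> (\<forall>v\<in>S i. p v = v) \<and>
     (\<forall>v. v - p v \<in> T i)"
    using exists_projection subrepD(1)[OF S] subrepD(1)[OF T] ST by blast
  from bchoice[OF this] show ?thesis unfolding splitting_def by blast
qed

context
  fixes V T p
  assumes V: "rep V" and T: "subrep V T" and p: "splitting V T p"
begin

lemma split_add: "i \<in> I \<Longrightarrow> p i (v + w) = p i v + p i w"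
  and split_scale: "i \<in> I \<Longrightarrow> p i (c *s v) = c *s p i v"
  and split_kernel: "i \<in> I \<Longrightarrow> v \<in> T i \<Longrightarrow> p i v = 0"
  and split_rest: "i \<in> I \<Longrightarrow> v - p i v \<in> T i"
  using p unfolding splitting_def Vector_Spaces.linear_iff by blast+

lemma split_zero: "i \<in> I \<Longrightarrow> p i 0 = 0"
  using split_scale[of i 0 0] by simp

lemma split_diff: "i \<in> I \<Longrightarrow> p i (v - w) = p i v - p i w"
  using split_add[of i v "(-1) *s w"] split_scale[of i "-1" w] by simp

lemma split_idem: "i \<in> I \<Longrightarrow> p i (p i v) = p i v"
  using split_kernel[OF _ split_rest, of i v] by (simp add: split_diff)

lemma split_sum: "i \<in> I \<Longrightarrow> p i (\<Sum>k\<in>K. f k) = (\<Sum>k\<in>K. p i (f k))"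
  by (induction K rule: infinite_finite_induct) (auto simp: split_zero split_add)

lemma split_kernel_iff: "i \<in> I \<Longrightarrow> p i v = 0 \<longleftrightarrow> v \<in> T i"
  using split_kernel[of i v] split_rest[of i v] by auto

lemma split_mem: "i \<in> I \<Longrightarrow> v \<in> vspace V i \<Longrightarrow> p i v \<in> vspace V i"
  using subspace_diff[OF rep_subspace[OF V], of i v "v - p i v"] subrepD(2)[OF T _ split_rest] by auto

lemma split_edge:
  assumes "adjacent \<Gamma> i j" "v \<in> vspace V j"
  shows "p i (edge_map V i j (p j v)) = p i (edge_map V i j v)"
proof -
  note ij = adj_I[OF assms(1)]
  note pv = split_mem[OF ij(2) assms(2)]
  have "edge_map V i j (v - p j v) \<in> T i" by (rule subrepD(3)[OF T assms(1) split_rest[OF ij(2)]])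
  moreover have "edge_map V i j (v - p j v) = edge_map V i j v - edge_map V i j (p j v)"
    by (rule lin_diff[OF rep_edge[OF V assms(1)] rep_subspace[OF V ij(2)] assms(2) pv])
  ultimately show ?thesis using split_kernel[OF ij(1)] split_diff[OF ij(1)] by fastforce
qed

lemma split_loop:
  assumes "i \<in> I" "v \<in> vspace V i"
  shows "p i (loop_map V i (p i v)) = p i (loop_map V i v)"
proof -
  note pv = split_mem[OF assms]
  have "loop_map V i (v - p i v) \<in> T i" by (rule subrepD(4)[OF T assms(1) split_rest[OF assms(1)]])
  moreover have "loop_map V i (v - p i v) = loop_map V i v - loop_map V i (p i v)"
    by (rule lin_diff[OF rep_loop[OF V assms(1)] rep_subspace[OF V assms(1)] assms(2) pv])
  ultimately show ?thesis using split_kernel[OF assms(1)] split_diff[OF assms(1)] by fastforce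
qed

lemma split_subspace: "i \<in> I \<Longrightarrow> subspace (p i ` vspace V i)"
  by (rule lin_image[of "vspace V i" "vspace V i" "p i"])
     (auto simp: linear_between_def split_add split_scale split_mem rep_subspace[OF V])

lemma rep_quotient: "rep (quotient_rep V p)"
proof -
  let ?Q = "quotient_rep V p"
  have simps: "vspace ?Q i = p i ` vspace V i" "edge_map ?Q i j = (\<lambda>v. p i (edge_map V i j v))"
    "loop_map ?Q i = (\<lambda>v. p i (loop_map V i v))" for i j
    by (simp_all add: quotient_rep_def)
  have sub: "v \<in> vspace V i" if "i \<in> I" "v \<in> p i ` vspace V i" for i v
    using that split_mem by auto
  have pow: "((\<lambda>v. p i (loop_map V i v)) ^^ k) (p i v) = p i ((loop_map V i ^^ k) v)"
    if "i \<in> I" "v \<in> vspace V i" for i v k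
    by (induction k) (simp_all add: split_loop[OF that(1)] funpow_mem[OF rep_loop[OF V that(1)] that(2)])
  show ?thesis
    unfolding is_rep_def simps
  proof (intro conjI ballI impI)
    fix i assume i: "i \<in> I"
    show "fd_space (p i ` vspace V i)"
      by (rule fd_space_mono(1)[OF rep_fd_space[OF V i] split_subspace[OF i]]) (use i split_mem in auto)
    show "lin (p i ` vspace V i) (p i ` vspace V i) (\<lambda>v. p i (loop_map V i v))"
      using sub[OF i] by (auto simp: linear_between_def lin_add[OF rep_loop[OF V i]] lin_scale[OF rep_loop[OF V i]]
          split_add[OF i] split_scale[OF i] split_loop[OF i] split_mem[OF i] rep_loop_mem[OF V i])
  next
    fix i j assume ij: "adjacent \<Gamma> i j"
    note i = adj_I(1)[OF ij] and j = adj_I(2)[OF ij]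
    show "lin (p j ` vspace V j) (p i ` vspace V i) (\<lambda>v. p i (edge_map V i j v))"
      using sub[OF j] by (auto simp: linear_between_def lin_add[OF rep_edge[OF V ij]] lin_scale[OF rep_edge[OF V ij]]
          split_add[OF i] split_scale[OF i] split_edge[OF ij] split_mem[OF j] rep_edge_mem[OF V ij])
    fix v assume v: "v \<in> p j ` vspace V j"
    note v' = sub[OF j v]
    show "p i (edge_map V i j (p j (loop_map V j v))) = p i (loop_map V i (p i (edge_map V i j v)))"
      by (simp add: split_edge[OF ij rep_loop_mem[OF V j v']] split_loop[OF i rep_edge_mem[OF V ij v']]
          rep_commute[OF V ij v'])
  next
    fix j v assume j: "j \<in> I" and "v \<in> p j ` vspace V j"
    then obtain u where u: "u \<in> vspace V j" "v = p j u" by auto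
    have "(\<Sum>i\<in>I. of_int (edge_sign \<Gamma> i j) *s p j (edge_map V j i (p i (edge_map V i j v)))) =
       (\<Sum>i\<in>I. p j (of_int (edge_sign \<Gamma> i j) *s (edge_map V j i (edge_map V i j u))))"
    proof (intro sum.cong refl)
      fix i assume i: "i \<in> I"
      show "of_int (edge_sign \<Gamma> i j) *s p j (edge_map V j i (p i (edge_map V i j v))) =
        p j (of_int (edge_sign \<Gamma> i j) *s (edge_map V j i (edge_map V i j u)))"
      proof (cases "adjacent \<Gamma> i j")
        case True
        have "p i (edge_map V i j v) = p i (edge_map V i j u)" using u split_edge[OF True] by simp
        moreover have "adjacent \<Gamma> j i" using True adjacent_sym by blast
        ultimately show ?thesis
          using split_edge[of j i "edge_map V i j u"] rep_edge_mem[OF V True u(1)] by (simp add: split_scale[OF j])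
      qed (simp add: edge_sign_def split_zero[OF j])
    qed
    also have "\<dots> = p j (\<Sum>i\<in>I. of_int (edge_sign \<Gamma> i j) *s (edge_map V j i (edge_map V i j u)))"
      by (simp add: split_sum[OF j])
    moreover have "poly_map scale (P' j) (\<lambda>v. p j (loop_map V j v)) v = p j (poly_map scale (P' j) (loop_map V j) u)"
      by (simp add: poly_map_def u pow[OF j u(1)] split_sum[OF j] split_scale[OF j])
    ultimately show "(\<Sum>i\<in>I. of_int (edge_sign \<Gamma> i j) *s p j (edge_map V j i (p i (edge_map V i j v)))) +
      poly_map scale (P' j) (\<lambda>v. p j (loop_map V j v)) v = 0"
      using rep_relation[OF V j u(1)] by (simp add: split_add[OF j, symmetric] split_zero[OF j])
  qed
qed

lemma subrep_preimage:
  assumes W: "subrep (quotient_rep V p) W"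
  shows "subrep V (\<lambda>i. {v \<in> vspace V i. p i v \<in> W i})"
proof (rule subrepI)
  fix i assume i: "i \<in> I"
  show "subspace {v \<in> vspace V i. p i v \<in> W i}"
    using rep_subspace[OF V i] subrepD(1)[OF W i]
    by (auto simp: subspace_def split_add[OF i] split_scale[OF i] split_zero[OF i])
  show "loop_map V i v \<in> {v \<in> vspace V i. p i v \<in> W i}" if "v \<in> {v \<in> vspace V i. p i v \<in> W i}" for v
    using that subrepD(4)[OF W i, of "p i v"] i
    by (simp add: quotient_rep_def split_loop rep_loop_mem[OF V])
next
  fix i j v assume ij: "adjacent \<Gamma> i j" and v: "v \<in> {v \<in> vspace V j. p j v \<in> W j}"
  then show "edge_map V i j v \<in> {v \<in> vspace V i. p i v \<in> W i}"
    using subrepD(3)[OF W ij, of "p j v"]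
    by (simp add: quotient_rep_def split_edge rep_edge_mem[OF V])
qed auto

end

text \<open>Equality up to the irrelevant values of the maps outside the spaces of the representation.\<close>

definition same_rep :: "'v quiver_rep \<Rightarrow> 'v quiver_rep \<Rightarrow> bool" where
  "same_rep V W \<longleftrightarrow> (\<forall>i\<in>I. vspace V i = vspace W i \<and> (\<forall>v\<in>vspace V i. loop_map V i v = loop_map W i v)) \<and>
     (\<forall>i j. adjacent \<Gamma> i j \<longrightarrow> (\<forall>v\<in>vspace V j. edge_map V i j v = edge_map W i j v))"

lemma same_repD:
  assumes "same_rep V W"
  shows "i \<in> I \<Longrightarrow> vspace W i = vspace V i"
    "i \<in> I \<Longrightarrow> v \<in> vspace V i \<Longrightarrow> loop_map W i v = loop_map V i v"
    "adjacent \<Gamma> i j \<Longrightarrow> v \<in> vspace V j \<Longrightarrow> edge_map W i j v = edge_map V i j v"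
  using assms by (simp_all add: same_rep_def)

lemma same_rep_subrep:
  assumes VW: "same_rep V W" and U: "subrep V U"
  shows "subrep W U"
proof (rule subrepI)
  fix i j v assume ij: "adjacent \<Gamma> i j" and v: "v \<in> U j"
  then show "edge_map W i j v \<in> U i"
    using same_repD(3)[OF VW ij subrepD(2)[OF U adj_I(2)[OF ij] v]] subrepD(3)[OF U ij v] by simp
next
  fix i v assume i: "i \<in> I" and v: "v \<in> U i"
  note vV = subrepD(2)[OF U i v]
  show "loop_map W i v \<in> U i" using same_repD(2)[OF VW i vV] subrepD(4)[OF U i v] by simp
  show "v \<in> vspace W i" using same_repD(1)[OF VW i] vV by simp
qed (rule subrepD(1)[OF U])

lemma same_rep_sym: "same_rep V W \<Longrightarrow> same_rep W V"
  using adj_I by (auto simp: same_rep_def)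

lemma same_rep_simple:
  assumes VW: "same_rep V W" and V: "simple_rep V" and W: "rep W"
  shows "simple_rep W"
  unfolding simple_rep_def
proof (intro conjI allI impI ballI)
  have eq: "vspace V i = vspace W i" if "i \<in> I" for i using VW that by (simp add: same_rep_def)
  show "nonzero_family \<Gamma> (vspace W)" using simple_repD(2)[OF V] eq by (auto simp: nonzero_family_def)
  fix U i assume "subrep W U" "nonzero_family \<Gamma> U" "i \<in> I"
  then show "U i = vspace W i"
    using simple_repD(3)[OF V same_rep_subrep[OF same_rep_sym[OF VW]]] eq by blast
qed (rule W)

end

section \<open>Dimension vectors of simple representations\<close>

context ade_quiver
begin

text \<open>A fixed choice of bases, which are at the same time the row and column index sets of the
  matrices of a representation.\<close>

definition basis_of :: "'v quiver_rep \<Rightarrow> nat \<Rightarrow> 'v set" where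
  "basis_of V i = (SOME B. finite B \<and> independent B \<and> span B = vspace V i)"

lemma basis_of:
  assumes "rep V" "i \<in> I"
  shows "finite (basis_of V i)" "independent (basis_of V i)" "span (basis_of V i) = vspace V i"
proof -
  have "\<exists>B. finite B \<and> independent B \<and> span B = vspace V i"
    using fd_space_basis[OF rep_fd_space[OF assms]] by metis
  from someI_ex[OF this] show "finite (basis_of V i)" "independent (basis_of V i)" "span (basis_of V i) = vspace V i"
    unfolding basis_of_def by blast+
qed

lemma basis_of_mem: "rep V \<Longrightarrow> i \<in> I \<Longrightarrow> b \<in> basis_of V i \<Longrightarrow> b \<in> vspace V i"
  using basis_of(3) span_base by blast

lemma card_basis_of: "rep V \<Longrightarrow> i \<in> I \<Longrightarrow> card (basis_of V i) = dim (vspace V i)"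
  using basis_of dim_span_eq_card_independent by metis

abbreviation coord :: "'v quiver_rep \<Rightarrow> nat \<Rightarrow> 'v \<Rightarrow> 'v \<Rightarrow> complex" where
  "coord V i \<equiv> representation (basis_of V i)"

definition edge_matrix :: "'v quiver_rep \<Rightarrow> nat \<Rightarrow> nat \<Rightarrow> 'v \<Rightarrow> 'v \<Rightarrow> complex" where
  "edge_matrix V i j c b = coord V i (edge_map V i j b) c"

lemma coord_apply:
  assumes V: "rep V" "i \<in> I" and W: "rep W" "j \<in> I" and f: "lin (vspace V i) (vspace W j) f"
    and v: "v \<in> vspace V i"
  shows "coord W j (f v) c = (\<Sum>b\<in>basis_of V i. coord W j (f b) c * coord V i v b)"
  using lin_representation[of "basis_of V i" "basis_of W j" f v c] basis_of[OF V] basis_of[OF W] f v by simp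

lemma coord_eqI:
  assumes "rep V" "i \<in> I" "v \<in> vspace V i" "w \<in> vspace V i"
    "\<And>b. b \<in> basis_of V i \<Longrightarrow> coord V i v b = coord V i w b"
  shows "v = w"
  using representation_eq_imp_eq[of "basis_of V i" v w] basis_of[OF assms(1,2)] assms by simp

lemma coord_self: "rep V \<Longrightarrow> i \<in> I \<Longrightarrow> b \<in> basis_of V i \<Longrightarrow> coord V i b c = (if c = b then 1 else 0)"
  using representation_basis[OF basis_of(2)] by simp

lemma coord_scale: "rep V \<Longrightarrow> i \<in> I \<Longrightarrow> v \<in> vspace V i \<Longrightarrow> coord V i (c *s v) b = c * coord V i v b"
  using representation_scale[OF basis_of(2)] basis_of(3) by simp

lemma coord_add: "rep V \<Longrightarrow> i \<in> I \<Longrightarrow> v \<in> vspace V i \<Longrightarrow> w \<in> vspace V i \<Longrightarrow>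
    coord V i (v + w) b = coord V i v b + coord V i w b"
  using representation_add[OF basis_of(2)] basis_of(3) by simp

lemma coord_sum: "rep V \<Longrightarrow> i \<in> I \<Longrightarrow> (\<And>k. k \<in> K \<Longrightarrow> f k \<in> vspace V i) \<Longrightarrow>
    coord V i (\<Sum>k\<in>K. f k) b = (\<Sum>k\<in>K. coord V i (f k) b)"
  using representation_sum[OF basis_of(2), of V i K f] basis_of(3) by simp

lemma poly_map_scalar:
  assumes "rep V" "loop_scalar V z" "i \<in> I" "v \<in> vspace V i"
  shows "poly_map scale p (loop_map V i) v = poly p z *s v"
  using poly_map_jordan[OF rep_loop[OF assms(1,3)] assms(4) subspace_0[OF rep_subspace[OF assms(1,3)]], of z p]
    assms lin_zero[OF rep_loop[OF assms(1,3)] rep_subspace[OF assms(1,3)]] rep_subspace[OF assms(1,3)]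
  by (simp add: loop_scalar_def)

lemma matrix_rep_of_rep:
  assumes V: "rep V" and z: "loop_scalar V z"
  shows "matrix_rep \<Gamma> (\<lambda>j. poly (P' j) z) (basis_of V) (edge_matrix V)"
  unfolding matrix_rep_def
proof (intro conjI ballI)
  fix j b b' assume j: "j \<in> I" and b: "b \<in> basis_of V j" and b': "b' \<in> basis_of V j"
  note bV = basis_of_mem[OF V j b]
  let ?s = "\<lambda>i. complex_of_int (edge_sign \<Gamma> i j)"
  have mem: "?s i *s edge_map V j i (edge_map V i j b) \<in> vspace V j" if "i \<in> I" for i
  proof (cases "adjacent \<Gamma> i j")
    case True
    then have "adjacent \<Gamma> j i" using adjacent_sym by blast
    then show ?thesis using True rep_edge_mem[OF V] bV subspace_scale[OF rep_subspace[OF V j]] by blast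
  qed (simp add: edge_sign_def subspace_0 rep_subspace V j)
  have rel: "(\<Sum>i\<in>I. ?s i *s edge_map V j i (edge_map V i j b)) = (- poly (P' j) z) *s b"
    using rep_relation[OF V j bV] poly_map_scalar[OF V z j bV] by (simp add: add_eq_0_iff)
  have "(- poly (P' j) z) * coord V j b b' = coord V j (\<Sum>i\<in>I. ?s i *s edge_map V j i (edge_map V i j b)) b'"
    by (simp only: rel coord_scale[OF V j bV])
  also have "\<dots> = (\<Sum>i\<in>I. coord V j (?s i *s edge_map V j i (edge_map V i j b)) b')"
    by (rule coord_sum[OF V j mem])
  also have "\<dots> = (\<Sum>i\<in>I. ?s i * mtimes (basis_of V i) (edge_matrix V j i) (edge_matrix V i j) b' b)"
  proof (intro sum.cong refl)
    fix i assume i: "i \<in> I"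
    show "coord V j (?s i *s edge_map V j i (edge_map V i j b)) b' = ?s i * mtimes (basis_of V i) (edge_matrix V j i) (edge_matrix V i j) b' b"
    proof (cases "adjacent \<Gamma> i j")
      case True
      then have ji: "adjacent \<Gamma> j i" using adjacent_sym by blast
      note m = rep_edge_mem[OF V True bV]
      show ?thesis
        using coord_apply[OF V i V j rep_edge[OF V ji] m, of b'] coord_scale[OF V j rep_edge_mem[OF V ji m]]
        by (simp add: mtimes_def edge_matrix_def)
    qed (simp add: edge_sign_def representation_zero)
  qed
  finally show "(\<Sum>i\<in>I. ?s i * mtimes (basis_of V i) (edge_matrix V j i) (edge_matrix V i j) b' b) =
      - poly (P' j) z * (if b' = b then 1 else 0)"
    using coord_self[OF V j b] by simp
qed (rule basis_of(1)[OF V])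

definition dimvec :: "'v quiver_rep \<Rightarrow> nat \<Rightarrow> int" where
  "dimvec V i = (if i \<in> I then int (dim (vspace V i)) else 0)"

lemma poly_combination:
  "poly (combination \<Gamma> Q a) x = (\<Sum>i\<in>I. of_int (a i) * poly (Q i) x)"
  by (simp add: combination_def poly_sum)

lemma pderiv_combination: "pderiv (combination \<Gamma> Q a) = combination \<Gamma> (\<lambda>i. pderiv (Q i)) a"
proof -
  have of_int_monom: "(of_int k :: complex poly) = [:of_int k:]" for k by (rule of_int_poly)
  show ?thesis
    by (simp add: combination_def of_int_monom higher_pderiv_sum[of 1, simplified] pderiv_smult)
qed

text \<open>The vertex relation at \<open>j\<close> contributes the trace \<open>d\<^sub>j P'\<^sub>j(z)\<close>, and these traces cancel.\<close>

lemma dimvec_root: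
  assumes V: "rep V" and z: "loop_scalar V z"
  shows "poly (combination \<Gamma> P' (dimvec V)) z = 0"
proof -
  have "(\<Sum>j\<in>I. of_int (dimvec V j) * poly (P' j) z) = (\<Sum>j\<in>I. of_nat (card (basis_of V j)) * poly (P' j) z)"
    by (intro sum.cong refl) (simp add: dimvec_def card_basis_of[OF V])
  then show ?thesis
    unfolding poly_combination using matrix_rep_trace[OF ADE matrix_rep_of_rep[OF V z]] by simp
qed

lemma dimvec_nonzero:
  assumes "simple_rep V" shows "\<exists>i\<in>I. dimvec V i \<noteq> 0"
proof -
  note V = simple_repD(1)[OF assms]
  obtain i v where iv: "i \<in> I" "v \<in> vspace V i" "v \<noteq> 0"
    using nonzero_family_rep[OF V simple_repD(2)[OF assms]] .
  then have "basis_of V i \<noteq> {}" using basis_of(3)[OF V iv(1)] by auto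
  then have "card (basis_of V i) \<noteq> 0" using basis_of(1)[OF V iv(1)] by simp
  then show ?thesis using iv card_basis_of[OF V iv(1)] by (auto simp: dimvec_def)
qed

lemma matrix_hom_realize:
  assumes V: "rep V" and W: "rep W" and z: "loop_scalar V z" "loop_scalar W z"
    and x: "matrix_hom \<Gamma> (basis_of V) (edge_matrix V) (basis_of W) (edge_matrix W) x"
  shows "\<exists>f. morph V W f \<and> (\<forall>i\<in>I. \<forall>b\<in>basis_of V i. \<forall>c\<in>basis_of W i. coord W i (f i b) c = x i c b)"
proof -
  have "\<forall>i\<in>I. \<exists>f. lin (vspace V i) (vspace W i) f \<and> (\<forall>b\<in>basis_of V i. \<forall>c\<in>basis_of W i. coord W i (f b) c = x i c b)"
  proof
    fix i assume i: "i \<in> I"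
    show "\<exists>f. lin (vspace V i) (vspace W i) f \<and> (\<forall>b\<in>basis_of V i. \<forall>c\<in>basis_of W i. coord W i (f b) c = x i c b)"
      using lin_of_matrix[of "basis_of V i" "basis_of W i" "x i"] basis_of[OF V i] basis_of[OF W i] by simp
  qed
  from bchoice[OF this] obtain f where f: "\<And>i. i \<in> I \<Longrightarrow> lin (vspace V i) (vspace W i) (f i)"
      "\<And>i b c. i \<in> I \<Longrightarrow> b \<in> basis_of V i \<Longrightarrow> c \<in> basis_of W i \<Longrightarrow> coord W i (f i b) c = x i c b" by blast
  have "morph V W f"
  proof (rule morphI)
    fix i j v assume ij: "adjacent \<Gamma> i j" and v: "v \<in> vspace V j"
    note i = adj_I(1)[OF ij] and j = adj_I(2)[OF ij]
    show "f i (edge_map V i j v) = edge_map W i j (f j v)"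
    proof (rule lin_eq_on_basis[where B = "basis_of V j" and f = "\<lambda>v. f i (edge_map V i j v)"
          and g = "\<lambda>v. edge_map W i j (f j v)" and W = "vspace W i"])
      show "lin (span (basis_of V j)) (vspace W i) (\<lambda>v. f i (edge_map V i j v))"
        "lin (span (basis_of V j)) (vspace W i) (\<lambda>v. edge_map W i j (f j v))"
        unfolding basis_of(3)[OF V j]
        by (rule lin_compose[OF rep_edge[OF V ij] f(1)[OF i]], rule lin_compose[OF f(1)[OF j] rep_edge[OF W ij]])
      fix b assume b: "b \<in> basis_of V j"
      note bV = basis_of_mem[OF V j b]
      note m1 = rep_edge_mem[OF V ij bV] and m2 = lin_mem[OF f(1)[OF j] bV]
      show "f i (edge_map V i j b) = edge_map W i j (f j b)"
      proof (rule coord_eqI[OF W i lin_mem[OF f(1)[OF i] m1] rep_edge_mem[OF W ij m2]])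
        fix c assume c: "c \<in> basis_of W i"
        have "coord W i (f i (edge_map V i j b)) c = mtimes (basis_of V i) (x i) (edge_matrix V i j) c b"
          unfolding coord_apply[OF V i W i f(1)[OF i] m1] mtimes_def edge_matrix_def
          using f(2)[OF i _ c] by simp
        also have "\<dots> = mtimes (basis_of W j) (edge_matrix W i j) (x j) c b"
          using x i j ij b c unfolding matrix_hom_def nbrs_def by blast
        also have "\<dots> = coord W i (edge_map W i j (f j b)) c"
          unfolding coord_apply[OF W j W i rep_edge[OF W ij] m2] mtimes_def edge_matrix_def
          using f(2)[OF j b] by simp
        finally show "coord W i (f i (edge_map V i j b)) c = coord W i (edge_map W i j (f j b)) c" .
      qed
    qed (use basis_of[OF V j] v in simp_all)
  next
    fix i v assume "i \<in> I" "v \<in> vspace V i"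
    then show "f i (loop_map V i v) = loop_map W i (f i v)"
      using z lin_mem[OF f(1)] lin_scale[OF f(1)] by (simp add: loop_scalar_def)
  qed (rule f(1))
  then show ?thesis using f(2) by blast
qed

lemma matrix_hom_of_morph:
  assumes V: "rep V" and W: "rep W" and f: "morph V W f"
  shows "matrix_hom \<Gamma> (basis_of V) (edge_matrix V) (basis_of W) (edge_matrix W) (\<lambda>i c b. coord W i (f i b) c)"
  unfolding matrix_hom_def
proof (intro ballI)
  fix i j c b assume i: "i \<in> I" and j: "j \<in> nbrs \<Gamma> i" and b: "b \<in> basis_of V j"
  then have ij: "adjacent \<Gamma> i j" and j: "j \<in> I" by (auto simp: nbrs_def)
  note bV = basis_of_mem[OF V j b]
  have "mtimes (basis_of V i) (\<lambda>c b. coord W i (f i b) c) (edge_matrix V i j) c b = coord W i (f i (edge_map V i j b)) c"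
    unfolding coord_apply[OF V i W i morphD(1)[OF f i] rep_edge_mem[OF V ij bV]] mtimes_def edge_matrix_def ..
  also have "\<dots> = coord W i (edge_map W i j (f j b)) c" by (simp add: morphD(2)[OF f ij bV])
  also have "\<dots> = mtimes (basis_of W j) (edge_matrix W i j) (\<lambda>c b. coord W j (f j b) c) c b"
    unfolding coord_apply[OF W j W i rep_edge[OF W ij] lin_mem[OF morphD(1)[OF f j] bV]] mtimes_def edge_matrix_def ..
  finally show "mtimes (basis_of V i) (\<lambda>c b. coord W i (f i b) c) (edge_matrix V i j) c b =
    mtimes (basis_of W j) (edge_matrix W i j) (\<lambda>c b. coord W j (f j b) c) c b" .
qed

text \<open>By Schur's lemma every homomorphism is a multiple of the isomorphism \<open>h\<close>, so it vanishes as soon as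
  one entry does at which the matrix of \<open>h\<close> is nonzero. In the dimension count this lemma stands for
  \<open>dim Hom(V,W) \<le> 1\<close>.\<close>

lemma hom_detected_by_entry:
  assumes V: "simple_rep V" and W: "simple_rep W" and z: "loop_scalar V z" "loop_scalar W z"
    and h: "is_iso V W h"
  shows "\<exists>i\<in>I. \<exists>c\<in>basis_of W i. \<exists>b\<in>basis_of V i.
     \<forall>x. matrix_hom \<Gamma> (basis_of V) (edge_matrix V) (basis_of W) (edge_matrix W) x \<longrightarrow> x i c b = 0 \<longrightarrow>
       (\<forall>k\<in>I. \<forall>c\<in>basis_of W k. \<forall>b\<in>basis_of V k. x k c b = 0)"
proof -
  note rV = simple_repD(1)[OF V] and rW = simple_repD(1)[OF W]
  have mh: "morph V W h" using h by (simp add: is_iso_def)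
  obtain i v where i: "i \<in> I" "v \<in> vspace V i" "v \<noteq> 0"
    using nonzero_family_rep[OF rV simple_repD(2)[OF V]] .
  then have "basis_of V i \<noteq> {}" using basis_of(3)[OF rV i(1)] by auto
  then obtain b where b: "b \<in> basis_of V i" by blast
  note bV = basis_of_mem[OF rV i(1) b]
  have b0: "b \<noteq> 0" using b basis_of(2)[OF rV i(1)] dependent_zero by blast
  have lh: "lin (vspace V i) (vspace W i) (h i)" by (rule morphD(1)[OF mh i(1)])
  have hb: "h i b \<in> vspace W i" by (rule lin_mem[OF lh bV])
  have "h i b \<noteq> h i 0"
    using h i(1) bV b0 subspace_0[OF rep_subspace[OF rV i(1)]]
    unfolding is_iso_def bij_betw_def inj_on_def by blast
  then have "h i b \<noteq> 0" using lin_zero[OF lh rep_subspace[OF rV i(1)]] by simp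
  then obtain c where c: "c \<in> basis_of W i" "coord W i (h i b) c \<noteq> 0"
    using coord_eqI[OF rW i(1) hb subspace_0[OF rep_subspace[OF rW i(1)]]] by (auto simp: representation_zero)
  have "x k c' b' = 0" if x: "matrix_hom \<Gamma> (basis_of V) (edge_matrix V) (basis_of W) (edge_matrix W) x" "x i c b = 0"
      and k: "k \<in> I" "c' \<in> basis_of W k" "b' \<in> basis_of V k" for x k c' b'
  proof -
    obtain f where f: "morph V W f" "\<And>i b c. i \<in> I \<Longrightarrow> b \<in> basis_of V i \<Longrightarrow> c \<in> basis_of W i \<Longrightarrow> coord W i (f i b) c = x i c b"
      using matrix_hom_realize[OF rV rW z x(1)] by blast
    obtain d where d: "\<And>i v. i \<in> I \<Longrightarrow> v \<in> vspace V i \<Longrightarrow> f i v = d *s h i v"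
      using schur_scalar[OF V W h f(1)] by blast
    have "0 = d * coord W i (h i b) c"
      using x(2) f(2)[OF i(1) b c(1)] d[OF i(1) bV] coord_scale[OF rW i(1) hb] by simp
    then have "d = 0" using c(2) by simp
    then show ?thesis using f(2)[OF k(1,3,2)] d[OF k(1) basis_of_mem[OF rV k(1,3)]] by (simp add: representation_zero)
  qed
  then show ?thesis using i(1) b c(1) by blast
qed

text \<open>Both Hom spaces in the dimension count are one-dimensional, so \<open>(d, d) \<le> 2\<close>; the form is positive
  definite and even.\<close>

lemma simple_dimvec_root:
  assumes V: "simple_rep V"
  shows "dimvec V \<in> positive_roots \<Gamma>"
proof -
  note rV = simple_repD(1)[OF V]
  obtain z where z: "loop_scalar V z" using simple_loop_scalar[OF V] by blast
  have "is_iso V V (\<lambda>i v. v)"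
    by (auto simp: is_iso_def bij_betw_def linear_between_def intro!: morphI)
  from hom_detected_by_entry[OF V V z z this] obtain i c b where
    e: "i \<in> I" "c \<in> basis_of V i" "b \<in> basis_of V i" and
    det: "\<And>x k c' b'. matrix_hom \<Gamma> (basis_of V) (edge_matrix V) (basis_of V) (edge_matrix V) x \<Longrightarrow> x i c b = 0 \<Longrightarrow>
       k \<in> I \<Longrightarrow> c' \<in> basis_of V k \<Longrightarrow> b' \<in> basis_of V k \<Longrightarrow> x k c' b' = 0" by blast
  interpret hom_complex \<Gamma> "\<lambda>j. poly (P' j) z" "basis_of V" "edge_matrix V" "basis_of V" "edge_matrix V"
    using ADE matrix_rep_of_rep[OF rV z] by unfold_locales
  have "2 * (\<Sum>i\<in>I. card (basis_of V i) * card (basis_of V i)) \<le>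
     (\<Sum>i\<in>I. \<Sum>j\<in>nbrs \<Gamma> i. card (basis_of V i) * card (basis_of V j)) + card {(i, c, b)} + card {(i, c, b)}"
  proof (rule hom_bound)
    show "{(i, c, b)} \<subseteq> hom_index" "{(i, c, b)} \<subseteq> cohom_index"
      using e by (auto simp: hom_index_def cohom_index_def)
  qed (use det in \<open>auto simp: hom_index_def cohom_index_def\<close>)
  then have "int (2 * (\<Sum>i\<in>I. card (basis_of V i) * card (basis_of V i))) \<le>
     int ((\<Sum>i\<in>I. \<Sum>j\<in>nbrs \<Gamma> i. card (basis_of V i) * card (basis_of V j)) + 2)"
    by (simp only: of_nat_le_iff) simp
  moreover have "dimvec V i = int (card (basis_of V i))" if "i \<in> I" for i
    using that by (simp add: dimvec_def card_basis_of[OF rV])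
  moreover have "nbrs \<Gamma> i \<subseteq> I" for i by (auto simp: nbrs_def)
  ultimately have "cartan_form \<Gamma> (dimvec V) (dimvec V) \<le> 2"
    by (simp add: cartan_form_expand subset_iff)
  moreover have "cartan_form \<Gamma> (dimvec V) (dimvec V) > 0"
    using dimvec_nonzero[OF V] cartan_form_pos[OF ADE] by blast
  moreover have "even (cartan_form \<Gamma> (dimvec V) (dimvec V))" by (rule cartan_form_even[OF ADE])
  ultimately have "cartan_form \<Gamma> (dimvec V) (dimvec V) = 2" by presburger
  then show ?thesis by (auto simp: positive_roots_def dimvec_def[of V])
qed

end

locale generic_ade_quiver = ade_quiver scale \<Gamma> P'
  for scale :: "complex \<Rightarrow> 'v::ab_group_add \<Rightarrow> 'v" (infixr "*s" 75) and \<Gamma> P' +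
  assumes no_multiple_root: "\<forall>p\<in>B_set \<Gamma> P'. \<not> has_multiple_root p"
    and star: "condition_star \<Gamma> P'"
begin

text \<open>Both dimension vectors give combinations that vanish at \<open>z\<close>, so condition \<open>(*)\<close> makes them
  proportional. The factor squares to \<open>1\<close> because both have norm \<open>2\<close>, and it is not \<open>-1\<close> because their
  entries are nonnegative.\<close>

lemma simple_dimvec_eq:
  assumes V: "simple_rep V" and W: "simple_rep W" and z: "loop_scalar V z" "loop_scalar W z"
  shows "dimvec V = dimvec W"
proof -
  note rV = simple_repD(1)[OF V] and rW = simple_repD(1)[OF W]
  obtain c :: complex where c: "\<And>i. i \<in> I \<Longrightarrow> of_int (dimvec W i) = c * of_int (dimvec V i)"
    using star dimvec_nonzero[OF V] dimvec_nonzero[OF W] dimvec_root[OF rV z(1)] dimvec_root[OF rW z(2)]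
    unfolding condition_star_def by blast
  have form: "cartan_form \<Gamma> (dimvec V) (dimvec V) = 2" "cartan_form \<Gamma> (dimvec W) (dimvec W) = 2"
    using simple_dimvec_root[OF V] simple_dimvec_root[OF W] by (auto simp: positive_roots_def)
  have sub: "nbrs \<Gamma> i \<subseteq> I" for i by (auto simp: nbrs_def)
  have "of_int (cartan_form \<Gamma> (dimvec W) (dimvec W)) = c\<^sup>2 * of_int (cartan_form \<Gamma> (dimvec V) (dimvec V))"
  proof -
    have "of_int (\<Sum>j\<in>nbrs \<Gamma> i. dimvec W j) = c * of_int (\<Sum>j\<in>nbrs \<Gamma> i. dimvec V j)" for i
      unfolding of_int_sum sum_distrib_left using c sub by (intro sum.cong refl) blast
    then have "of_int (dimvec W i * (2 * dimvec W i - (\<Sum>j\<in>nbrs \<Gamma> i. dimvec W j))) =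
       c\<^sup>2 * of_int (dimvec V i * (2 * dimvec V i - (\<Sum>j\<in>nbrs \<Gamma> i. dimvec V j)))" if "i \<in> I" for i
      using c[OF that] by (simp only: of_int_mult of_int_diff of_int_numeral) (simp add: power2_eq_square algebra_simps)
    then show ?thesis
      unfolding cartan_form_def of_int_sum sum_distrib_left by (intro sum.cong refl)
  qed
  then have "c\<^sup>2 = 1" using form by simp
  then have c': "c = 1 \<or> c = -1" by (simp add: power2_eq_1_iff)
  have "c \<noteq> -1"
  proof
    assume "c = -1"
    obtain i where i: "i \<in> I" "dimvec V i \<noteq> 0" using dimvec_nonzero[OF V] by blast
    have "complex_of_int (dimvec W i) = of_int (- dimvec V i)" using c[OF i(1)] \<open>c = -1\<close> by simp
    then have "dimvec W i = - dimvec V i" by (simp only: of_int_eq_iff)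
    then show False using i by (auto simp: dimvec_def)
  qed
  then have "c = 1" using c' by simp
  show ?thesis
  proof
    fix i
    show "dimvec V i = dimvec W i"
    proof (cases "i \<in> I")
      case True
      then show ?thesis using c[OF True] \<open>c = 1\<close> by simp
    qed (simp add: dimvec_def)
  qed
qed

text \<open>Without nonzero homomorphisms in either direction the dimension count would give \<open>(d, d) \<le> 0\<close>.\<close>

lemma simple_iso:
  assumes V: "simple_rep V" and W: "simple_rep W" and z: "loop_scalar V z" "loop_scalar W z"
  shows "\<exists>f. is_iso V W f"
proof (rule ccontr)
  assume no: "\<not> ?thesis"
  note rV = simple_repD(1)[OF V] and rW = simple_repD(1)[OF W]
  have VW: "f i v = 0" if "morph V W f" "i \<in> I" "v \<in> vspace V i" for f i v
    using schur_iso[OF V W that] no by blast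
  have WV: "f i v = 0" if "morph W V f" "i \<in> I" "v \<in> vspace W i" for f i v
    using schur_iso[OF W V that] no iso_inverse[OF rW rV] by blast
  interpret hom_complex \<Gamma> "\<lambda>j. poly (P' j) z" "basis_of V" "edge_matrix V" "basis_of W" "edge_matrix W"
    using ADE matrix_rep_of_rep[OF rV z(1)] matrix_rep_of_rep[OF rW z(2)] by unfold_locales
  have "2 * (\<Sum>i\<in>I. card (basis_of W i) * card (basis_of V i)) \<le>
     (\<Sum>i\<in>I. \<Sum>j\<in>nbrs \<Gamma> i. card (basis_of W i) * card (basis_of V j)) + card ({} :: (nat \<times> 'v \<times> 'v) set) + card ({} :: (nat \<times> 'v \<times> 'v) set)"
  proof (rule hom_bound)
    fix x i c b assume x: "hom x" and i: "(i, c, b) \<in> hom_index"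
    obtain f where f: "morph V W f" "\<And>i b c. i \<in> I \<Longrightarrow> b \<in> basis_of V i \<Longrightarrow> c \<in> basis_of W i \<Longrightarrow> coord W i (f i b) c = x i c b"
      using matrix_hom_realize[OF rV rW z x] by blast
    show "x i c b = 0"
      using i VW[OF f(1)] f(2)[of i b c] basis_of_mem[OF rV, of i b] by (auto simp: hom_index_def representation_zero)
  next
    fix x i b c assume x: "cohom x" and i: "(i, b, c) \<in> cohom_index"
    obtain f where f: "morph W V f" "\<And>i b c. i \<in> I \<Longrightarrow> b \<in> basis_of W i \<Longrightarrow> c \<in> basis_of V i \<Longrightarrow> coord V i (f i b) c = x i c b"
      using matrix_hom_realize[OF rW rV z(2,1) x] by blast
    show "x i b c = 0"
      using i WV[OF f(1)] f(2)[of i c b] basis_of_mem[OF rW, of i c] by (auto simp: cohom_index_def representation_zero)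
  qed auto
  then have "int (2 * (\<Sum>i\<in>I. card (basis_of W i) * card (basis_of V i))) \<le>
     int (\<Sum>i\<in>I. \<Sum>j\<in>nbrs \<Gamma> i. card (basis_of W i) * card (basis_of V j))"
    by (simp only: of_nat_le_iff) simp
  moreover have "dimvec V i = int (card (basis_of V i))" if "i \<in> I" for i
    using that by (simp add: dimvec_def card_basis_of[OF rV])
  moreover have "dimvec V i = int (card (basis_of W i))" if "i \<in> I" for i
    using that simple_dimvec_eq[OF V W z] by (simp add: dimvec_def card_basis_of[OF rW])
  moreover have "nbrs \<Gamma> i \<subseteq> I" for i by (auto simp: nbrs_def)
  ultimately have "cartan_form \<Gamma> (dimvec V) (dimvec V) \<le> 0"
    by (simp add: cartan_form_expand subset_iff)
  then show False using simple_dimvec_root[OF V] by (simp add: positive_roots_def)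
qed

text \<open>The polynomial \<open>\<Sum>\<^sub>j d\<^sub>j P'\<^sub>j\<close> belongs to \<open>B_set \<Gamma> P'\<close> and vanishes at \<open>z\<close>; a vanishing derivative would make
  \<open>z\<close> a multiple root.\<close>

lemma derivative_nonzero:
  assumes V: "simple_rep V" and z: "loop_scalar V z"
  shows "(\<Sum>j\<in>I. of_int (dimvec V j) * poly (pderiv (P' j)) z) \<noteq> 0"
proof
  let ?p = "combination \<Gamma> P' (dimvec V)"
  assume "(\<Sum>j\<in>I. of_int (dimvec V j) * poly (pderiv (P' j)) z) = 0"
  then have d: "poly (pderiv ?p) z = 0" by (simp add: pderiv_combination poly_combination)
  have "poly ?p z = 0" by (rule dimvec_root[OF simple_repD(1)[OF V] z])
  then obtain r where r: "?p = [:-z, 1:] * r" by (metis dvdE poly_eq_0_iff_dvd)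
  have "poly r z = 0" using d unfolding r pderiv_mult by (simp add: pderiv_pCons del: mult_pCons_left)
  then obtain q where "r = [:-z, 1:] * q" by (metis dvdE poly_eq_0_iff_dvd)
  then have "[:-z, 1:] ^ 2 dvd ?p" unfolding r power2_eq_square by (metis dvd_triv_left mult.assoc)
  then have "has_multiple_root ?p" unfolding has_multiple_root_def by blast
  then show False
    using no_multiple_root positive_root_combination[OF ADE simple_dimvec_root[OF V]] by blast
qed

end

section \<open>Extensions of a simple representation by itself\<close>

context generic_ade_quiver
begin

text \<open>An extension \<open>E\<close> of a simple representation \<open>D = E / S\<close> by a simple \<open>R = S\<close> with the same loop scalar.
  The quotient lives on the complement of \<open>S\<close> chosen by the projections \<open>p\<close>.\<close>

context
  fixes E S p z
  assumes E: "rep E" and S: "subrep E S" and p: "splitting E S p"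
    and simS: "simple_rep (restrict_rep E S)" and simD: "simple_rep (quotient_rep E p)"
    and zS: "loop_scalar (restrict_rep E S) z" and zD: "loop_scalar (quotient_rep E p) z"
begin

abbreviation "D \<equiv> quotient_rep E p"
abbreviation "R \<equiv> restrict_rep E S"

lemma D_simps: "vspace D i = p i ` vspace E i" "edge_map D i j v = p i (edge_map E i j v)"
    "loop_map D i v = p i (loop_map E i v)"
  by (simp_all add: quotient_rep_def)

lemmas rD = simple_repD(1)[OF simD]
lemmas rR = simple_repD(1)[OF simS]
lemmas kernel = split_kernel[OF E S p] and rest = split_rest[OF E S p]
lemmas idem = split_idem[OF E S p]

lemma D_in_E: "i \<in> I \<Longrightarrow> v \<in> vspace D i \<Longrightarrow> v \<in> vspace E i"
  using split_mem[OF E S p] by (auto simp: D_simps)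

lemma D_fixed: "i \<in> I \<Longrightarrow> v \<in> vspace D i \<Longrightarrow> p i v = v"
  using idem by (auto simp: D_simps)

lemma loop_S: "i \<in> I \<Longrightarrow> v \<in> S i \<Longrightarrow> loop_map E i v = z *s v"
  using zS by (simp add: loop_scalar_def)

lemma loop_D: "i \<in> I \<Longrightarrow> v \<in> vspace D i \<Longrightarrow> p i (loop_map E i v) = z *s v"
  using zD unfolding loop_scalar_def D_simps(3) by blast

text \<open>The nilpotent part of the loops; it kills \<open>S\<close> and maps \<open>E\<close> into \<open>S\<close>, hence it induces a homomorphism
  \<open>D \<rightarrow> R\<close>.\<close>

definition loop_nil :: "nat \<Rightarrow> 'v \<Rightarrow> 'v" where "loop_nil i v = loop_map E i v - z *s v"

lemma morph_loop_nil_E: "morph E E loop_nil"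
proof -
  have "morph E E (loop_map E)" by (rule morphI) (auto simp: rep_commute[OF E] intro: rep_loop[OF E])
  moreover have "morph E E (\<lambda>i v. v)" by (rule morphI) (auto simp: linear_between_def)
  ultimately show ?thesis unfolding loop_nil_def[abs_def] by (rule morph_combination[OF E E])
qed

lemma loop_nil_S: "i \<in> I \<Longrightarrow> v \<in> S i \<Longrightarrow> loop_nil i v = 0"
  by (simp add: loop_nil_def loop_S)

lemma loop_nil_mem: "i \<in> I \<Longrightarrow> v \<in> vspace D i \<Longrightarrow> loop_nil i v \<in> S i"
  using rest[of i "loop_map E i v"] by (simp add: loop_nil_def loop_D)

lemma loop_nil_p: "i \<in> I \<Longrightarrow> v \<in> vspace E i \<Longrightarrow> loop_nil i (p i v) = loop_nil i v"
  using lin_diff[OF morphD(1)[OF morph_loop_nil_E] rep_subspace[OF E], of i v "p i v"]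
    loop_nil_S[OF _ rest, of i v] split_mem[OF E S p] by simp

lemma morph_loop_nil: "morph D R loop_nil"
proof (rule morphI)
  fix i assume i: "i \<in> I"
  show "lin (vspace D i) (vspace R i) (loop_nil i)"
    using morphD(1)[OF morph_loop_nil_E i] loop_nil_mem[OF i] D_in_E[OF i] by (simp add: linear_between_def)
  show "loop_nil i (loop_map D i v) = loop_map R i (loop_nil i v)" if v: "v \<in> vspace D i" for v
    using loop_D[OF i v] loop_S[OF i loop_nil_mem[OF i v]] lin_scale[OF morphD(1)[OF morph_loop_nil_E i] D_in_E[OF i v]]
    by (simp add: D_simps)
next
  fix i j v assume ij: "adjacent \<Gamma> i j" and v: "v \<in> vspace D j"
  note v' = D_in_E[OF adj_I(2)[OF ij] v]
  show "loop_nil i (edge_map D i j v) = edge_map R i j (loop_nil j v)"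
    using loop_nil_p[OF adj_I(1)[OF ij] rep_edge_mem[OF E ij v']] morphD(2)[OF morph_loop_nil_E ij v']
    by (simp add: D_simps)
qed

text \<open>The off-diagonal block of the arrows of \<open>E = S \<oplus> D\<close>.\<close>

definition cocycle :: "nat \<Rightarrow> nat \<Rightarrow> 'v \<Rightarrow> 'v" where
  "cocycle i j v = edge_map E i j v - p i (edge_map E i j v)"

lemma cocycle_lin:
  assumes ij: "adjacent \<Gamma> i j" shows "lin (vspace D j) (vspace R i) (cocycle i j)"
  unfolding linear_between_def cocycle_def
  using rest[OF adj_I(1)[OF ij]] D_in_E[OF adj_I(2)[OF ij]]
  by (auto simp: lin_add[OF rep_edge[OF E ij]] lin_scale[OF rep_edge[OF E ij]]
      split_add[OF E S p adj_I(1)[OF ij]] split_scale[OF E S p adj_I(1)[OF ij]] scale_right_diff_distrib)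

text \<open>The off-diagonal block of the vertex relation at \<open>j\<close>. The polynomial contributes only its
  first-order term, because \<open>loop_nil\<close> maps \<open>E\<close> into \<open>S\<close> and kills \<open>S\<close>.\<close>

lemma cocycle_relation:
  assumes j: "j \<in> I" and v: "v \<in> vspace D j"
  shows "(\<Sum>i\<in>I. of_int (edge_sign \<Gamma> i j) *s
      (edge_map E j i (cocycle i j v) + cocycle j i (edge_map D i j v))) = - (poly (pderiv (P' j)) z *s loop_nil j v)"
proof -
  note vE = D_in_E[OF j v]
  have "of_int (edge_sign \<Gamma> i j) *s (edge_map E j i (cocycle i j v) + cocycle j i (edge_map D i j v)) =
     of_int (edge_sign \<Gamma> i j) *s edge_map E j i (edge_map E i j v)
     - of_int (edge_sign \<Gamma> i j) *s edge_map D j i (edge_map D i j v)" if i: "i \<in> I" for i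
  proof (cases "adjacent \<Gamma> i j")
    case True
    then have ji: "adjacent \<Gamma> j i" using adjacent_sym by blast
    note m = rep_edge_mem[OF E True vE]
    show ?thesis
      by (simp add: cocycle_def D_simps lin_diff[OF rep_edge[OF E ji] rep_subspace[OF E i] m split_mem[OF E S p i m]]
          scale_right_diff_distrib scale_right_distrib)
  qed (simp add: edge_sign_def)
  then have "(\<Sum>i\<in>I. of_int (edge_sign \<Gamma> i j) *s
      (edge_map E j i (cocycle i j v) + cocycle j i (edge_map D i j v))) =
     (\<Sum>i\<in>I. of_int (edge_sign \<Gamma> i j) *s edge_map E j i (edge_map E i j v))
     - (\<Sum>i\<in>I. of_int (edge_sign \<Gamma> i j) *s edge_map D j i (edge_map D i j v))"
    by (simp add: sum_subtractf)
  moreover have "poly_map scale (P' j) (loop_map E j) v = poly (P' j) z *s v + poly (pderiv (P' j)) z *s loop_nil j v"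
  proof (rule poly_map_jordan[OF rep_loop[OF E j] vE _ _ _ rep_subspace[OF E j]])
    show "loop_nil j v \<in> vspace E j" by (rule lin_mem[OF morphD(1)[OF morph_loop_nil_E j] vE])
  qed (simp_all add: loop_nil_def loop_S[OF j loop_nil_mem[OF j v], unfolded loop_nil_def])
  moreover have "poly_map scale (P' j) (loop_map D j) v = poly (P' j) z *s v"
    by (rule poly_map_scalar[OF rD zD j v])
  moreover have "(\<Sum>i\<in>I. of_int (edge_sign \<Gamma> i j) *s edge_map E j i (edge_map E i j v)) =
      - poly_map scale (P' j) (loop_map E j) v"
    using rep_relation[OF E j vE] by (simp only: eq_neg_iff_add_eq_0)
  moreover have "(\<Sum>i\<in>I. of_int (edge_sign \<Gamma> i j) *s edge_map D j i (edge_map D i j v)) =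
      - poly_map scale (P' j) (loop_map D j) v"
    using rep_relation[OF rD j v] by (simp only: eq_neg_iff_add_eq_0)
  ultimately show ?thesis by simp
qed

text \<open>The isomorphism \<open>h\<close> turns the nilpotent part into a scalar \<open>c\<close>, and pairing the cocycle relation with
  \<open>h\<^sup>-\<^sup>1\<close> gives \<open>c \<Sum>\<^sub>j d\<^sub>j P''\<^sub>j(z) = 0\<close>. With \<open>c = 0\<close> the arrow block is a cocycle, hence the coboundary of some
  \<open>f\<close>, and the graph \<open>{v + f v | v \<in> D}\<close> is a subrepresentation complementary to \<open>S\<close>.\<close>

lemma self_extension_splits:
  "\<exists>U. subrep E U \<and> nonzero_family \<Gamma> U \<and> (\<forall>i\<in>I. U i \<inter> S i = {0})"
proof -
  obtain h where h: "is_iso D R h" using simple_iso[OF simD simS zD zS] by blast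
  define k where "k i = inv_into (vspace D i) (h i)" for i
  have k: "is_iso R D k" using iso_inverse[OF rD rR h] by (simp add: k_def[abs_def])
  have mh: "morph D R h" and mk: "morph R D k" using h k by (auto simp: is_iso_def)
  have kh: "k i (h i v) = v" if "i \<in> I" "v \<in> vspace D i" for i v
    using that h unfolding k_def is_iso_def bij_betw_def by (simp add: inv_into_f_f)
  obtain c where c: "\<And>i v. i \<in> I \<Longrightarrow> v \<in> vspace D i \<Longrightarrow> loop_nil i v = c *s h i v"
    using schur_scalar[OF simD simS h morph_loop_nil] by blast
  interpret hom_complex \<Gamma> "\<lambda>j. poly (P' j) z" "basis_of D" "edge_matrix D" "basis_of R" "edge_matrix R"
    using ADE matrix_rep_of_rep[OF rD zD] matrix_rep_of_rep[OF rR zS] by unfold_locales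
  define y where "y i j a b = coord R i (cocycle i j b) a" for i j a b
  have y: "diff1 y j a b = - poly (pderiv (P' j)) z * (c * coord R j (h j b) a)"
    if j: "j \<in> I" and b: "b \<in> basis_of D j" for j a b
  proof -
    note bD = basis_of_mem[OF rD j b]
    have hb: "h j b \<in> vspace R j" by (rule lin_mem[OF morphD(1)[OF mh j] bD])
    note sub = rep_subspace[OF rR j]
    have "- poly (pderiv (P' j)) z * (c * coord R j (h j b) a) =
      coord R j ((- poly (pderiv (P' j)) z) *s (c *s h j b)) a"
      by (simp only: coord_scale[OF rR j subspace_scale[OF sub hb]] coord_scale[OF rR j hb])
    also have "(- poly (pderiv (P' j)) z) *s (c *s h j b) = - (poly (pderiv (P' j)) z *s loop_nil j b)"
      by (simp add: c[OF j bD])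
    also have "\<dots> = (\<Sum>i\<in>I. of_int (edge_sign \<Gamma> i j) *s
      (edge_map E j i (cocycle i j b) + cocycle j i (edge_map D i j b)))"
      by (rule cocycle_relation[OF j bD, symmetric])
    also have "coord R j \<dots> a = (\<Sum>i\<in>I. coord R j (of_int (edge_sign \<Gamma> i j) *s
      (edge_map E j i (cocycle i j b) + cocycle j i (edge_map D i j b))) a)"
    proof (rule coord_sum[OF rR j])
      fix i assume i: "i \<in> I"
      show "of_int (edge_sign \<Gamma> i j) *s (edge_map E j i (cocycle i j b) + cocycle j i (edge_map D i j b)) \<in> vspace R j"
      proof (cases "adjacent \<Gamma> i j")
        case True
        then have ji: "adjacent \<Gamma> j i" using adjacent_sym by blast
        show ?thesis
          using rep_edge_mem[OF rR ji lin_mem[OF cocycle_lin[OF True] bD]]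
            lin_mem[OF cocycle_lin[OF ji] rep_edge_mem[OF rD True bD]] sub
          by (intro subspace_scale subspace_add) auto
      qed (use subspace_0[OF sub] in \<open>simp add: edge_sign_def\<close>)
    qed
    also have "\<dots> = diff1 y j a b"
      unfolding diff1_def
    proof (intro sum.cong refl)
      fix i assume i: "i \<in> I"
      show "coord R j (of_int (edge_sign \<Gamma> i j) *s
          (edge_map E j i (cocycle i j b) + cocycle j i (edge_map D i j b))) a =
        s i j * (mtimes (basis_of R i) (edge_matrix R j i) (y i j) a b + mtimes (basis_of D i) (y j i) (edge_matrix D i j) a b)"
      proof (cases "adjacent \<Gamma> i j")
        case True
        then have ji: "adjacent \<Gamma> j i" using adjacent_sym by blast
        note m1 = lin_mem[OF cocycle_lin[OF True] bD] and m2 = rep_edge_mem[OF rD True bD]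
        have e1: "edge_map E j i (cocycle i j b) \<in> vspace R j" using rep_edge_mem[OF rR ji m1] by simp
        have e2: "cocycle j i (edge_map D i j b) \<in> vspace R j" by (rule lin_mem[OF cocycle_lin[OF ji] m2])
        have "coord R j (edge_map E j i (cocycle i j b)) a = mtimes (basis_of R i) (edge_matrix R j i) (y i j) a b"
          using coord_apply[OF rR i rR j rep_edge[OF rR ji] m1, of a] by (simp add: mtimes_def edge_matrix_def y_def)
        moreover have "coord R j (cocycle j i (edge_map D i j b)) a = mtimes (basis_of D i) (y j i) (edge_matrix D i j) a b"
          using coord_apply[OF rD i rR j cocycle_lin[OF ji] m2, of a] by (simp add: mtimes_def edge_matrix_def y_def)
        ultimately show ?thesis
          by (simp only: coord_scale[OF rR j subspace_add[OF sub e1 e2]] coord_add[OF rR j e1 e2])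
      qed (simp add: edge_sign_def representation_zero)
    qed
    finally show ?thesis ..
  qed
  \<comment> \<open>the trace of the cocycle relation against the inverse isomorphism\<close>
  have "c = 0"
  proof -
    have "0 = (\<Sum>j\<in>I. mpair (basis_of D j) (basis_of R j) (\<lambda>b a. coord D j (k j a) b) (diff1 y j))"
      by (rule cohom_pair_diff1[OF matrix_hom_of_morph[OF rR rD mk], symmetric])
    also have "\<dots> = (\<Sum>j\<in>I. - c * (of_int (dimvec D j) * poly (pderiv (P' j)) z))"
    proof (intro sum.cong refl)
      fix j assume j: "j \<in> I"
      have "mpair (basis_of D j) (basis_of R j) (\<lambda>b a. coord D j (k j a) b) (diff1 y j) =
        mpair (basis_of D j) (basis_of R j) (\<lambda>b a. coord D j (k j a) b) (\<lambda>a b. (- poly (pderiv (P' j)) z * c) * coord R j (h j b) a)"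
        by (rule mpair_cong) (simp_all add: y[OF j])
      also have "\<dots> = (- poly (pderiv (P' j)) z * c) *
        mpair (basis_of D j) (basis_of R j) (\<lambda>b a. coord D j (k j a) b) (\<lambda>a b. coord R j (h j b) a)"
        by (rule mpair_scale_right)
      also have "mpair (basis_of D j) (basis_of R j) (\<lambda>b a. coord D j (k j a) b) (\<lambda>a b. coord R j (h j b) a) =
        (\<Sum>b\<in>basis_of D j. 1)"
        unfolding mpair_def
      proof (intro sum.cong refl)
        fix b assume b: "b \<in> basis_of D j"
        note bD = basis_of_mem[OF rD j b]
        have "(\<Sum>a\<in>basis_of R j. coord D j (k j a) b * coord R j (h j b) a) = coord D j (k j (h j b)) b"
          by (rule coord_apply[OF rR j rD j morphD(1)[OF mk j] lin_mem[OF morphD(1)[OF mh j] bD], symmetric])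
        also have "\<dots> = 1" using kh[OF j bD] coord_self[OF rD j b] by simp
        finally show "(\<Sum>a\<in>basis_of R j. coord D j (k j a) b * coord R j (h j b) a) = 1" .
      qed
      finally show "mpair (basis_of D j) (basis_of R j) (\<lambda>b a. coord D j (k j a) b) (diff1 y j) =
         - c * (of_int (dimvec D j) * poly (pderiv (P' j)) z)"
        using j card_basis_of[OF rD j] by (simp add: dimvec_def)
    qed
    also have "\<dots> = - c * (\<Sum>j\<in>I. of_int (dimvec D j) * poly (pderiv (P' j)) z)"
      by (simp add: sum_distrib_left)
    finally show "c = 0" using derivative_nonzero[OF simD zD] by simp
  qed
  obtain i1 a1 b1 where e1: "i1 \<in> I" "a1 \<in> basis_of R i1" "b1 \<in> basis_of D i1" and
    det1: "\<And>x k c' b'. matrix_hom \<Gamma> (basis_of D) (edge_matrix D) (basis_of R) (edge_matrix R) x \<Longrightarrow> x i1 a1 b1 = 0 \<Longrightarrow>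
       k \<in> I \<Longrightarrow> c' \<in> basis_of R k \<Longrightarrow> b' \<in> basis_of D k \<Longrightarrow> x k c' b' = 0"
    using hom_detected_by_entry[OF simD simS zD zS h] by blast
  obtain i2 a2 b2 where e2: "i2 \<in> I" "a2 \<in> basis_of D i2" "b2 \<in> basis_of R i2" and
    det2: "\<And>x k c' b'. matrix_hom \<Gamma> (basis_of R) (edge_matrix R) (basis_of D) (edge_matrix D) x \<Longrightarrow> x i2 a2 b2 = 0 \<Longrightarrow>
       k \<in> I \<Longrightarrow> c' \<in> basis_of D k \<Longrightarrow> b' \<in> basis_of R k \<Longrightarrow> x k c' b' = 0"
    using hom_detected_by_entry[OF simS simD zS zD k] by blast
  have "\<exists>x. \<forall>i\<in>I. \<forall>j\<in>nbrs \<Gamma> i. \<forall>a\<in>basis_of R i. \<forall>b\<in>basis_of D j. diff0 x i j a b = y i j a b"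
  proof (rule hom_exact[where F = "{(i1, a1, b1)}" and G = "{(i2, a2, b2)}"])
    show "{(i1, a1, b1)} \<subseteq> hom_index" "{(i2, a2, b2)} \<subseteq> cohom_index"
      using e1 e2 by (auto simp: hom_index_def cohom_index_def)
    have eqD: "int (card (basis_of D i)) = dimvec D i" if "i \<in> I" for i
      using that by (simp add: dimvec_def card_basis_of[OF rD])
    have eqR: "int (card (basis_of R i)) = dimvec D i" if "i \<in> I" for i
      using that simple_dimvec_eq[OF simD simS zD zS] by (simp add: dimvec_def card_basis_of[OF rR])
    have sub: "nbrs \<Gamma> i \<subseteq> I" for i by (auto simp: nbrs_def)
    have "int (2 * (\<Sum>i\<in>I. card (basis_of R i) * card (basis_of D i))) =
      int ((\<Sum>i\<in>I. \<Sum>j\<in>nbrs \<Gamma> i. card (basis_of R i) * card (basis_of D j)) + 2)"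
    proof -
      have "(\<Sum>j\<in>nbrs \<Gamma> i. dimvec D i * int (card (basis_of D j))) = (\<Sum>j\<in>nbrs \<Gamma> i. dimvec D i * dimvec D j)" for i
        by (intro sum.cong refl) (metis eqD sub subsetD)
      then show ?thesis
        using simple_dimvec_root[OF simD] by (simp add: positive_roots_def cartan_form_expand eqD eqR)
    qed
    then show "2 * (\<Sum>i\<in>I. card (basis_of R i) * card (basis_of D i)) \<ge>
      (\<Sum>i\<in>I. \<Sum>j\<in>nbrs \<Gamma> i. card (basis_of R i) * card (basis_of D j)) + card {(i1, a1, b1)} + card {(i2, a2, b2)}"
      by (simp only: of_nat_eq_iff) simp
    show "diff1 y j a b = 0" if "j \<in> I" "a \<in> basis_of R j" "b \<in> basis_of D j" for j a b
      using y[OF that(1,3)] \<open>c = 0\<close> by simp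
  qed (use det1 det2 in \<open>auto simp: hom_index_def cohom_index_def\<close>)
  then obtain x where x: "\<And>i j a b. adjacent \<Gamma> i j \<Longrightarrow> a \<in> basis_of R i \<Longrightarrow> b \<in> basis_of D j \<Longrightarrow> diff0 x i j a b = y i j a b"
    unfolding nbrs_def using adj_I by blast
  have "\<forall>i\<in>I. \<exists>f. lin (vspace D i) (vspace R i) f \<and> (\<forall>b\<in>basis_of D i. \<forall>a\<in>basis_of R i. coord R i (f b) a = x i a b)"
  proof
    fix i assume i: "i \<in> I"
    show "\<exists>f. lin (vspace D i) (vspace R i) f \<and> (\<forall>b\<in>basis_of D i. \<forall>a\<in>basis_of R i. coord R i (f b) a = x i a b)"
      using lin_of_matrix[of "basis_of D i" "basis_of R i" "x i"] basis_of[OF rD i] basis_of[OF rR i] by simp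
  qed
  from bchoice[OF this] obtain f where f: "\<And>i. i \<in> I \<Longrightarrow> lin (vspace D i) (vspace R i) (f i)"
      "\<And>i b a. i \<in> I \<Longrightarrow> b \<in> basis_of D i \<Longrightarrow> a \<in> basis_of R i \<Longrightarrow> coord R i (f i b) a = x i a b" by blast
  have coboundary: "f i (edge_map D i j v) = cocycle i j v + edge_map R i j (f j v)"
    if ij: "adjacent \<Gamma> i j" and v: "v \<in> vspace D j" for i j v
  proof -
    note i = adj_I(1)[OF ij] and j = adj_I(2)[OF ij]
    note sub = rep_subspace[OF rR i]
    show ?thesis
    proof (rule lin_eq_on_basis[where B = "basis_of D j" and f = "\<lambda>v. f i (edge_map D i j v)"
          and g = "\<lambda>v. cocycle i j v + edge_map R i j (f j v)" and W = "vspace R i"])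
      show "lin (span (basis_of D j)) (vspace R i) (\<lambda>v. f i (edge_map D i j v))"
        unfolding basis_of(3)[OF rD j] by (rule lin_compose[OF rep_edge[OF rD ij] f(1)[OF i]])
      have "lin (vspace D j) (vspace R i) (\<lambda>v. edge_map R i j (f j v))"
        by (rule lin_compose[OF f(1)[OF j] rep_edge[OF rR ij]])
      with cocycle_lin[OF ij] show "lin (span (basis_of D j)) (vspace R i) (\<lambda>v. cocycle i j v + edge_map R i j (f j v))"
        unfolding basis_of(3)[OF rD j] linear_between_def
        using subspace_add[OF sub] by (simp add: scale_right_distrib algebra_simps)
      fix b assume b: "b \<in> basis_of D j"
      note bD = basis_of_mem[OF rD j b]
      note m1 = rep_edge_mem[OF rD ij bD] and m2 = lin_mem[OF f(1)[OF j] bD]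
      note m3 = lin_mem[OF cocycle_lin[OF ij] bD] and m4 = rep_edge_mem[OF rR ij m2]
      show "f i (edge_map D i j b) = cocycle i j b + edge_map R i j (f j b)"
      proof (rule coord_eqI[OF rR i lin_mem[OF f(1)[OF i] m1] subspace_add[OF sub m3 m4]])
        fix a assume a: "a \<in> basis_of R i"
        have "coord R i (f i (edge_map D i j b)) a = mtimes (basis_of D i) (x i) (edge_matrix D i j) a b"
          unfolding coord_apply[OF rD i rR i f(1)[OF i] m1] mtimes_def edge_matrix_def
          using f(2)[OF i _ a] by simp
        moreover have "coord R i (edge_map R i j (f j b)) a = mtimes (basis_of R j) (edge_matrix R i j) (x j) a b"
          unfolding coord_apply[OF rR j rR i rep_edge[OF rR ij] m2] mtimes_def edge_matrix_def
          using f(2)[OF j b] by simp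
        moreover have "coord R i (cocycle i j b) a = diff0 x i j a b"
          using x[OF ij a b] by (simp add: y_def)
        ultimately show "coord R i (f i (edge_map D i j b)) a = coord R i (cocycle i j b + edge_map R i j (f j b)) a"
          by (simp only: coord_add[OF rR i m3 m4]) (simp add: diff0_def)
      qed
    qed (use basis_of[OF rD j] v in simp_all)
  qed
  define U where "U i = (\<lambda>v. v + f i v) ` vspace D i" for i
  have fS: "f i v \<in> S i" if "i \<in> I" "v \<in> vspace D i" for i v
    using lin_mem[OF f(1)[OF that(1)] that(2)] by simp
  have "subrep E U"
  proof (rule subrepI)
    fix i assume i: "i \<in> I"
    have "lin (vspace D i) (vspace E i) (\<lambda>v. v + f i v)"
      using f(1)[OF i] D_in_E[OF i] subrepD(2)[OF S i] subspace_add[OF rep_subspace[OF E i]]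
      unfolding linear_between_def by (simp add: scale_right_distrib algebra_simps)
    then show "subspace (U i)" unfolding U_def by (rule lin_image[OF _ rep_subspace[OF rD i]])
    show "v \<in> vspace E i" if "v \<in> U i" for v
      using that D_in_E[OF i] subrepD(2)[OF S i fS[OF i]] subspace_add[OF rep_subspace[OF E i]]
      unfolding U_def by blast
    show "loop_map E i v \<in> U i" if "v \<in> U i" for v
    proof -
      obtain u where u: "u \<in> vspace D i" "v = u + f i u" using \<open>v \<in> U i\<close> by (auto simp: U_def)
      have "loop_nil i u = 0" using c[OF i u(1)] \<open>c = 0\<close> by simp
      then have "loop_map E i u = z *s u" by (simp add: loop_nil_def)
      then have "loop_map E i v = z *s u + f i (z *s u)"
        using lin_add[OF rep_loop[OF E i] D_in_E[OF i u(1)] subrepD(2)[OF S i fS[OF i u(1)]]]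
          loop_S[OF i fS[OF i u(1)]] lin_scale[OF f(1)[OF i] u(1)] by (simp add: u(2))
      then show ?thesis unfolding U_def using subspace_scale[OF rep_subspace[OF rD i] u(1)] by blast
    qed
  next
    fix i j v assume ij: "adjacent \<Gamma> i j" and v: "v \<in> U j"
    note i = adj_I(1)[OF ij] and j = adj_I(2)[OF ij]
    obtain u where u: "u \<in> vspace D j" "v = u + f j u" using v by (auto simp: U_def)
    have "edge_map E i j v = edge_map E i j u + edge_map E i j (f j u)"
      using lin_add[OF rep_edge[OF E ij] D_in_E[OF j u(1)] subrepD(2)[OF S j fS[OF j u(1)]]] by (simp add: u(2))
    also have "\<dots> = edge_map D i j u + f i (edge_map D i j u)"
      using coboundary[OF ij u(1)] by (simp add: cocycle_def D_simps)
    finally show "edge_map E i j v \<in> U i" unfolding U_def using rep_edge_mem[OF rD ij u(1)] by blast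
  qed
  moreover have UD: "u = 0" if "i \<in> I" "u \<in> vspace D i" "u + f i u \<in> S i" for i u
  proof -
    have "u \<in> S i" using subspace_diff[OF subrepD(1)[OF S that(1)] that(3) fS[OF that(1,2)]] by simp
    then show "u = 0" using kernel[OF that(1)] D_fixed[OF that(1,2)] by simp
  qed
  moreover have "nonzero_family \<Gamma> U"
  proof -
    obtain i v where iv: "i \<in> I" "v \<in> vspace D i" "v \<noteq> 0"
      using nonzero_family_rep[OF rD simple_repD(2)[OF simD]] .
    then have "v + f i v \<noteq> 0" using UD[OF iv(1,2)] subspace_0[OF subrepD(1)[OF S iv(1)]] by auto
    then show ?thesis using iv by (intro nonzero_familyI[of i "v + f i v"]) (auto simp: U_def)
  qed
  moreover have "U i \<inter> S i = {0}" if i: "i \<in> I" for i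
  proof
    have f0: "f i 0 = 0" by (rule lin_zero[OF f(1)[OF i] rep_subspace[OF rD i]])
    show "U i \<inter> S i \<subseteq> {0}"
    proof
      fix u assume "u \<in> U i \<inter> S i"
      then obtain v where v: "v \<in> vspace D i" "u = v + f i v" "u \<in> S i" by (auto simp: U_def)
      then have "v = 0" using UD[OF i] by blast
      then show "u \<in> {0}" using v(2) f0 by simp
    qed
    show "{0} \<subseteq> U i \<inter> S i"
      using subspace_0[OF subrepD(1)[OF \<open>subrep E U\<close> i]] subspace_0[OF subrepD(1)[OF S i]] by simp
  qed
  ultimately show ?thesis by blast
qed

end

end

section \<open>Indecomposable representations are simple\<close>

context generic_ade_quiver
begin

text \<open>For different scalars \<open>w\<close> on the quotient and \<open>z\<close> on \<open>S\<close>, the loops act as \<open>w\<close> on the image of \<open>\<Phi> - z\<close>, so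
  this image meets \<open>S\<close> trivially.\<close>

lemma extension_splits:
  assumes E: "rep E" and S: "subrep E S" and p: "splitting E S p"
    and simS: "simple_rep (restrict_rep E S)" and simD: "simple_rep (quotient_rep E p)"
  shows "\<exists>U. subrep E U \<and> nonzero_family \<Gamma> U \<and> (\<forall>i\<in>I. U i \<inter> S i = {0})"
proof -
  obtain z where zS: "loop_scalar (restrict_rep E S) z" using simple_loop_scalar[OF simS] by blast
  obtain w where zD: "loop_scalar (quotient_rep E p) w" using simple_loop_scalar[OF simD] by blast
  show ?thesis
  proof (cases "w = z")
    case True
    then show ?thesis using self_extension_splits[OF E S p simS simD zS] zD by simp
  next
    case False
    define m where "m i v = loop_map E i v - z *s v" for i v
    have "morph E E (loop_map E)" by (rule morphI) (auto simp: rep_commute[OF E] intro: rep_loop[OF E])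
    moreover have "morph E E (\<lambda>i v. v)" by (rule morphI) (auto simp: linear_between_def)
    ultimately have m: "morph E E m" unfolding m_def[abs_def] by (rule morph_combination[OF E E])
    define U where "U i = m i ` vspace E i" for i
    have U: "subrep E U" unfolding U_def[abs_def] by (rule morph_image[OF E E m])
    have loopS: "loop_map E i s = z *s s" if "i \<in> I" "s \<in> S i" for i s
      using zS that by (simp add: loop_scalar_def)
    have loopU: "loop_map E i u = w *s u" if i: "i \<in> I" and u: "u \<in> U i" for i u
    proof -
      obtain v where v: "v \<in> vspace E i" "u = m i v" using u by (auto simp: U_def)
      define d where "d = p i v"
      define n where "n = loop_map E i d - w *s d"
      note lE = rep_loop[OF E i] and sE = rep_subspace[OF E i]
      have dE: "d \<in> vspace E i" unfolding d_def by (rule split_mem[OF E S p i v(1)])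
      have "p i (loop_map E i d) = w *s d"
        using zD i v(1) unfolding loop_scalar_def quotient_rep_def d_def by simp
      then have nS: "n \<in> S i" using split_rest[OF E S p i, of "loop_map E i d"] by (simp add: n_def)
      have "m i (v - d) = 0"
        using loopS[OF i split_rest[OF E S p i]] by (simp add: m_def d_def)
      then have "m i v = m i d" using lin_diff[OF morphD(1)[OF m i] sE v(1) dE] by simp
      then have ud: "u = (w - z) *s d + n" by (simp add: v(2) m_def n_def scale_left_diff_distrib)
      have nE: "n \<in> vspace E i" by (rule subrepD(2)[OF S i nS])
      have "loop_map E i u = (w - z) *s loop_map E i d + z *s n"
        unfolding ud using lin_add[OF lE subspace_scale[OF sE dE] nE] lin_scale[OF lE dE] loopS[OF i nS] by simp
      also have "loop_map E i d = w *s d + n" by (simp add: n_def)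
      also have "(w - z) *s (w *s d + n) + z *s n = w *s u"
        by (simp add: ud scale_right_distrib scale_left_diff_distrib scale_right_diff_distrib right_diff_distrib mult.commute)
      finally show ?thesis .
    qed
    have "U i \<inter> S i = {0}" if i: "i \<in> I" for i
    proof -
      have "u = 0" if "u \<in> U i" "u \<in> S i" for u
      proof -
        have "w *s u = z *s u" using loopU[OF i that(1)] loopS[OF i that(2)] by (simp del: scale_cancel_right)
        then show "u = 0" using False scale_right_imp_eq[of u w z] by auto
      qed
      then show ?thesis using subspace_0[OF subrepD(1)[OF U i]] subspace_0[OF subrepD(1)[OF S i]] by auto
    qed
    moreover have "nonzero_family \<Gamma> U"
    proof -
      obtain i d where d: "i \<in> I" "d \<in> vspace (quotient_rep E p) i" "d \<noteq> 0"
        using nonzero_family_rep[OF simple_repD(1,2)[OF simD]] .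
      then obtain v where v: "v \<in> vspace E i" "d = p i v" by (auto simp: quotient_rep_def)
      have dE: "d \<in> vspace E i" unfolding v(2) by (rule split_mem[OF E S p d(1) v(1)])
      have pl: "p i (loop_map E i d) = w *s d" using zD d(1,2) by (simp add: loop_scalar_def quotient_rep_def v)
      have "p i (m i d) = w *s d - z *s d"
        using pl by (simp add: m_def split_diff[OF E S p d(1)] split_scale[OF E S p d(1)] v(2) split_idem[OF E S p d(1)])
      also have "\<dots> \<noteq> 0" using False d(3) by (simp flip: scale_left_diff_distrib)
      finally have "m i d \<noteq> 0" using split_zero[OF E S p d(1)] by auto
      then show ?thesis using d(1) dE by (intro nonzero_familyI[of i "m i d"]) (auto simp: U_def)
    qed
    ultimately show ?thesis using U by blast
  qed
qed

text \<open>A simple subrepresentation of \<open>V / S\<close> has as preimage an extension of simple representations, which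
  splits.\<close>

lemma exists_transversal_subrep:
  assumes V: "rep V" and S: "subrep V S" and simS: "simple_rep (restrict_rep V S)"
    and proper: "k \<in> I" "S k \<noteq> vspace V k"
  shows "\<exists>U. subrep V U \<and> nonzero_family \<Gamma> U \<and> (\<forall>i\<in>I. U i \<inter> S i = {0})"
proof -
  obtain p where p: "splitting V S p"
    using exists_splitting[OF V subrep_zero[OF V] S] subspace_0[OF subrepD(1)[OF S]] by auto
  let ?Q = "quotient_rep V p"
  have Q: "rep ?Q" by (rule rep_quotient[OF V S p])
  have "nonzero_family \<Gamma> (vspace ?Q)"
  proof -
    obtain v where v: "v \<in> vspace V k" "v \<notin> S k" using proper subrepD(2)[OF S] by blast
    then have "p k v \<noteq> 0" using split_kernel_iff[OF V S p proper(1)] by blast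
    then show ?thesis using v proper by (intro nonzero_familyI[of k "p k v"]) (auto simp: quotient_rep_def)
  qed
  then obtain R where R: "subrep ?Q R" and simR: "simple_rep (restrict_rep ?Q R)"
    using exists_simple_subrep[OF Q] by blast
  define E where "E i = {v \<in> vspace V i. p i v \<in> R i}" for i
  have E: "subrep V E" unfolding E_def[abs_def] by (rule subrep_preimage[OF V S p R])
  note rE = rep_restrict[OF V E]
  have SE: "S i \<subseteq> E i" if "i \<in> I" for i
    using that subrepD(2)[OF S] split_kernel[OF V S p] subspace_0[OF subrepD(1)[OF R]] by (auto simp: E_def)
  have SE': "subrep (restrict_rep V E) S" using S SE subrep_restrict[OF E] by blast
  have pE: "splitting (restrict_rep V E) S p" using p by (simp add: splitting_def)
  have img: "p i ` E i = R i" if i: "i \<in> I" for i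
  proof
    show "p i ` E i \<subseteq> R i" by (auto simp: E_def)
    show "R i \<subseteq> p i ` E i"
    proof
      fix r assume r: "r \<in> R i"
      then obtain v where "v \<in> vspace V i" "r = p i v" using subrepD(2)[OF R i r] by (auto simp: quotient_rep_def)
      then show "r \<in> p i ` E i" using r by (auto simp: E_def)
    qed
  qed
  have "same_rep (restrict_rep ?Q R) (quotient_rep (restrict_rep V E) p)"
    using img by (simp add: same_rep_def quotient_rep_def)
  then have simD: "simple_rep (quotient_rep (restrict_rep V E) p)"
    by (rule same_rep_simple[OF _ simR rep_quotient[OF rE SE' pE]])
  obtain U where U: "subrep (restrict_rep V E) U" "nonzero_family \<Gamma> U" "\<forall>i\<in>I. U i \<inter> S i = {0}"
    using extension_splits[OF rE SE' pE _ simD] simS by auto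
  then show ?thesis using subrep_restrict[OF E] by blast
qed

text \<open>Dividing out a subrepresentation \<open>U\<close> that meets \<open>S\<close> trivially keeps \<open>S\<close> as a simple subrepresentation and
  lowers the dimension; the preimage of a complement of \<open>S\<close> in \<open>V / U\<close> is a complement in \<open>V\<close>.\<close>

lemma simple_subrep_complement:
  assumes "rep V" "subrep V S" "simple_rep (restrict_rep V S)"
  shows "\<exists>U. subrep V U \<and> is_direct_sum \<Gamma> V S U"
  using assms
proof (induction "total_dim (vspace V)" arbitrary: V rule: less_induct)
  case less
  note V = less.prems(1) and S = less.prems(2) and simS = less.prems(3)
  show ?case
  proof (cases "\<forall>k\<in>I. S k = vspace V k")
    case True
    have "is_direct_sum \<Gamma> V S (\<lambda>_. {0})"
      using True subspace_0[OF rep_subspace[OF V]] by (auto simp: is_direct_sum_def)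
    then show ?thesis using subrep_zero[OF V] by blast
  next
    case False
    then obtain U where U: "subrep V U" "nonzero_family \<Gamma> U" and US: "\<And>i. i \<in> I \<Longrightarrow> S i \<inter> U i = {0}"
      using exists_transversal_subrep[OF V S simS] by (metis Int_commute)
    obtain p where p: "splitting V U p" and pS: "\<And>i v. i \<in> I \<Longrightarrow> v \<in> S i \<Longrightarrow> p i v = v"
      using exists_splitting[OF V S U(1) US] by blast
    let ?Q = "quotient_rep V p"
    have Q: "rep ?Q" by (rule rep_quotient[OF V U(1) p])
    have SQ: "S i \<subseteq> vspace ?Q i" if "i \<in> I" for i
      using pS[OF that] subrepD(2)[OF S that] by (force simp: quotient_rep_def)
    have edgeS: "edge_map ?Q i j v = edge_map V i j v" if "adjacent \<Gamma> i j" "v \<in> S j" for i j v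
      using pS[OF adj_I(1)[OF that(1)] subrepD(3)[OF S that]] by (simp add: quotient_rep_def)
    have loopS: "loop_map ?Q i v = loop_map V i v" if "i \<in> I" "v \<in> S i" for i v
      using pS[OF that(1) subrepD(4)[OF S that]] by (simp add: quotient_rep_def)
    have SQ': "subrep ?Q S"
    proof (rule subrepI)
      show "edge_map ?Q i j v \<in> S i" if "adjacent \<Gamma> i j" "v \<in> S j" for i j v
        using edgeS[OF that] subrepD(3)[OF S that] by simp
      show "loop_map ?Q i v \<in> S i" if "i \<in> I" "v \<in> S i" for i v
        using loopS[OF that] subrepD(4)[OF S that] by simp
    qed (use SQ subrepD(1)[OF S] in auto)
    have "same_rep (restrict_rep V S) (restrict_rep ?Q S)"
      using edgeS loopS by (simp add: same_rep_def)
    then have simQ: "simple_rep (restrict_rep ?Q S)"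
      by (rule same_rep_simple[OF _ simS rep_restrict[OF Q SQ']])
    have "total_dim (vspace ?Q) < total_dim (vspace V)"
    proof -
      obtain k u where u: "k \<in> I" "u \<in> U k" "u \<noteq> 0"
        using U(2) subspace_0[OF subrepD(1)[OF U(1)]] unfolding nonzero_family_def by blast
      have "u \<notin> vspace ?Q k"
        using split_kernel[OF V U(1) p u(1,2)] u(3) split_idem[OF V U(1) p u(1)] by (auto simp: quotient_rep_def)
      moreover have "u \<in> vspace V k" by (rule subrepD(2)[OF U(1) u(1,2)])
      ultimately show ?thesis
        using u(1) rep_fd_space[OF V] rep_subspace[OF Q] split_mem[OF V U(1) p]
        by (intro total_dim_less[of _ _ k]) (auto simp: quotient_rep_def)
    qed
    then obtain W where W: "subrep ?Q W" "is_direct_sum \<Gamma> ?Q S W"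
      using less.hyps[OF _ Q SQ' simQ] by blast
    define X where "X i = {v \<in> vspace V i. p i v \<in> W i}" for i
    have X: "subrep V X" unfolding X_def[abs_def] by (rule subrep_preimage[OF V U(1) p W(1)])
    have "is_direct_sum \<Gamma> V S X"
      unfolding is_direct_sum_def
    proof (intro ballI conjI)
      fix i assume i: "i \<in> I"
      have WS: "p i ` vspace V i = {u + w |u w. u \<in> S i \<and> w \<in> W i}" "S i \<inter> W i = {0}"
        using W(2) i by (auto simp: is_direct_sum_def quotient_rep_def)
      show "vspace V i = {u + w |u w. u \<in> S i \<and> w \<in> X i}"
      proof
        show "{u + w |u w. u \<in> S i \<and> w \<in> X i} \<subseteq> vspace V i"
          using subrepD(2)[OF S i] subspace_add[OF rep_subspace[OF V i]] by (auto simp: X_def)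
        show "vspace V i \<subseteq> {u + w |u w. u \<in> S i \<and> w \<in> X i}"
        proof
          fix v assume v: "v \<in> vspace V i"
          then obtain s w where sw: "s \<in> S i" "w \<in> W i" "p i v = s + w" using WS(1) by blast
          have "p i (v - s) = w" using sw pS[OF i sw(1)] by (simp add: split_diff[OF V U(1) p i])
          then have "v - s \<in> X i"
            using sw(2) subspace_diff[OF rep_subspace[OF V i] v subrepD(2)[OF S i sw(1)]] by (simp add: X_def)
          moreover have "v = s + (v - s)" by simp
          ultimately show "v \<in> {u + w |u w. u \<in> S i \<and> w \<in> X i}" using sw(1) by blast
        qed
      qed
      show "S i \<inter> X i = {0}"
        using WS(2) pS[OF i] subspace_0[OF subrepD(1)[OF S i]] subspace_0[OF subrepD(1)[OF X i]]
        by (auto simp: X_def)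
    qed
    then show ?thesis using X by blast
  qed
qed

lemma indecomposable_imp_simple:
  assumes "indecomposable_rep scale \<Gamma> P' V"
  shows "simple_rep V"
proof -
  have V: "rep V" and nz: "nonzero_family \<Gamma> (vspace V)"
    and ind: "\<And>U W. subrep V U \<Longrightarrow> subrep V W \<Longrightarrow> is_direct_sum \<Gamma> V U W \<Longrightarrow>
       nonzero_family \<Gamma> U \<Longrightarrow> \<not> nonzero_family \<Gamma> W"
    using assms by (auto simp: indecomposable_rep_def)
  obtain S where S: "subrep V S" and simS: "simple_rep (restrict_rep V S)"
    using exists_simple_subrep[OF V nz] by blast
  obtain U where U: "subrep V U" "is_direct_sum \<Gamma> V S U"
    using simple_subrep_complement[OF V S simS] by blast
  have "\<not> nonzero_family \<Gamma> U" using ind[OF S U] simple_repD(2)[OF simS] by simp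
  then have "same_rep (restrict_rep V S) V"
    using U(2) by (auto simp: same_rep_def is_direct_sum_def nonzero_family_def)
  then show ?thesis by (rule same_rep_simple[OF _ simS V])
qed

text \<open>The isomorphism classes inject into the roots of the polynomials \<open>\<Sum>\<^sub>j d\<^sub>j P'\<^sub>j\<close>, with \<open>d\<close> a positive root:
  the class of \<open>V\<close> is the set of all indecomposable representations with the same loop scalar.\<close>

lemma finite_type: "finite_representation_type scale \<Gamma> P'"
proof -
  let ?A = "{V. indecomposable_rep scale \<Gamma> P' V}"
  let ?r = "{(V, W). indecomposable_rep scale \<Gamma> P' V \<and> indecomposable_rep scale \<Gamma> P' W \<and>
      isomorphic_reps scale \<Gamma> V W}"
  define \<Lambda> where "\<Lambda> = (\<Union>a\<in>positive_roots \<Gamma>. {z. poly (combination \<Gamma> P' a) z = 0})"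
  have "finite \<Lambda>"
    unfolding \<Lambda>_def
  proof (intro finite_UN_I finite_positive_roots[OF ADE] poly_roots_finite notI)
    fix a assume "a \<in> positive_roots \<Gamma>" "combination \<Gamma> P' a = 0"
    then have "0 \<in> B_set \<Gamma> P'" using positive_root_combination[OF ADE, of a P'] by simp
    then show False using no_multiple_root by (force simp: has_multiple_root_def)
  qed
  moreover have "?A // ?r \<subseteq> (\<lambda>z. {W \<in> ?A. loop_scalar W z}) ` \<Lambda>"
  proof
    fix X assume "X \<in> ?A // ?r"
    then obtain V where V: "V \<in> ?A" "X = ?r `` {V}" by (rule quotientE)
    have simV: "simple_rep V" using V(1) indecomposable_imp_simple by simp
    obtain z where z: "loop_scalar V z" using simple_loop_scalar[OF simV] by blast
    have "z \<in> \<Lambda>"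
      using dimvec_root[OF simple_repD(1)[OF simV] z] simple_dimvec_root[OF simV] by (auto simp: \<Lambda>_def)
    moreover have "isomorphic_reps scale \<Gamma> V W \<longleftrightarrow> loop_scalar W z" if W: "W \<in> ?A" for W
    proof
      assume "isomorphic_reps scale \<Gamma> V W"
      then obtain f where f: "morph V W f" and bij: "\<And>i. i \<in> I \<Longrightarrow> bij_betw (f i) (vspace V i) (vspace W i)"
        by (auto simp: isomorphic_reps_def)
      show "loop_scalar W z"
        unfolding loop_scalar_def
      proof (intro ballI)
        fix i w assume i: "i \<in> I" and "w \<in> vspace W i"
        then obtain v where v: "v \<in> vspace V i" "w = f i v" using bij[OF i] by (auto simp: bij_betw_def)
        then show "loop_map W i w = z *s w"
          using morphD(3)[OF f i v(1)] z i lin_scale[OF morphD(1)[OF f i] v(1)] by (simp add: loop_scalar_def)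
      qed
    next
      assume "loop_scalar W z"
      then show "isomorphic_reps scale \<Gamma> V W"
        using simple_iso[OF simV indecomposable_imp_simple z] W by (auto simp: isomorphic_reps_def is_iso_def)
    qed
    then have "X = {W \<in> ?A. loop_scalar W z}" using V by auto
    ultimately show "X \<in> (\<lambda>z. {W \<in> ?A. loop_scalar W z}) ` \<Lambda>" by blast
  qed
  ultimately show ?thesis
    unfolding finite_representation_type_def by (meson finite_imageI finite_subset)
qed

end

theorem mainTheorem1:
  fixes \<Gamma> :: dynkin
    and P' :: "nat \<Rightarrow> complex poly"
    and scale :: "complex \<Rightarrow> 'v::ab_group_add \<Rightarrow> 'v"
  assumes "vector_space scale"
    and "is_ADE \<Gamma>"
    and "\<forall>p\<in>B_set \<Gamma> P'. \<not> has_multiple_root p"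
    and "condition_star \<Gamma> P'"
  shows "finite_representation_type scale \<Gamma> P'"
proof -
  interpret vector_space scale by (rule assms(1))
  interpret generic_ade_quiver scale \<Gamma> P'
    by unfold_locales (use assms in auto)
  show ?thesis by (rule finite_type)
qed

end
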